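(* Let $\alpha\in\{0,1\}$. For each $n$ let $G_n=([n],E_n)$ be a simple graph and let $W=(w_{ij})_{1\le i,j\le n}$ be a symmetric matrix with $(w_{ij})_{i\le j}$ i.i.d. real random variables, independent of $G_n$, $w_{ji}=w_{ij}$. Let $T(G_n)$ be the diagonal matrix with $T(G_n)_{ii}=\sum_j w_{ij}A(G_n)_{ij}$, and $\bar\Delta_n=W\circ A(G_n)-\alpha T(G_n)$ (where $\circ$ is the entrywise product), with empirical spectral measure $\mu_{\bar\Delta_n}$. Assume (B): with $o$ a uniformly chosen vertex, the random variables $\sum_{k=1}^n A(G_n)_{ok}|w_{ok}|$, $n\in\mathbb N$, are uniformly integrable. (i) If the $G_n$ are deterministic and $U(G_n)\Rightarrow\rho$ for some probability measure $\rho$ on $\mathcal G^*$, then there is a probability measure $\nu$ on $\mathbb R$ such that almost surely $\mu_{\bar\Delta_n}\to\nu$ weakly. (ii) If the $G_n$ are random and $\mathbb E[U_2(G_n)]\Rightarrow\rho\otimes\rho$ for some probability measure $\rho$ on $\mathcal G^*$, then there is a probability measure $\nu$ on $\mathbb R$ such that $\lim_{n\to\infty}\mathbb E\,L(\mu_{\bar\Delta_n},\nu)=0$.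
   Context: $A(G)$ is the adjacency matrix. The empirical spectral measure of an $n\times n$ symmetric matrix $M$ is $n^{-1}\sum_i\delta_{\lambda_i(M)}$. $L$ is the Lévy distance, $L(\mu,\nu)=\inf\{h\ge0:\forall x,\ \mu((-\infty,x-h])-h\le\nu((-\infty,x])\le\mu((-\infty,x-h])+h\}$. $\mathcal G^*$ is the space of rooted-isomorphism classes of rooted connected locally finite graphs with the local metric (distance $1/(r+1)$, $r$ the supremum of radii for which the balls around the roots are rooted-isomorphic). $U(G)$ is the law of $[G,o]$ (component of $o$ rooted at $o$) for a uniform vertex $o$; $U_2(G)$ the law of $([G,o_1],[G,o_2])$ for a uniform pair $(o_1,o_2)$; $\mathbb E[U_2(G_n)](B)=\mathbb E[U_2(G_n)(B)]$; $\Rightarrow$ is weak convergence.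
   Formalization: The Lévy distance is taken in its standard form, with upper bound μ((−∞,x+h])+h (the printed x−h makes (ii) false); the weights are one infinite i.i.d. array, and in (ii) they are independent of the whole sequence (G_n). *)

theory Defs
  imports "HOL-Probability.Probability" "Jordan_Normal_Form.Char_Poly"
begin

definition simple_graph_on :: "nat \<Rightarrow> (nat \<Rightarrow> nat \<Rightarrow> bool) \<Rightarrow> bool" where
  "simple_graph_on n A \<longleftrightarrow> (\<forall>i j. A i j \<longrightarrow> i < n \<and> j < n) \<and> (\<forall>i j. A i j \<longrightarrow> A j i) \<and> (\<forall>i. \<not> A i i)"

definition adj :: "(nat \<Rightarrow> nat \<Rightarrow> bool) \<Rightarrow> nat \<Rightarrow> nat \<Rightarrow> real" where
  "adj A i j = (if A i j then 1 else 0)"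

definition eigs :: "nat \<Rightarrow> (nat \<Rightarrow> nat \<Rightarrow> real) \<Rightarrow> real multiset" where
  "eigs n M = proots (char_poly (mat n n (\<lambda>(i, j). M i j)))"

definition esd :: "nat \<Rightarrow> (nat \<Rightarrow> nat \<Rightarrow> real) \<Rightarrow> real measure" where
  "esd n M = measure_pmf (pmf_of_multiset (eigs n M))"

definition levy_dist :: "real measure \<Rightarrow> real measure \<Rightarrow> real" where
  "levy_dist \<mu> \<nu> = Inf {h. h \<ge> 0 \<and> (\<forall>x. measure \<mu> {..x - h} - h \<le> measure \<nu> {..x}
                                     \<and> measure \<nu> {..x} \<le> measure \<mu> {..x + h} + h)}"

definition Delta :: "real \<Rightarrow> nat \<Rightarrow> (nat \<Rightarrow> nat \<Rightarrow> real) \<Rightarrow> (nat \<Rightarrow> nat \<Rightarrow> bool) \<Rightarrow> nat \<Rightarrow> nat \<Rightarrow> real" where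
  "Delta \<alpha> n W A i j = W i j * adj A i j - \<alpha> * (if i = j then (\<Sum>k<n. W i k * adj A i k) else 0)"

definition wdeg :: "nat \<Rightarrow> (nat \<Rightarrow> nat \<Rightarrow> real) \<Rightarrow> (nat \<Rightarrow> nat \<Rightarrow> bool) \<Rightarrow> nat \<Rightarrow> real" where
  "wdeg n W A v0 = (\<Sum>k<n. adj A v0 k * \<bar>W v0 k\<bar>)"

text \<open>A rooted graph is represented as (V, E, root) with vertices natural numbers.
  Rooted-isomorphism classes are handled via the (pseudo)metric below, which vanishes
  exactly on rooted-isomorphic pairs; the sigma-algebra is generated by the
  (isomorphism-saturated) open sets, so measures on it are exactly the Borel measures on G*.\<close>

type_synonym rgraph = "nat set \<times> (nat \<Rightarrow> nat \<Rightarrow> bool) \<times> nat"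

definition rg_edge :: "rgraph \<Rightarrow> nat \<Rightarrow> nat \<Rightarrow> bool" where
  "rg_edge G x y \<longleftrightarrow> x \<in> fst G \<and> y \<in> fst G \<and> fst (snd G) x y"

definition rooted_iso :: "rgraph \<Rightarrow> rgraph \<Rightarrow> bool" where
  "rooted_iso G H \<longleftrightarrow> (\<exists>f. bij_betw f (fst G) (fst H) \<and> f (snd (snd G)) = snd (snd H) \<and>
      (\<forall>u\<in>fst G. \<forall>v\<in>fst G. rg_edge G u v \<longleftrightarrow> rg_edge H (f u) (f v)))"

definition rg_ball :: "nat \<Rightarrow> rgraph \<Rightarrow> rgraph" where
  "rg_ball r G = (let B = {v \<in> fst G. \<exists>k\<le>r. (rg_edge G ^^ k) (snd (snd G)) v}
                  in (B, \<lambda>x y. x \<in> B \<and> y \<in> B \<and> rg_edge G x y, snd (snd G)))"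

definition rooted_graph :: "rgraph \<Rightarrow> bool" where
  "rooted_graph G \<longleftrightarrow> snd (snd G) \<in> fst G
     \<and> (\<forall>x y. rg_edge G x y \<longrightarrow> rg_edge G y x) \<and> (\<forall>x. \<not> rg_edge G x x)
     \<and> (\<forall>v\<in>fst G. (rg_edge G)\<^sup>*\<^sup>* (snd (snd G)) v)
     \<and> (\<forall>v\<in>fst G. finite {u. rg_edge G v u})"

definition Gstar :: "rgraph set" where
  "Gstar = {G. rooted_graph G}"

definition ldist :: "rgraph \<Rightarrow> rgraph \<Rightarrow> real" where
  "ldist G H = (if \<forall>r. rooted_iso (rg_ball r G) (rg_ball r H) then 0
               else 1 / (real (Sup {r. rooted_iso (rg_ball r G) (rg_ball r H)}) + 1))"

definition gs_open :: "rgraph set \<Rightarrow> bool" where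
  "gs_open U \<longleftrightarrow> U \<subseteq> Gstar \<and> (\<forall>x\<in>U. \<exists>e>0. \<forall>y\<in>Gstar. ldist x y < e \<longrightarrow> y \<in> U)"

definition gs_borel :: "rgraph measure" where
  "gs_borel = sigma Gstar {U. gs_open U}"

definition gs_bcont :: "(rgraph \<Rightarrow> real) \<Rightarrow> bool" where
  "gs_bcont f \<longleftrightarrow> (\<exists>B. \<forall>x\<in>Gstar. \<bar>f x\<bar> \<le> B) \<and>
     (\<forall>x\<in>Gstar. \<forall>e>0. \<exists>d>0. \<forall>y\<in>Gstar. ldist x y < d \<longrightarrow> \<bar>f y - f x\<bar> < e)"

definition gs2_bcont :: "(rgraph \<times> rgraph \<Rightarrow> real) \<Rightarrow> bool" where
  "gs2_bcont F \<longleftrightarrow> (\<exists>B. \<forall>x\<in>Gstar \<times> Gstar. \<bar>F x\<bar> \<le> B) \<and>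
     (\<forall>x\<in>Gstar \<times> Gstar. \<forall>e>0. \<exists>d>0. \<forall>y\<in>Gstar \<times> Gstar.
        max (ldist (fst x) (fst y)) (ldist (snd x) (snd y)) < d \<longrightarrow> \<bar>F y - F x\<bar> < e)"

definition comp_at :: "nat \<Rightarrow> (nat \<Rightarrow> nat \<Rightarrow> bool) \<Rightarrow> nat \<Rightarrow> rgraph" where
  "comp_at n A v0 = (let V = {v. v < n \<and> (\<lambda>x y. x < n \<and> y < n \<and> A x y)\<^sup>*\<^sup>* v0 v}
                    in (V, \<lambda>x y. x \<in> V \<and> y \<in> V \<and> A x y, v0))"

definition local_conv :: "(nat \<Rightarrow> nat \<Rightarrow> nat \<Rightarrow> bool) \<Rightarrow> rgraph measure \<Rightarrow> bool" where
  "local_conv G \<rho> \<longleftrightarrow> (\<forall>f. gs_bcont f \<longrightarrow>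
     (\<lambda>n. (\<Sum>v0<n. f (comp_at n (G n) v0)) / real n) \<longlonglongrightarrow> (\<integral>x. f x \<partial>\<rho>))"

definition local_conv2 :: "'a measure \<Rightarrow> (nat \<Rightarrow> 'a \<Rightarrow> nat \<Rightarrow> nat \<Rightarrow> bool) \<Rightarrow> rgraph measure \<Rightarrow> bool" where
  "local_conv2 M G \<rho> \<longleftrightarrow> (\<forall>F. gs2_bcont F \<longrightarrow>
     (\<lambda>n. \<integral>\<omega>. (\<Sum>o1<n. \<Sum>o2<n. F (comp_at n (G n \<omega>) o1, comp_at n (G n \<omega>) o2)) / (real n)\<^sup>2 \<partial>M)
       \<longlonglongrightarrow> (\<integral>z. F z \<partial>(\<rho> \<Otimes>\<^sub>M \<rho>)))"

end

theory Submission
  imports Defs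
begin

text \<open>
  All information about a spectral measure is taken from ramp functions, that is, functions equal to 1
  on \<open>(-\<infinity>, a]\<close>, to 0 on \<open>[b, \<infinity>)\<close> and linear in between. Counting eigenvalues by the min-max principle gives
  two bounds for the sum of a ramp over the eigenvalues of a symmetric matrix: it moves by at most
  \<open>q\<close> if only \<open>q\<close> rows and columns are changed, and it is Lipschitz in the entrywise \<open>l1\<close> norm.

  By the first bound, changing one weight moves the normalised ramp statistic by \<open>O(1/n)\<close>. Condition (B)
  bounds the expected number of edges by \<open>O(n)\<close>, so the bounded differences method makes the statistic
  concentrate around its mean given the graph, with summable tails. By the second bound and condition (B),
  the weights at vertices of weighted degree above \<open>K\<close> can be deleted. The spectrum then lies in
  \<open>[-2K, 2K]\<close>, the ramp may be replaced by a polynomial, and the mean of the statistic becomes the average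
  over the vertices of the expected weight of closed walks: a bounded function of a ball around the
  vertex, continuous on the space of rooted graphs, because the weights are identically distributed.
  Hence the means converge, and the limits for all ramps determine the limit distribution.
\<close>

section \<open>Eigenvalues of real symmetric matrices\<close>

text \<open>At most one absolute moment of the weights is under control, so neither norms nor
  moments of the full matrix can be used; this is why two perturbation bounds are kept side by side.
  The first ignores the size of a weight and serves concentration, the second asks only for first
  moments and serves truncation and tightness. Condition (B) bounds weighted degrees; the passage to
  edge counts divides by E|w_00|, and if that number is 0, then the weights on edges vanish almost
  surely and the statistic is deterministic. The limit law is not built from an operator on the
  limit graph: the means of a ramp statistic are uniformly close to convergent local averages, hence
  form a Cauchy sequence. For random graphs the same argument runs with the graph frozen, which is
  elementary because for each n only finitely many graphs exist. Convergence for two independent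
  roots supplies the first two moments of every local average, hence convergence in mean to a
  constant; a single root would leave room for a random limit.\<close>

lemma underdetermined_system_nat:
  fixes c :: "nat \<Rightarrow> nat \<Rightarrow> real"
  assumes "m < k"
  shows "\<exists>y. (\<exists>i<k. y i \<noteq> 0) \<and> (\<forall>e<m. (\<Sum>i<k. c e i * y i) = 0)"
proof -
  \<comment> \<open>Zero rows are appended to the m equations to get a square matrix. As m < k, row
    m is zero, so the determinant vanishes and a kernel vector exists.\<close>
  define C where "C = mat k k (\<lambda>(e, i). if e < m then c e i else 0)"
  have C: "C \<in> carrier_mat k k" by (simp add: C_def)
  have "row C m = 0\<^sub>v k" using assms by (intro eq_vecI) (auto simp: C_def)
  then have "det C = 0"
  proof -
    have "C = mat\<^sub>r k k (\<lambda>i. if i = m then 0\<^sub>v k else row C i)"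
      using assms by (intro eq_matI) (auto simp: C_def)
    then have "det C = det (mat\<^sub>r k k (\<lambda>i. if i = m then 0\<^sub>v k else row C i))" by (rule arg_cong)
    also have "\<dots> = 0" by (rule det_row_0) (use assms C in auto)
    finally show ?thesis .
  qed
  then obtain v where v: "v \<in> carrier_vec k" "v \<noteq> 0\<^sub>v k" "C *\<^sub>v v = 0\<^sub>v k"
    using det_0_iff_vec_prod_zero[OF C] by auto
  have "\<exists>i<k. v $ i \<noteq> 0" using v(1,2) by (metis eq_vecI carrier_vecD index_zero_vec zero_carrier_vec)
  moreover have "(\<Sum>i<k. c e i * v $ i) = 0" if "e < m" for e
  proof -
    have "(C *\<^sub>v v) $ e = 0" using v(3) that assms by simp
    then show ?thesis using that assms v(1)
      by (simp add: C_def scalar_prod_def atLeast0LessThan)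
  qed
  ultimately show ?thesis by blast
qed

text \<open>Transport along enumerations. Arbitrary index types are wanted because the equations
  will be indexed by a disjoint sum of eigenvectors and constraints.\<close>

lemma underdetermined_system:
  fixes c :: "'e \<Rightarrow> 'i \<Rightarrow> real"
  assumes "finite E" "finite I" "card E < card I"
  shows "\<exists>y. (\<exists>i\<in>I. y i \<noteq> 0) \<and> (\<forall>e\<in>E. (\<Sum>i\<in>I. c e i * y i) = 0)"
proof -
  obtain f where f: "bij_betw f {0..<card E} E" using ex_bij_betw_nat_finite assms by blast
  obtain g where g: "bij_betw g {0..<card I} I" using ex_bij_betw_nat_finite assms by blast
  obtain y where y: "\<exists>i<card I. y i \<noteq> 0" "\<And>e. e < card E \<Longrightarrow> (\<Sum>i<card I. c (f e) (g i) * y i) = 0"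
    using underdetermined_system_nat[OF assms(3), of "\<lambda>e i. c (f e) (g i)"] by blast
  define z where "z = y \<circ> the_inv_into {0..<card I} g"
  have zg: "z (g i) = y i" if "i < card I" for i
    using that g by (simp add: z_def the_inv_into_f_f bij_betw_def)
  have "(\<Sum>i\<in>I. c e i * z i) = 0" if e: "e \<in> E" for e
  proof -
    obtain e' where e': "e' < card E" "e = f e'" using f e by (metis atLeastLessThan_iff bij_betw_imp_surj_on imageE)
    have "(\<Sum>i\<in>I. c e i * z i) = (\<Sum>i\<in>{0..<card I}. c e (g i) * z (g i))"
      by (rule sum.reindex_bij_betw[OF g, symmetric])
    also have "\<dots> = (\<Sum>i<card I. c (f e') (g i) * y i)"
      by (rule sum.cong) (auto simp: zg e')
    finally show ?thesis using y(2)[OF e'(1)] by simp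
  qed
  moreover have "\<exists>i\<in>I. z i \<noteq> 0" using y(1) zg g by (force simp: bij_betw_def)
  ultimately show ?thesis by blast
qed

text \<open>The fundamental theorem of algebra gives a complex eigenvector. Symmetry makes the
  eigenvalue real, so real and imaginary part satisfy the same real equation, and one of them is
  nonzero.\<close>

lemma symmetric_real_eigenvector:
  fixes M :: "nat \<Rightarrow> nat \<Rightarrow> real"
  assumes sym: "\<And>i j. i < n \<Longrightarrow> j < n \<Longrightarrow> M i j = M j i" and n: "n > 0"
  shows "\<exists>l v. (\<Sum>a<n. v a * v a) = 1 \<and> (\<forall>a<n. (\<Sum>b<n. M a b * v b) = l * v a)"
proof -
  define C where "C = mat n n (\<lambda>(i, j). complex_of_real (M i j))"
  have C: "C \<in> carrier_mat n n" by (simp add: C_def)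
  have "degree (char_poly C) = n" using degree_monic_char_poly[OF C] by simp
  then have "\<not> constant (poly (char_poly C))" using n by (simp add: constant_degree)
  then obtain l where "poly (char_poly C) l = 0" using fundamental_theorem_of_algebra by blast
  then have "eigenvalue C l" using eigenvalue_root_char_poly[OF C] by simp
  then obtain v where v: "v \<in> carrier_vec n" "v \<noteq> 0\<^sub>v n" "C *\<^sub>v v = l \<cdot>\<^sub>v v"
    using C by (auto simp: eigenvalue_def eigenvector_def)
  have ev: "(\<Sum>b<n. of_real (M a b) * v $ b) = l * v $ a" if "a < n" for a
  proof -
    have "(C *\<^sub>v v) $ a = l * v $ a" using v that by simp
    then show ?thesis using that v(1)
      by (simp add: C_def scalar_prod_def atLeast0LessThan)
  qed
  obtain a0 where a0: "a0 < n" "v $ a0 \<noteq> 0"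
    using v(1,2) by (metis eq_vecI carrier_vecD index_zero_vec zero_carrier_vec)
  \<comment> \<open>\<open>S\<close> is the Hermitian form at \<open>v\<close>: it equals
    \<open>l\<close> times the squared norm of \<open>v\<close> and, by symmetry, its own
    conjugate.\<close>
  define S where "S = (\<Sum>a<n. \<Sum>b<n. cnj (v $ a) * (of_real (M a b) * v $ b))"
  have S1: "S = l * of_real (\<Sum>a<n. (cmod (v $ a))\<^sup>2)"
  proof -
    have "S = (\<Sum>a<n. cnj (v $ a) * (l * v $ a))"
      unfolding S_def by (rule sum.cong[OF refl]) (simp add: ev flip: sum_distrib_left)
    also have "\<dots> = l * (\<Sum>a<n. v $ a * cnj (v $ a))"
      by (simp add: sum_distrib_left mult_ac)
    finally show ?thesis by (simp add: complex_norm_square[symmetric] del: of_real_power)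
  qed
  have "cnj S = (\<Sum>a<n. \<Sum>b<n. cnj (v $ b) * (of_real (M b a) * v $ a))"
    unfolding S_def cnj_sum by (intro sum.cong refl) (simp add: sym mult_ac)
  also have "\<dots> = S" unfolding S_def by (rule sum.swap)
  finally have "cnj S = S" .
  moreover have pos: "(\<Sum>a<n. (cmod (v $ a))\<^sup>2) > 0"
    using a0 by (intro sum_pos2[of _ a0]) auto
  ultimately have "cnj l = l" unfolding S1 by (simp del: of_real_sum of_real_power)
  then have lr: "l = of_real (Re l)" by (metis Reals_cnj_iff of_real_Re)
  have ev2: "(\<Sum>b<n. M a b * Re (v $ b)) = Re l * Re (v $ a)"
    "(\<Sum>b<n. M a b * Im (v $ b)) = Re l * Im (v $ a)" if "a < n" for a
    using arg_cong[OF ev[OF that], of Re] arg_cong[OF ev[OF that], of Im] lr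
    by (simp_all add: complex_eq_iff)
  have norm: ?thesis if x: "x a0 \<noteq> 0" and e: "\<And>a. a < n \<Longrightarrow> (\<Sum>b<n. M a b * x b) = Re l * x a"
    for x :: "nat \<Rightarrow> real"
  proof -
    define s where "s = (\<Sum>a<n. x a * x a)"
    have s: "s > 0" unfolding s_def using x a0 by (intro sum_pos2[of _ a0]) (auto simp: mult_pos_pos not_square_less_zero zero_less_mult_iff)
    have "(\<Sum>a<n. (x a / sqrt s) * (x a / sqrt s)) = 1"
      using s by (simp add: flip: sum_divide_distrib s_def)
    moreover have "(\<Sum>b<n. M a b * (x b / sqrt s)) = Re l * (x a / sqrt s)" if "a < n" for a
      using e[OF that] by (simp flip: sum_divide_distrib)
    ultimately show ?thesis by (intro exI[of _ "Re l"] exI[of _ "\<lambda>a. x a / sqrt s"]) blast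
  qed
  from a0(2) have "Re (v $ a0) \<noteq> 0 \<or> Im (v $ a0) \<noteq> 0" by (simp add: complex_eq_iff)
  then show ?thesis using norm[OF _ ev2(1)] norm[OF _ ev2(2)] by blast
qed

text \<open>\<open>H\<close> is the Householder reflection that exchanges \<open>v\<close> with the
  first unit vector; being symmetric and orthogonal, it is its own inverse. If
  \<open>v 0 = 1\<close>, then \<open>v\<close> is that unit vector and the identity serves.\<close>

lemma orthonormal_completion:
  fixes v :: "nat \<Rightarrow> real"
  assumes v: "(\<Sum>a<n. v a * v a) = 1" and n: "n > 0"
  shows "\<exists>H. (\<forall>a<n. \<forall>b<n. H a b = H b a) \<and> (\<forall>a<n. H a 0 = v a) \<and>
     (\<forall>a<n. \<forall>b<n. (\<Sum>c<n. H a c * H c b) = (if a = b then 1 else 0))"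
proof (cases "v 0 = 1")
  case True
  have "(\<Sum>a<n. v a * v a) = v 0 * v 0 + (\<Sum>a\<in>{..<n} - {0}. v a * v a)"
    using n by (subst sum.remove[of _ 0]) auto
  then have "(\<Sum>a\<in>{..<n} - {0}. v a * v a) = 0" using v True by simp
  then have "v a = 0" if "a < n" "a \<noteq> 0" for a
    using that by (subst (asm) sum_nonneg_eq_0_iff) auto
  then show ?thesis using True
    by (intro exI[of _ "\<lambda>a b. if a = b then 1 else 0"]) (auto simp: sum.delta if_distrib[of "\<lambda>x. x * _"] cong: if_cong)
next
  case False
  define u where "u a = v a - (if a = 0 then 1 else 0)" for a
  \<comment> \<open>\<open>2 * s\<close> is the squared norm of \<open>u\<close>, so division by
    \<open>s\<close> produces the usual reflection coefficient 2 / |u|^2.\<close>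
  define s where "s = 1 - v 0"
  define H where "H a b = (if a = b then 1 else 0) - u a * u b / s" for a b
  have s: "s \<noteq> 0" using False by (simp add: s_def)
  have uu: "(\<Sum>a<n. u a * u a) = 2 * s"
  proof -
    have "(\<Sum>a<n. u a * u a) = (\<Sum>a<n. v a * v a + (if a = 0 then 1 - 2 * v 0 else 0))"
      by (intro sum.cong refl) (auto simp: u_def algebra_simps)
    also have "\<dots> = 2 * s" using n by (simp add: sum.distrib v sum.delta' s_def)
    finally show ?thesis .
  qed
  have u0: "u 0 = - s" by (simp add: u_def s_def)
  have "(\<Sum>c<n. H a c * H c b) = (if a = b then 1 else 0)" if "a < n" "b < n" for a b
  proof -
    have "(\<Sum>c<n. H a c * H c b) = (\<Sum>c<n. (if a = c then (if c = b then 1 else 0) - u c * u b / s else 0)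
         - (if c = b then u a * u c / s else 0)) + u a * u b / s\<^sup>2 * (\<Sum>c<n. u c * u c)"
      unfolding sum_distrib_left sum.distrib[symmetric] by (intro sum.cong refl) (auto simp: H_def algebra_simps power2_eq_square)
    also have "\<dots> = (if a = b then 1 else 0) - u a * u b / s - u a * u b / s + u a * u b / s\<^sup>2 * (2 * s)"
      using that by (simp add: sum.distrib sum_subtractf sum.delta sum.delta' uu)
    also have "\<dots> = (if a = b then 1 else 0)" using s by (simp add: field_simps power2_eq_square)
    finally show ?thesis .
  qed
  moreover have "H a 0 = v a" for a using s unfolding H_def u0 by (auto simp: u_def)
  moreover have "H a b = H b a" for a b by (auto simp: H_def)
  ultimately show ?thesis by blast
qed

text \<open>Deflation: conjugation by a reflection whose first column is a unit eigenvector splits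
  off one eigenvalue, and the induction hypothesis applies to the remaining block.\<close>

lemma symmetric_orthonormal_eigenbasis:
  fixes M :: "nat \<Rightarrow> nat \<Rightarrow> real"
  assumes "\<And>i j. i < n \<Longrightarrow> j < n \<Longrightarrow> M i j = M j i"
  shows "\<exists>l u. (\<forall>i<n. \<forall>j<n. (\<Sum>a<n. u i a * u j a) = (if i = j then 1 else 0)) \<and>
     (\<forall>i<n. \<forall>a<n. (\<Sum>b<n. M a b * u i b) = l i * u i a)"
  using assms
proof (induction n arbitrary: M)
  case 0
  then show ?case by simp
next
  case (Suc m)
  let ?n = "Suc m"
  have sym: "M i j = M j i" if "i < ?n" "j < ?n" for i j using Suc.prems that by blast
  obtain l0 v where v: "(\<Sum>a<?n. v a * v a) = 1"
    and ev: "\<And>a. a < ?n \<Longrightarrow> (\<Sum>b<?n. M a b * v b) = l0 * v a"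
    using symmetric_real_eigenvector[of ?n M] sym by blast
  obtain H where Hs: "\<And>a b. a < ?n \<Longrightarrow> b < ?n \<Longrightarrow> H a b = H b a" and H0: "\<And>a. a < ?n \<Longrightarrow> H a 0 = v a"
    and HH: "\<And>a b. a < ?n \<Longrightarrow> b < ?n \<Longrightarrow> (\<Sum>c<?n. H a c * H c b) = (if a = b then 1 else 0)"
    using orthonormal_completion[OF v] by blast
  \<comment> \<open>\<open>B\<close> is H M H. Since H is its own inverse, M H = H B, and the first
    column of \<open>B\<close> is \<open>l0\<close> times the first unit vector.\<close>
  define B where "B i j = (\<Sum>a<?n. \<Sum>b<?n. H i a * M a b * H b j)" for i j
  have Bs: "B i j = B j i" if "i < ?n" "j < ?n" for i j
  proof -
    have "B i j = (\<Sum>b<?n. \<Sum>a<?n. H i a * M a b * H b j)" unfolding B_def by (rule sum.swap)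
    also have "\<dots> = B j i" unfolding B_def
      by (intro sum.cong refl) (use that in \<open>simp add: Hs[of i] Hs[of _ j] sym mult_ac\<close>)
    finally show ?thesis .
  qed
  have MH: "(\<Sum>b<?n. M a b * H b j) = (\<Sum>c<?n. H a c * B c j)" if "a < ?n" "j < ?n" for a j
  proof -
    have "(\<Sum>c<?n. H a c * B c j) = (\<Sum>c<?n. \<Sum>d<?n. \<Sum>b<?n. H a c * H c d * (M d b * H b j))"
      unfolding B_def by (simp add: sum_distrib_left mult_ac del: sum.lessThan_Suc)
    also have "\<dots> = (\<Sum>d<?n. \<Sum>b<?n. \<Sum>c<?n. H a c * H c d * (M d b * H b j))"
      by (subst sum.swap, rule sum.cong[OF refl], rule sum.swap)
    also have "\<dots> = (\<Sum>d<?n. \<Sum>b<?n. (if a = d then M d b * H b j else 0))"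
      by (intro sum.cong refl) (use that HH in \<open>simp add: flip: sum_distrib_right del: sum.lessThan_Suc\<close>)
    also have "\<dots> = (\<Sum>d<?n. if a = d then (\<Sum>b<?n. M d b * H b j) else 0)"
      by (intro sum.cong refl) auto
    also have "\<dots> = (\<Sum>b<?n. M a b * H b j)"
      using that by (subst sum.delta') auto
    finally show ?thesis by simp
  qed
  have B0: "B i 0 = (if i = 0 then l0 else 0)" if "i < ?n" for i
  proof -
    have "B i 0 = (\<Sum>a<?n. H i a * (\<Sum>b<?n. M a b * v b))"
      unfolding B_def by (intro sum.cong refl) (simp add: H0 sum_distrib_left mult_ac del: sum.lessThan_Suc)
    also have "\<dots> = (\<Sum>a<?n. l0 * (H i a * H a 0))"
      by (intro sum.cong refl) (simp add: H0 ev del: sum.lessThan_Suc)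
    also have "\<dots> = l0 * (\<Sum>a<?n. H i a * H a 0)" by (simp only: sum_distrib_left)
    also have "\<dots> = (if i = 0 then l0 else 0)" using HH[OF that, of 0] by simp
    finally show ?thesis .
  qed
  obtain l' u' where u'1: "\<And>i j. i < m \<Longrightarrow> j < m \<Longrightarrow> (\<Sum>a<m. u' i a * u' j a) = (if i = j then 1 else 0)"
    and u'2: "\<And>i a. i < m \<Longrightarrow> a < m \<Longrightarrow> (\<Sum>b<m. B (Suc a) (Suc b) * u' i b) = l' i * u' i a"
  proof -
    have "\<exists>l u. (\<forall>i<m. \<forall>j<m. (\<Sum>a<m. u i a * u j a) = (if i = j then 1 else 0)) \<and>
       (\<forall>i<m. \<forall>a<m. (\<Sum>b<m. B (Suc a) (Suc b) * u i b) = l i * u i a)"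
      by (rule Suc.IH) (simp add: Bs)
    then show ?thesis using that by blast
  qed
  \<comment> \<open>Eigenvectors of \<open>B\<close> are the first unit vector and those of the
    block with a zero in front; applying H carries them back to \<open>M\<close>.\<close>
  define l where "l i = (case i of 0 \<Rightarrow> l0 | Suc i \<Rightarrow> l' i)" for i
  define t where "t i a = (case i of 0 \<Rightarrow> (if a = 0 then 1 else 0) | Suc i \<Rightarrow> (case a of 0 \<Rightarrow> 0 | Suc a \<Rightarrow> u' i a))"
    for i a :: nat
  have t1: "(\<Sum>a<?n. t i a * t j a) = (if i = j then 1 else 0)" if "i < ?n" "j < ?n" for i j
  proof -
    have "(\<Sum>a<?n. t i a * t j a) = t i 0 * t j 0 + (\<Sum>a<m. t i (Suc a) * t j (Suc a))"
      by (rule sum.lessThan_Suc_shift)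
    then show ?thesis using that u'1[of "i - 1" "j - 1"] by (cases i; cases j) (simp_all add: t_def)
  qed
  have t2: "(\<Sum>b<?n. B a b * t i b) = l i * t i a" if "i < ?n" "a < ?n" for i a
  proof (cases i)
    case 0
    then show ?thesis using B0[OF that(2)] by (simp add: t_def l_def sum.lessThan_Suc_shift del: sum.lessThan_Suc)
  next
    case (Suc i')
    show ?thesis
    proof (cases a)
      case 0
      have "B 0 (Suc b) = 0" if "b < m" for b using Bs[of 0 "Suc b"] B0[of "Suc b"] that by simp
      then show ?thesis using 0 Suc by (simp add: t_def sum.lessThan_Suc_shift del: sum.lessThan_Suc)
    next
      case (Suc a')
      then show ?thesis using \<open>i = Suc i'\<close> that u'2[of i' a']
        by (simp add: t_def l_def sum.lessThan_Suc_shift del: sum.lessThan_Suc)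
    qed
  qed
  define u where "u i a = (\<Sum>c<?n. H a c * t i c)" for i a
  have "(\<Sum>a<?n. u i a * u j a) = (if i = j then 1 else 0)" if "i < ?n" "j < ?n" for i j
  proof -
    have "(\<Sum>a<?n. u i a * u j a) = (\<Sum>a<?n. \<Sum>c<?n. \<Sum>d<?n. (H c a * H a d) * (t i c * t j d))"
      unfolding u_def sum_product
      by (intro sum.cong refl) (simp add: Hs mult_ac del: sum.lessThan_Suc)
    also have "\<dots> = (\<Sum>c<?n. \<Sum>d<?n. \<Sum>a<?n. (H c a * H a d) * (t i c * t j d))"
      by (subst sum.swap, rule sum.cong[OF refl], rule sum.swap)
    also have "\<dots> = (\<Sum>c<?n. \<Sum>d<?n. if c = d then t i c * t j d else 0)"
      by (intro sum.cong refl) (use HH in \<open>simp add: flip: sum_distrib_right del: sum.lessThan_Suc\<close>)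
    also have "\<dots> = (\<Sum>c<?n. t i c * t j c)"
      by (intro sum.cong refl) (subst sum.delta', auto)
    finally show ?thesis using t1[OF that] by simp
  qed
  moreover have "(\<Sum>b<?n. M a b * u i b) = l i * u i a" if "i < ?n" "a < ?n" for i a
  proof -
    have "(\<Sum>b<?n. M a b * u i b) = (\<Sum>c<?n. (\<Sum>b<?n. M a b * H b c) * t i c)"
      unfolding u_def sum_distrib_left sum_distrib_right by (subst sum.swap) (simp add: mult_ac del: sum.lessThan_Suc)
    also have "\<dots> = (\<Sum>c<?n. \<Sum>d<?n. H a d * B d c * t i c)"
      using that by (intro sum.cong refl) (simp add: MH sum_distrib_right del: sum.lessThan_Suc)
    also have "\<dots> = (\<Sum>d<?n. H a d * (\<Sum>c<?n. B d c * t i c))"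
      unfolding sum_distrib_left by (subst sum.swap) (simp add: mult_ac del: sum.lessThan_Suc)
    also have "\<dots> = (\<Sum>d<?n. l i * (H a d * t i d))"
      using that by (intro sum.cong refl) (simp add: t2 del: sum.lessThan_Suc)
    also have "\<dots> = l i * u i a" unfolding u_def by (simp only: sum_distrib_left)
    finally show ?thesis .
  qed
  ultimately show ?case by blast
qed

text \<open>Orthonormality is recorded for rows and for columns of \<open>u\<close>: coefficient
  formulas use the former, expansions and Parseval the latter. The last clause ties \<open>l\<close>
  to the roots of the characteristic polynomial with multiplicity; the order of \<open>l\<close> is
  immaterial.\<close>

definition eigensystem :: "nat \<Rightarrow> (nat \<Rightarrow> nat \<Rightarrow> real) \<Rightarrow> (nat \<Rightarrow> real) \<Rightarrow> (nat \<Rightarrow> nat \<Rightarrow> real) \<Rightarrow> bool" where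
  "eigensystem n M l u \<longleftrightarrow>
     (\<forall>i<n. \<forall>j<n. (\<Sum>a<n. u i a * u j a) = (if i = j then 1 else 0)) \<and>
     (\<forall>a<n. \<forall>b<n. (\<Sum>i<n. u i a * u i b) = (if a = b then 1 else 0)) \<and>
     (\<forall>i<n. \<forall>a<n. (\<Sum>b<n. M a b * u i b) = l i * u i a) \<and>
     eigs n M = image_mset l (mset_set {..<n})"

text \<open>With the eigenvectors as rows of U, U U^T = 1 implies U^T U = 1. The matrix is thus
  similar to a diagonal one, and its characteristic polynomial factors accordingly.\<close>

lemma eigensystem_exists:
  fixes M :: "nat \<Rightarrow> nat \<Rightarrow> real"
  assumes "\<And>i j. i < n \<Longrightarrow> j < n \<Longrightarrow> M i j = M j i"
  shows "\<exists>l u. eigensystem n M l u"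
proof -
  obtain l u where o: "\<And>i j. i < n \<Longrightarrow> j < n \<Longrightarrow> (\<Sum>a<n. u i a * u j a) = (if i = j then 1 else 0)"
    and e: "\<And>i a. i < n \<Longrightarrow> a < n \<Longrightarrow> (\<Sum>b<n. M a b * u i b) = l i * u i a"
    using symmetric_orthonormal_eigenbasis[of n M] assms by blast
  define A where "A = mat n n (\<lambda>(i, j). M i j)"
  define U where "U = mat n n (\<lambda>(i, a). u i a)"
  define D where "D = mat n n (\<lambda>(i, j). if i = j then l i else 0)"
  have car: "A \<in> carrier_mat n n" "U \<in> carrier_mat n n" "D \<in> carrier_mat n n" "U\<^sup>T \<in> carrier_mat n n"
    by (simp_all add: A_def U_def D_def)
  have UUt: "U * U\<^sup>T = 1\<^sub>m n"
    by (rule eq_matI) (simp_all add: U_def scalar_prod_def atLeast0LessThan o)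
  have UtU: "U\<^sup>T * U = 1\<^sub>m n"
    by (rule mat_mult_left_right_inverse[OF car(2,4) UUt])
  have c: "(\<Sum>i<n. u i a * u i b) = (if a = b then 1 else 0)" if "a < n" "b < n" for a b
  proof -
    have "(U\<^sup>T * U) $$ (a, b) = (\<Sum>i<n. u i a * u i b)"
      using that by (simp add: U_def scalar_prod_def atLeast0LessThan)
    then show ?thesis using that by (simp add: UtU)
  qed
  have AU: "A * U\<^sup>T = U\<^sup>T * D"
  proof (rule eq_matI)
    fix a i assume "a < dim_row (U\<^sup>T * D)" "i < dim_col (U\<^sup>T * D)"
    then have ai: "a < n" "i < n" using car by auto
    have "(U\<^sup>T * D) $$ (a, i) = (\<Sum>j<n. u j a * (if j = i then l j else 0))"
      using ai by (simp add: U_def D_def scalar_prod_def atLeast0LessThan)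
    also have "\<dots> = u i a * l i" using ai by (simp add: if_distrib[of "\<lambda>x. a * x" for a] cong: if_cong)
    finally show "(A * U\<^sup>T) $$ (a, i) = (U\<^sup>T * D) $$ (a, i)"
      using ai e[of i a] by (simp add: A_def U_def scalar_prod_def atLeast0LessThan mult_ac)
  qed (use car in auto)
  have "A = A * (U\<^sup>T * U)" using car by (simp add: UtU)
  also have "\<dots> = U\<^sup>T * D * U" using car by (simp add: AU flip: assoc_mult_mat[of A n n "U\<^sup>T" n U n])
  finally have "similar_mat_wit A D U\<^sup>T U"
    using car UUt UtU by (simp add: similar_mat_wit_def Let_def)
  then have "char_poly A = char_poly D" by (intro char_poly_similar) (auto simp: similar_mat_def)
  also have "\<dots> = (\<Prod>a\<leftarrow>diag_mat D. [:- a, 1:])"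
    by (rule char_poly_upper_triangular[OF car(3)]) (auto simp: D_def)
  also have "diag_mat D = map l [0..<n]"
    by (auto simp: diag_mat_def D_def)
  finally have "eigs n M = proots (\<Prod>a\<leftarrow>map l [0..<n]. [:- a, 1:])"
    by (simp add: eigs_def A_def)
  also have "\<dots> = image_mset l (mset_set {..<n})"
  proof (induction n)
    case (Suc n)
    define P where "P = (\<Prod>a\<leftarrow>map l [0..<n]. [:- a, 1:])"
    have "P \<noteq> 0" by (auto simp: P_def prod_list_zero_iff)
    then have "proots (P * [:- l n, 1:]) = proots P + {#l n#}" by (subst proots_mult) auto
    then show ?case using Suc by (simp add: lessThan_Suc P_def del: mult_pCons_right)
  qed simp
  finally show ?thesis unfolding eigensystem_def using o c e by blast
qed

section \<open>Quadratic forms, traces and powers in an eigenbasis; comparison of eigenvalue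
  counts\<close>

definition quad_form :: "nat \<Rightarrow> (nat \<Rightarrow> nat \<Rightarrow> real) \<Rightarrow> (nat \<Rightarrow> real) \<Rightarrow> real" where
  "quad_form n M x = (\<Sum>a<n. \<Sum>b<n. x a * (M a b * x b))"

context
  fixes n M l u assumes es: "eigensystem n M l u"
begin

lemma eigensystem_expand:
  assumes "a < n" "b < n"
  shows "M a b = (\<Sum>i<n. l i * (u i a * u i b))"
proof -
  have "(\<Sum>i<n. l i * (u i a * u i b)) = (\<Sum>i<n. (\<Sum>c<n. M a c * u i c) * u i b)"
    using es assms by (intro sum.cong refl) (auto simp: eigensystem_def)
  also have "\<dots> = (\<Sum>c<n. M a c * (\<Sum>i<n. u i c * u i b))"
    unfolding sum_distrib_left sum_distrib_right by (subst sum.swap) (simp add: mult_ac)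
  also have "\<dots> = (\<Sum>c<n. if c = b then M a c else 0)"
    using es assms by (intro sum.cong refl) (auto simp: eigensystem_def)
  also have "\<dots> = M a b" using assms by simp
  finally show ?thesis by simp
qed

lemma eigensystem_quad_form:
  "quad_form n M x = (\<Sum>i<n. l i * (\<Sum>a<n. u i a * x a)\<^sup>2)"
proof -
  have "quad_form n M x = (\<Sum>a<n. \<Sum>b<n. \<Sum>i<n. l i * ((u i a * x a) * (u i b * x b)))"
    unfolding quad_form_def
    by (intro sum.cong refl) (simp add: eigensystem_expand sum_distrib_left sum_distrib_right mult_ac)
  also have "\<dots> = (\<Sum>a<n. \<Sum>i<n. \<Sum>b<n. l i * ((u i a * x a) * (u i b * x b)))"
    by (rule sum.cong[OF refl], rule sum.swap)
  also have "\<dots> = (\<Sum>i<n. \<Sum>a<n. \<Sum>b<n. l i * ((u i a * x a) * (u i b * x b)))"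
    by (rule sum.swap)
  also have "\<dots> = (\<Sum>i<n. l i * (\<Sum>a<n. u i a * x a)\<^sup>2)"
    by (rule sum.cong[OF refl], subst power2_eq_square, subst sum_product, simp add: sum_distrib_left)
  finally show ?thesis .
qed

lemma eigensystem_parseval:
  "(\<Sum>a<n. (x a)\<^sup>2) = (\<Sum>i<n. (\<Sum>a<n. u i a * x a)\<^sup>2)"
proof -
  have "(\<Sum>i<n. (\<Sum>a<n. u i a * x a)\<^sup>2) = (\<Sum>i<n. \<Sum>a<n. \<Sum>b<n. x a * x b * (u i a * u i b))"
    by (simp add: power2_eq_square sum_product mult_ac)
  also have "\<dots> = (\<Sum>a<n. \<Sum>i<n. \<Sum>b<n. x a * x b * (u i a * u i b))"
    by (rule sum.swap)
  also have "\<dots> = (\<Sum>a<n. \<Sum>b<n. \<Sum>i<n. x a * x b * (u i a * u i b))"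
    by (rule sum.cong[OF refl], rule sum.swap)
  also have "\<dots> = (\<Sum>a<n. \<Sum>b<n. if a = b then x a * x b else 0)"
    using es by (intro sum.cong refl) (auto simp: eigensystem_def simp flip: sum_distrib_left)
  also have "\<dots> = (\<Sum>a<n. (x a)\<^sup>2)"
    by (intro sum.cong refl) (subst sum.delta', auto simp: power2_eq_square)
  finally show ?thesis by simp
qed

lemma eigensystem_coeff:
  assumes "I \<subseteq> {..<n}" "i < n"
  shows "(\<Sum>a<n. u i a * (\<Sum>j\<in>I. y j * u j a)) = (if i \<in> I then y i else 0)"
proof -
  have I: "finite I" using assms finite_subset by blast
  have "(\<Sum>a<n. u i a * (\<Sum>j\<in>I. y j * u j a)) = (\<Sum>j\<in>I. y j * (\<Sum>a<n. u i a * u j a))"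
    unfolding sum_distrib_left by (subst sum.swap) (simp add: mult_ac)
  also have "\<dots> = (\<Sum>j\<in>I. if j = i then y j else 0)"
    using es assms by (intro sum.cong refl) (auto simp: eigensystem_def)
  finally show ?thesis using I by simp
qed

lemma eigensystem_trace_eq_sum: "(\<Sum>a<n. M a a) = (\<Sum>i<n. l i)"
proof -
  have "(\<Sum>a<n. M a a) = (\<Sum>i<n. l i * (\<Sum>a<n. u i a * u i a))"
    unfolding sum_distrib_left by (subst sum.swap) (simp add: eigensystem_expand)
  also have "\<dots> = (\<Sum>i<n. l i)" using es by (intro sum.cong refl) (auto simp: eigensystem_def)
  finally show ?thesis .
qed

text \<open>Powers are written as iterates of the map from x to M x, because the same iterates
  appear later on rooted graphs, which may be infinite.\<close>

lemma eigensystem_funpow: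
  assumes "a < n"
  shows "((\<lambda>x a. \<Sum>b<n. M a b * x b) ^^ k) x a = (\<Sum>i<n. l i ^ k * (u i a * (\<Sum>b<n. u i b * x b)))"
  using assms
proof (induction k arbitrary: a)
  case 0
  have "(\<Sum>i<n. u i a * (\<Sum>b<n. u i b * x b)) = (\<Sum>b<n. x b * (\<Sum>i<n. u i a * u i b))"
    unfolding sum_distrib_left by (subst sum.swap) (simp add: mult_ac)
  also have "\<dots> = (\<Sum>b<n. if b = a then x b else 0)"
    using es 0 by (intro sum.cong refl) (auto simp: eigensystem_def)
  finally show ?case using 0 by simp
next
  case (Suc k)
  let ?z = "\<lambda>i. \<Sum>b<n. u i b * x b"
  have "((\<lambda>x a. \<Sum>b<n. M a b * x b) ^^ Suc k) x a = (\<Sum>c<n. M a c * (\<Sum>i<n. l i ^ k * (u i c * ?z i)))"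
    using Suc by simp
  also have "\<dots> = (\<Sum>i<n. (\<Sum>c<n. M a c * u i c) * (l i ^ k * ?z i))"
    unfolding sum_distrib_left[of "M a _"] sum_distrib_right by (subst sum.swap) (simp add: mult_ac)
  also have "\<dots> = (\<Sum>i<n. l i ^ Suc k * (u i a * ?z i))"
    using es Suc.prems by (intro sum.cong refl) (auto simp: eigensystem_def)
  finally show ?case .
qed

text \<open>The trace of the k-th power, computed in two ways. The summand at \<open>v\<close> is
  the total weight of closed walks of length \<open>k\<close> at \<open>v\<close>.\<close>

lemma eigensystem_trace_funpow:
  "(\<Sum>v<n. ((\<lambda>x a. \<Sum>b<n. M a b * x b) ^^ k) (\<lambda>b. if b = v then 1 else 0) v) = (\<Sum>i<n. l i ^ k)"
proof -
  have "(\<Sum>v<n. ((\<lambda>x a. \<Sum>b<n. M a b * x b) ^^ k) (\<lambda>b. if b = v then 1 else 0) v)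
      = (\<Sum>v<n. \<Sum>i<n. l i ^ k * (u i v * u i v))"
    by (intro sum.cong refl) (simp add: eigensystem_funpow if_distrib[of "\<lambda>x. a * x" for a] cong: if_cong)
  also have "\<dots> = (\<Sum>i<n. l i ^ k * (\<Sum>v<n. u i v * u i v))"
    unfolding sum_distrib_left by (rule sum.swap)
  also have "\<dots> = (\<Sum>i<n. l i ^ k)" using es by (intro sum.cong refl) (auto simp: eigensystem_def)
  finally show ?thesis .
qed

text \<open>The eigenvector equation is read at an index where the eigenvector has maximal absolute
  value.\<close>

lemma eigensystem_abs_le_row_sum:
  assumes K: "\<And>a. a < n \<Longrightarrow> (\<Sum>b<n. \<bar>M a b\<bar>) \<le> K" and i: "i < n"
  shows "\<bar>l i\<bar> \<le> K"
proof -
  have ne: "(\<lambda>a. \<bar>u i a\<bar>) ` {..<n} \<noteq> {}" using i by auto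
  obtain a where a: "a < n" and am: "\<And>b. b < n \<Longrightarrow> \<bar>u i b\<bar> \<le> \<bar>u i a\<bar>"
  proof -
    have "Max ((\<lambda>a. \<bar>u i a\<bar>) ` {..<n}) \<in> (\<lambda>a. \<bar>u i a\<bar>) ` {..<n}" using ne by (intro Max_in) auto
    then obtain a where "a < n" "Max ((\<lambda>a. \<bar>u i a\<bar>) ` {..<n}) = \<bar>u i a\<bar>" by auto
    then show ?thesis using that by (metis Max_ge finite_imageI finite_lessThan imageI lessThan_iff)
  qed
  have "(\<Sum>b<n. u i b * u i b) = 1" using es i by (simp add: eigensystem_def)
  then have "\<exists>b<n. u i b \<noteq> 0" by (metis (no_types, lifting) lessThan_iff mult_zero_left sum.neutral zero_neq_one)
  then have pos: "\<bar>u i a\<bar> > 0" using am by fastforce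
  have "\<bar>l i\<bar> * \<bar>u i a\<bar> = \<bar>\<Sum>b<n. M a b * u i b\<bar>"
    using es i a by (simp add: eigensystem_def abs_mult)
  also have "\<dots> \<le> (\<Sum>b<n. \<bar>M a b\<bar> * \<bar>u i a\<bar>)"
    by (rule order_trans[OF sum_abs]) (auto intro!: sum_mono mult_left_mono am simp: abs_mult)
  also have "\<dots> \<le> K * \<bar>u i a\<bar>" using K[OF a] by (simp add: mult_right_mono flip: sum_distrib_right)
  finally show ?thesis using pos by simp
qed

end

text \<open>The dimension count behind the min-max principle. If the bound failed, the span of the
  eigenvectors of \<open>B\<close> with eigenvalue at most \<open>t\<close> would contain a nonzero
  \<open>x\<close> that satisfies the constraints \<open>Q\<close> and is orthogonal to all such
  eigenvectors of \<open>A\<close>. Then the form of \<open>B\<close> at \<open>x\<close> is at most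
  t |x|^2, while that of \<open>A\<close> is larger.\<close>

lemma eigenvalue_count_le:
  assumes A: "eigensystem n A l u" and B: "eigensystem n B m v"
    and q: "finite Q"
    and le: "\<And>x. (\<And>e. e \<in> Q \<Longrightarrow> (\<Sum>a<n. c e a * x a) = 0) \<Longrightarrow> quad_form n A x \<le> quad_form n B x"
  shows "card {i. i < n \<and> m i \<le> t} \<le> card {i. i < n \<and> l i \<le> t} + card Q"
proof (rule ccontr)
  define IA IB where "IA = {i. i < n \<and> l i \<le> t}" and "IB = {i. i < n \<and> m i \<le> t}"
  assume "\<not> ?thesis"
  then have gt: "card (IA <+> Q) < card IB" using q by (simp add: IA_def IB_def card_Plus)
  have fin: "finite IA" "finite IB" "IB \<subseteq> {..<n}" by (auto simp: IA_def IB_def)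
  \<comment> \<open>Equations for the coefficients of \<open>x\<close>: \<open>Inl\<close> stands
    for orthogonality to an eigenvector of \<open>A\<close>, \<open>Inr\<close> for a
    constraint.\<close>
  define f where "f e = (case e of Inl i \<Rightarrow> u i | Inr e \<Rightarrow> c e)" for e
  obtain y where y0: "\<exists>i\<in>IB. y i \<noteq> 0"
    and y: "\<And>e. e \<in> IA <+> Q \<Longrightarrow> (\<Sum>i\<in>IB. (\<Sum>a<n. f e a * v i a) * y i) = 0"
    using underdetermined_system[OF _ fin(2) gt, of "\<lambda>e i. \<Sum>a<n. f e a * v i a"] fin q by auto
  define x where "x a = (\<Sum>i\<in>IB. y i * v i a)" for a
  have fx: "(\<Sum>a<n. f e a * x a) = 0" if "e \<in> IA <+> Q" for e
  proof -
    have "(\<Sum>a<n. f e a * x a) = (\<Sum>i\<in>IB. (\<Sum>a<n. f e a * v i a) * y i)"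
      unfolding x_def sum_distrib_left sum_distrib_right by (subst sum.swap) (simp add: mult_ac)
    then show ?thesis using y[OF that] by simp
  qed
  have cB: "(\<Sum>a<n. v i a * x a) = (if i \<in> IB then y i else 0)" if "i < n" for i
    unfolding x_def by (rule eigensystem_coeff[OF B fin(3) that])
  define S where "S = (\<Sum>a<n. (x a)\<^sup>2)"
  have SB: "S = (\<Sum>i<n. (if i \<in> IB then y i else 0)\<^sup>2)"
    unfolding S_def by (rule trans[OF eigensystem_parseval[OF B]], intro sum.cong refl) (simp add: cB)
  have "quad_form n B x \<le> (\<Sum>i<n. t * (if i \<in> IB then y i else 0)\<^sup>2)"
    unfolding eigensystem_quad_form[OF B]
    by (intro sum_mono) (auto simp: cB IB_def intro!: mult_right_mono)
  then have qB: "quad_form n B x \<le> t * S" by (simp add: SB sum_distrib_left)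
  define z where "z i = (\<Sum>a<n. u i a * x a)" for i
  have zA: "z i = 0" if "i \<in> IA" for i using fx[of "Inl i", OF InlI[OF that]] by (simp add: z_def f_def)
  have SA: "S = (\<Sum>i<n. (z i)\<^sup>2)"
    unfolding S_def z_def by (rule eigensystem_parseval[OF A])
  have "S > 0"
  proof -
    obtain j where "j \<in> IB" "y j \<noteq> 0" using y0 by blast
    then show ?thesis unfolding SB using fin by (intro sum_pos2[of _ j]) auto
  qed
  \<comment> \<open>A nonzero coefficient of \<open>x\<close> in the eigenbasis of \<open>A\<close>
    belongs to an eigenvalue above \<open>t\<close>; this makes the comparison strict.\<close>
  then have "\<exists>i<n. z i \<noteq> 0" unfolding SA
    by (rule contrapos_pp) (simp add: sum.neutral)
  then obtain i0 where i0: "i0 < n" "z i0 \<noteq> 0" by blast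
  have "0 < (\<Sum>i<n. (l i - t) * (z i)\<^sup>2)"
  proof (rule sum_pos2[of _ i0])
    show "0 < (l i0 - t) * (z i0)\<^sup>2" 
    proof -
      have "i0 \<notin> IA" using i0 zA by blast
      then have "l i0 > t" using i0 by (simp add: IA_def)
      then show ?thesis using i0 by (simp add: zero_less_mult_iff)
    qed
    show "0 \<le> (l i - t) * (z i)\<^sup>2" if "i \<in> {..<n}" for i
      using zA[of i] that by (cases "i \<in> IA") (auto simp: IA_def)
  qed (use i0 in auto)
  also have "\<dots> = quad_form n A x - t * S"
    unfolding eigensystem_quad_form[OF A] SA by (simp add: z_def algebra_simps sum_subtractf sum_distrib_left)
  finally have "t * S < quad_form n A x" by simp
  moreover have "quad_form n A x \<le> quad_form n B x"
    by (rule le) (use fx[of "Inr _", OF InrI] in \<open>simp add: f_def\<close>)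
  ultimately show False using qB by simp
qed

section \<open>Linear statistics of ramp functions\<close>

definition ramp :: "real \<Rightarrow> real \<Rightarrow> real \<Rightarrow> real" where
  "ramp a b x = (if x \<le> a then 1 else if b \<le> x then 0 else (b - x) / (b - a))"

definition ramp_sum :: "nat \<Rightarrow> (nat \<Rightarrow> nat \<Rightarrow> real) \<Rightarrow> real \<Rightarrow> real \<Rightarrow> real" where
  "ramp_sum n M a b = (\<Sum>x\<in>#eigs n M. ramp a b x)"

lemma ramp_sum_eigensystem:
  "eigensystem n M l u \<Longrightarrow> ramp_sum n M a b = (\<Sum>i<n. ramp a b (l i))"
  by (simp add: ramp_sum_def eigensystem_def sum_unfold_sum_mset image_mset.compositionality o_def)

lemma has_integral_step:
  fixes a b l :: real
  assumes "a \<le> b"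
  shows "((\<lambda>x. if l \<le> x then 1 else 0 :: real) has_integral (if l \<le> a then b - a else if b \<le> l then 0 else b - l)) {a..b}"
proof -
  consider "l \<le> a" | "l > a" "b \<le> l" | "a < l" "l < b" by linarith
  then show ?thesis
  proof cases
    case 1
    have "((\<lambda>x. 1 :: real) has_integral (b - a)) {a..b}"
      using has_integral_const_real[of "1::real" a b] assms by simp
    then have "((\<lambda>x. if l \<le> x then 1 else 0 :: real) has_integral (b - a)) {a..b}"
      by (rule has_integral_eq[rotated]) (use 1 in auto)
    then show ?thesis using 1 by simp
  next
    case 2
    have "((\<lambda>x. if l \<le> x then 1 else 0 :: real) has_integral 0) {a..b}"
      by (rule has_integral_spike[OF negligible_sing[of b] _ has_integral_0]) (use 2 in auto)
    then show ?thesis using 2 by simp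
  next
    case 3
    have *: "((\<lambda>x. 1 :: real) has_integral (b - l)) {l..b}"
      using has_integral_const_real[of "1::real" l b] 3 by simp
    have "((\<lambda>x. if x \<in> {l..b} then 1 else 0 :: real) has_integral (b - l)) {a..b}"
      using * 3 by (subst has_integral_restrict) auto
    then have "((\<lambda>x. if l \<le> x then 1 else 0 :: real) has_integral (b - l)) {a..b}"
      by (rule has_integral_eq[rotated]) auto
    then show ?thesis using 3 by simp
  qed
qed

lemma ramp_eq_step:
  "a < b \<Longrightarrow> (if l \<le> a then b - a else if b \<le> l then 0 else b - l) = (b - a) * ramp a b l"
  by (simp add: ramp_def)

text \<open>A ramp at l is the average over t in [a, b] of the indicators of l \<le> t. A ramp sum
  is thus an averaged eigenvalue count, and inequalities between counts pass to ramp sums.\<close>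

lemma has_integral_count:
  fixes a b :: real and l :: "nat \<Rightarrow> real"
  assumes "a < b"
  shows "((\<lambda>x. real (card {i. i < n \<and> l i \<le> x})) has_integral (b - a) * (\<Sum>i<n. ramp a b (l i))) {a..b}"
proof -
  have "((\<lambda>x. \<Sum>i<n. if l i \<le> x then 1 else 0 :: real) has_integral (\<Sum>i<n. (b - a) * ramp a b (l i))) {a..b}"
    by (rule has_integral_sum) (use has_integral_step[of a b] assms in \<open>auto simp: ramp_eq_step\<close>)
  moreover have "(\<Sum>i<n. if l i \<le> x then 1 else 0 :: real) = real (card {i. i < n \<and> l i \<le> x})" for x
    by (subst sum.inter_filter[symmetric]) (auto intro!: arg_cong[of _ _ card])
  ultimately show ?thesis by (simp add: sum_distrib_left)
qed

lemma ramp_sum_diff_le_count: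
  fixes l m :: "nat \<Rightarrow> real"
  assumes ab: "a < b" and le: "\<And>t. card {i. i < n \<and> l i \<le> t} \<le> card {i. i < n \<and> m i \<le> t} + q"
  shows "(\<Sum>i<n. ramp a b (l i)) - (\<Sum>i<n. ramp a b (m i)) \<le> real q"
proof -
  have "((\<lambda>x. real (card {i. i < n \<and> m i \<le> x}) + real q) has_integral
      (b - a) * (\<Sum>i<n. ramp a b (m i)) + (b - a) * real q) {a..b}"
    using has_integral_const_real[of "real q" a b] ab
    by (intro has_integral_add has_integral_count) simp_all
  with has_integral_count[OF ab, of n l]
  have "(b - a) * (\<Sum>i<n. ramp a b (l i)) \<le> (b - a) * (\<Sum>i<n. ramp a b (m i)) + (b - a) * real q"
    by (rule has_integral_le) (use le in \<open>simp flip: of_nat_add\<close>)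
  then have "(b - a) * (\<Sum>i<n. ramp a b (l i)) \<le> (b - a) * ((\<Sum>i<n. ramp a b (m i)) + real q)"
    by (simp add: algebra_simps)
  then show ?thesis using ab by simp
qed

text \<open>The counting functions are ordered, so integrating their difference over a large interval
  instead of \<open>[a, b]\<close> only increases it, and turns it into the difference of the traces.\<close>

lemma ramp_sum_diff_le_trace:
  fixes l m :: "nat \<Rightarrow> real"
  assumes ab: "a < b" and le: "\<And>t. card {i. i < n \<and> m i \<le> t} \<le> card {i. i < n \<and> l i \<le> t}"
  shows "(\<Sum>i<n. ramp a b (l i)) - (\<Sum>i<n. ramp a b (m i)) \<le> ((\<Sum>i<n. m i) - (\<Sum>i<n. l i)) / (b - a)"
proof -
  \<comment> \<open>The interval [-R, R] contains [a, b] and all eigenvalues, so these lie in the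
    linear part of the ramp from -R to R, and the integral of a count becomes the sum of the
    \<open>R - l i\<close>.\<close>
  define R where "R = \<bar>a\<bar> + \<bar>b\<bar> + 1 + (\<Sum>i<n. \<bar>l i\<bar> + \<bar>m i\<bar>)"
  have s0: "(\<Sum>i<n. \<bar>l i\<bar> + \<bar>m i\<bar>) \<ge> 0" by (intro sum_nonneg) auto
  have R: "\<bar>l i\<bar> \<le> R" "\<bar>m i\<bar> \<le> R" if "i < n" for i
  proof -
    have "\<bar>l i\<bar> + \<bar>m i\<bar> \<le> (\<Sum>i<n. \<bar>l i\<bar> + \<bar>m i\<bar>)" using that by (intro member_le_sum) auto
    then show "\<bar>l i\<bar> \<le> R" "\<bar>m i\<bar> \<le> R" by (auto simp: R_def)
  qed
  have sub: "{a..b} \<subseteq> {-R..R}" and R0: "-R < R" using ab s0 by (auto simp: R_def)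
  define f where "f x = real (card {i. i < n \<and> l i \<le> x}) - real (card {i. i < n \<and> m i \<le> x})" for x
  have i1: "(f has_integral (b - a) * (\<Sum>i<n. ramp a b (l i)) - (b - a) * (\<Sum>i<n. ramp a b (m i))) {a..b}"
    unfolding f_def by (intro has_integral_diff has_integral_count ab)
  have rr: "(R - (-R)) * ramp (-R) R x = R - x" if "\<bar>x\<bar> \<le> R" for x
    using that R0 by (auto simp: ramp_def)
  have i2: "(f has_integral (\<Sum>i<n. R - l i) - (\<Sum>i<n. R - m i)) {-R..R}"
    using has_integral_diff[OF has_integral_count[OF R0, of n l] has_integral_count[OF R0, of n m]] rr R
    unfolding f_def sum_distrib_left by simp
  have "(b - a) * (\<Sum>i<n. ramp a b (l i)) - (b - a) * (\<Sum>i<n. ramp a b (m i)) \<le> (\<Sum>i<n. R - l i) - (\<Sum>i<n. R - m i)"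
    by (rule has_integral_subset_le[OF sub i1 i2]) (use le in \<open>simp add: f_def\<close>)
  then show ?thesis using ab by (simp add: field_simps sum_subtractf)
qed

text \<open>On vectors that vanish on \<open>Q\<close> the two quadratic forms agree, and vanishing
  on \<open>Q\<close> amounts to at most \<open>card Q\<close> linear constraints.\<close>

lemma ramp_sum_diff_le_restricted:
  assumes A: "\<And>i j. i < n \<Longrightarrow> j < n \<Longrightarrow> A i j = A j i" and B: "\<And>i j. i < n \<Longrightarrow> j < n \<Longrightarrow> B i j = B j i"
    and Q: "finite Q" and eq: "\<And>i j. i < n \<Longrightarrow> j < n \<Longrightarrow> i \<notin> Q \<Longrightarrow> j \<notin> Q \<Longrightarrow> A i j = B i j"
    and ab: "a < b"
  shows "ramp_sum n A a b - ramp_sum n B a b \<le> real (card Q)"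
proof -
  obtain l u where l: "eigensystem n A l u" using eigensystem_exists[of n A] A by blast
  obtain m v where m: "eigensystem n B m v" using eigensystem_exists[of n B] B by blast
  have "card {i. i < n \<and> l i \<le> t} \<le> card {i. i < n \<and> m i \<le> t} + card (Q \<inter> {..<n})" for t
  proof (rule eigenvalue_count_le[OF m l, where c = "\<lambda>e a. if a = e then 1 else 0"])
    fix x :: "nat \<Rightarrow> real"
    assume "\<And>e. e \<in> Q \<inter> {..<n} \<Longrightarrow> (\<Sum>a<n. (if a = e then 1 else 0) * x a) = 0"
    moreover have "(\<Sum>a<n. (if a = e then 1 else 0) * x a) = x e" if "e < n" for e
      using that by (simp add: if_distrib[of "\<lambda>y. y * z" for z] cong: if_cong)
    ultimately have x: "x e = 0" if "e \<in> Q" "e < n" for e using that by force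
    have "x i * (B i j * x j) = x i * (A i j * x j)" if "i < n" "j < n" for i j
      using eq[OF that] x that by (cases "i \<in> Q"; cases "j \<in> Q") auto
    then have "quad_form n B x = quad_form n A x"
      unfolding quad_form_def by (intro sum.cong refl) auto
    then show "quad_form n B x \<le> quad_form n A x" by simp
  qed (use Q in auto)
  from ramp_sum_diff_le_count[OF ab this]
  have "ramp_sum n A a b - ramp_sum n B a b \<le> real (card (Q \<inter> {..<n}))"
    by (simp add: ramp_sum_eigensystem[OF l] ramp_sum_eigensystem[OF m])
  also have "\<dots> \<le> real (card Q)" using Q by (simp add: card_mono)
  finally show ?thesis .
qed

text \<open>Ordered forms have ordered eigenvalue counts at every level, so the ramp difference has
  a sign and the traces bound its size.\<close>

lemma ramp_sum_diff_le_form: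
  assumes l: "eigensystem n A l u" and m: "eigensystem n B m v"
    and le: "\<And>x. quad_form n A x \<le> quad_form n B x" and ab: "a < b"
  shows "0 \<le> ramp_sum n A a b - ramp_sum n B a b"
    "ramp_sum n A a b - ramp_sum n B a b \<le> ((\<Sum>i<n. B i i) - (\<Sum>i<n. A i i)) / (b - a)"
proof -
  have *: "card {i. i < n \<and> m i \<le> t} \<le> card {i. i < n \<and> l i \<le> t}" for t
    using eigenvalue_count_le[OF l m, of "{} :: nat set" "\<lambda>_ _. 0" t] le by simp
  show "ramp_sum n A a b - ramp_sum n B a b \<le> ((\<Sum>i<n. B i i) - (\<Sum>i<n. A i i)) / (b - a)"
    using ramp_sum_diff_le_trace[OF ab *]
    by (simp add: ramp_sum_eigensystem[OF l] ramp_sum_eigensystem[OF m] eigensystem_trace_eq_sum[OF l]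
        eigensystem_trace_eq_sum[OF m])
  show "0 \<le> ramp_sum n A a b - ramp_sum n B a b"
    using ramp_sum_diff_le_count[OF ab, of n m l 0] *
    by (simp add: ramp_sum_eigensystem[OF l] ramp_sum_eigensystem[OF m])
qed

text \<open>Both matrices lie below \<open>A + diag d\<close>, where \<open>d\<close> are the absolute row sums of \<open>B - A\<close>.\<close>

lemma ramp_sum_diff_le_l1:
  assumes A: "\<And>i j. i < n \<Longrightarrow> j < n \<Longrightarrow> A i j = A j i" and B: "\<And>i j. i < n \<Longrightarrow> j < n \<Longrightarrow> B i j = B j i"
    and ab: "a < b"
  shows "\<bar>ramp_sum n A a b - ramp_sum n B a b\<bar> \<le> 2 / (b - a) * (\<Sum>i<n. \<Sum>j<n. \<bar>A i j - B i j\<bar>)"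
proof -
  define d where "d i = (\<Sum>j<n. \<bar>A i j - B i j\<bar>)" for i
  define C where "C i j = A i j + (if i = j then d i else 0)" for i j
  obtain l u where l: "eigensystem n A l u" using eigensystem_exists[of n A] A by blast
  obtain m v where m: "eigensystem n B m v" using eigensystem_exists[of n B] B by blast
  have "C i j = C j i" if "i < n" "j < n" for i j using A[OF that] by (cases "i = j") (auto simp: C_def)
  then obtain k t where k: "eigensystem n C k t" using eigensystem_exists[of n C] by blast
  have d0: "d i \<ge> 0" for i by (simp add: d_def sum_nonneg)
  have qC: "quad_form n C x = quad_form n A x + (\<Sum>i<n. d i * (x i)\<^sup>2)" for x
  proof -
    have "quad_form n C x = quad_form n A x + (\<Sum>i<n. \<Sum>j<n. if i = j then x i * (d i * x j) else 0)"
      unfolding quad_form_def C_def sum.distrib[symmetric]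
      by (intro sum.cong refl) (auto simp: algebra_simps)
    also have "(\<Sum>i<n. \<Sum>j<n. if i = j then x i * (d i * x j) else 0) = (\<Sum>i<n. d i * (x i)\<^sup>2)"
      by (intro sum.cong refl) (subst sum.delta', auto simp: power2_eq_square)
    finally show ?thesis .
  qed
  have AC: "quad_form n A x \<le> quad_form n C x" for x
    unfolding qC using d0 by (auto intro!: sum_nonneg)
  have BC: "quad_form n B x \<le> quad_form n C x" for x
  proof -
    have "quad_form n B x - quad_form n A x = (\<Sum>i<n. \<Sum>j<n. (B i j - A i j) * (x i * x j))"
      unfolding quad_form_def sum_subtractf[symmetric] by (intro sum.cong refl) (simp add: algebra_simps)
    \<comment> \<open>By 2|xy| \<le> x^2 + y^2 every entry is charged half to its row and half to
      its column; by symmetry both halves have the same total.\<close>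
    also have "\<dots> \<le> (\<Sum>i<n. \<Sum>j<n. \<bar>A i j - B i j\<bar> * (x i)\<^sup>2 / 2 + \<bar>A i j - B i j\<bar> * (x j)\<^sup>2 / 2)"
    proof (intro sum_mono)
      fix i j
      have "(B i j - A i j) * (x i * x j) \<le> \<bar>A i j - B i j\<bar> * \<bar>x i * x j\<bar>"
        by (metis abs_ge_self abs_minus_commute abs_mult)
      also have "\<dots> \<le> \<bar>A i j - B i j\<bar> * (((x i)\<^sup>2 + (x j)\<^sup>2) / 2)"
        using sum_squares_bound[of "\<bar>x i\<bar>" "\<bar>x j\<bar>"] by (intro mult_left_mono) (simp_all add: abs_mult)
      finally show "(B i j - A i j) * (x i * x j) \<le> \<bar>A i j - B i j\<bar> * (x i)\<^sup>2 / 2 + \<bar>A i j - B i j\<bar> * (x j)\<^sup>2 / 2"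
        by (simp add: algebra_simps add_divide_distrib)
    qed
    also have "\<dots> = (\<Sum>i<n. d i * (x i)\<^sup>2) / 2 + (\<Sum>i<n. \<Sum>j<n. \<bar>A i j - B i j\<bar> * (x j)\<^sup>2) / 2"
      by (simp add: sum.distrib d_def sum_divide_distrib sum_distrib_right)
    also have "(\<Sum>i<n. \<Sum>j<n. \<bar>A i j - B i j\<bar> * (x j)\<^sup>2) = (\<Sum>j<n. d j * (x j)\<^sup>2)"
      unfolding d_def sum_distrib_right by (subst sum.swap) (intro sum.cong refl, simp add: A B)
    finally show ?thesis unfolding qC by simp
  qed
  have tA: "(\<Sum>i<n. C i i) - (\<Sum>i<n. A i i) = (\<Sum>i<n. d i)"
    by (simp add: C_def sum.distrib)
  \<comment> \<open>The diagonals of \<open>A\<close> and \<open>B\<close> may differ by as much as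
    another sum of the \<open>d i\<close>, hence the factor 2 in the final bound.\<close>
  have "(\<Sum>i<n. A i i) - (\<Sum>i<n. B i i) \<le> (\<Sum>i<n. d i)"
    unfolding sum_subtractf[symmetric]
  proof (rule sum_mono)
    fix i assume "i \<in> {..<n}"
    then have "\<bar>A i i - B i i\<bar> \<le> d i" unfolding d_def by (intro member_le_sum[of i]) auto
    then show "A i i - B i i \<le> d i" by linarith
  qed
  then have tB: "(\<Sum>i<n. C i i) - (\<Sum>i<n. B i i) \<le> 2 * (\<Sum>i<n. d i)" using tA by linarith
  have "((\<Sum>i<n. C i i) - (\<Sum>i<n. B i i)) / (b - a) \<le> 2 * (\<Sum>i<n. d i) / (b - a)"
    using tB ab by (simp add: divide_right_mono)
  moreover have "(\<Sum>i<n. d i) / (b - a) \<le> 2 * (\<Sum>i<n. d i) / (b - a)"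
    using d0 ab by (intro divide_right_mono) (auto intro: sum_nonneg)
  \<comment> \<open>Both ramp sums exceed that of \<open>C\<close> by an amount between 0 and the
    bound, so they differ from each other by at most the bound.\<close>
  ultimately have "\<bar>ramp_sum n A a b - ramp_sum n B a b\<bar> \<le> 2 * (\<Sum>i<n. d i) / (b - a)"
    using ramp_sum_diff_le_form[OF l k AC ab] ramp_sum_diff_le_form[OF m k BC ab] unfolding tA by linarith
  then show ?thesis by (simp add: d_def)
qed

section \<open>Concentration for functions with bounded differences\<close>

text \<open>Induction on the coordinates. With the others fixed, the function of coordinate
  \<open>i\<close> takes values in an interval of length \<open>2 * c\<close>, so Hoeffding's lemma
  contributes a factor exp (s^2 (2c)^2 / 8); the partial mean over coordinate \<open>i\<close>
  inherits the difference bound \<open>c\<close>.\<close>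

lemma mgf_bounded_differences_PiM:
  fixes D :: "real measure" and f :: "('i \<Rightarrow> real) \<Rightarrow> real"
  assumes D: "prob_space D" "sets D = sets borel" and J: "finite J" and s: "s > 0"
    and f: "f \<in> borel_measurable (PiM J (\<lambda>_. D))"
    and B: "\<And>x. x \<in> space (PiM J (\<lambda>_. D)) \<Longrightarrow> \<bar>f x\<bar> \<le> B"
    and c: "\<And>x i y. x \<in> space (PiM J (\<lambda>_. D)) \<Longrightarrow> i \<in> J \<Longrightarrow> \<bar>f (x(i := y)) - f x\<bar> \<le> c"
  shows "(\<integral>\<^sup>+x. ennreal (exp (s * f x)) \<partial>PiM J (\<lambda>_. D))
     \<le> ennreal (exp (s * (\<integral>x. f x \<partial>PiM J (\<lambda>_. D)) + s\<^sup>2 * c\<^sup>2 * card J / 2))"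
  using J f B c
proof (induction J arbitrary: f rule: finite_induct)
  case empty
  interpret product_sigma_finite "\<lambda>_::'i. D"
    using D(1) by (simp add: product_sigma_finite_def prob_space_imp_sigma_finite)
  interpret P0: prob_space "PiM {} (\<lambda>_::'i. D)" by (rule prob_space_PiM) (rule D)
  have "(\<integral>\<^sup>+x. ennreal (exp (s * f x)) \<partial>PiM {} (\<lambda>_. D)) = (\<integral>\<^sup>+x. ennreal (exp (s * f (\<lambda>_. undefined))) \<partial>PiM {} (\<lambda>_::'i. D))"
    by (intro nn_integral_cong) (simp add: space_PiM)
  moreover have "(\<integral>x. f x \<partial>PiM {} (\<lambda>_. D)) = (\<integral>x. f (\<lambda>_. undefined) \<partial>PiM {} (\<lambda>_::'i. D))"
    by (intro Bochner_Integration.integral_cong) (simp_all add: space_PiM)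
  ultimately show ?case by (simp add: P0.emeasure_space_1 P0.prob_space)
next
  case (insert i J f)
  interpret D: prob_space D by fact
  interpret product_sigma_finite "\<lambda>_::'i. D"
    using D(1) by (simp add: product_sigma_finite_def prob_space_imp_sigma_finite)
  let ?P = "PiM J (\<lambda>_. D)" and ?P' = "PiM (insert i J) (\<lambda>_. D)"
  interpret P: prob_space ?P by (rule prob_space_PiM) (rule D)
  interpret P': prob_space ?P' by (rule prob_space_PiM) (rule D)
  have spD: "space D = UNIV" using sets_eq_imp_space_eq[OF D(2)] by simp
  have sp: "x(i := y) \<in> space ?P'" if "x \<in> space ?P" for x y
    using that by (auto simp: space_PiM spD PiE_def extensional_def)
  have sp2: "x(j := y) \<in> space ?P" if "x \<in> space ?P" "j \<in> J" for x y j
    using that by (auto simp: space_PiM spD PiE_def extensional_def)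
  note [measurable] = insert.prems(1)
  have fm: "(\<lambda>(x, y). f (x(i := y))) \<in> borel_measurable (?P \<Otimes>\<^sub>M D)"
    using measurable_compose[OF measurable_add_dim[of i J "\<lambda>_. D"] insert.prems(1)]
    by (simp add: split_beta')
  have hm: "(\<lambda>y. f (x(i := y))) \<in> borel_measurable D" if "x \<in> space ?P" for x
    using measurable_compose[OF measurable_Pair1'[OF that] fm] by simp
  define g where "g x = (\<integral>y. f (x(i := y)) \<partial>D)" for x
  have gm: "g \<in> borel_measurable ?P"
    unfolding g_def using fm by (intro D.borel_measurable_lebesgue_integral) simp
  have hint: "integrable D (\<lambda>y. f (x(i := y)))" if "x \<in> space ?P" for x
  proof (rule D.integrable_const_bound[of _ B])
    show "AE y in D. norm (f (x(i := y))) \<le> B"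
      unfolding real_norm_def by (intro AE_I2 insert.prems(2) sp that)
  qed (rule hm[OF that])
  have gB: "\<bar>g x\<bar> \<le> B" if x: "x \<in> space ?P" for x
  proof -
    have "\<bar>g x\<bar> \<le> (\<integral>y. \<bar>f (x(i := y))\<bar> \<partial>D)" unfolding g_def by (rule integral_abs_bound)
    also have "\<dots> \<le> (\<integral>y. B \<partial>D)"
      by (intro integral_mono integrable_abs hint x insert.prems(2) sp) simp
    finally show ?thesis by (simp add: D.prob_space)
  qed
  have gc: "\<bar>g (x(j := z)) - g x\<bar> \<le> c" if x: "x \<in> space ?P" "j \<in> J" for x j z
  proof -
    have ij: "i \<noteq> j" using insert.hyps x by auto
    have "\<bar>g (x(j := z)) - g x\<bar> = \<bar>\<integral>y. f (x(j := z, i := y)) - f (x(i := y)) \<partial>D\<bar>"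
      unfolding g_def by (subst Bochner_Integration.integral_diff) (auto intro!: hint sp2 x)
    also have "\<dots> \<le> (\<integral>y. \<bar>f (x(j := z, i := y)) - f (x(i := y))\<bar> \<partial>D)" by (rule integral_abs_bound)
    also have "\<dots> \<le> (\<integral>y. c \<partial>D)"
    proof (intro integral_mono integrable_abs Bochner_Integration.integrable_diff hint sp2 x)
      show "\<bar>f (x(j := z, i := y)) - f (x(i := y))\<bar> \<le> c" for y
        unfolding fun_upd_twist[OF ij[symmetric]] by (rule insert.prems(3)[OF sp]) (use x in auto)
    qed auto
    finally show ?thesis by (simp add: D.prob_space)
  qed
  have hoeff: "(\<integral>\<^sup>+y. ennreal (exp (s * f (x(i := y)))) \<partial>D) \<le> ennreal (exp (s * g x)) * ennreal (exp (s\<^sup>2 * c\<^sup>2 / 2))"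
    if x: "x \<in> space ?P" for x
  proof -
    define h where "h y = f (x(i := y))" for y
    \<comment> \<open>The value 0 of coordinate \<open>i\<close> serves as reference point; any
      other value would do.\<close>
    have "h y \<in> {h 0 - c..h 0 + c}" for y
    proof -
      have "\<bar>f (x(i := 0, i := y)) - f (x(i := 0))\<bar> \<le> c"
        by (rule insert.prems(3)[OF sp]) (use x in auto)
      then show ?thesis by (auto simp: h_def abs_le_iff)
    qed
    then interpret h: interval_bounded_random_variable D h "h 0 - c" "h 0 + c"
      by unfold_locales (use hm[OF x] in \<open>auto simp: h_def[abs_def]\<close>)
    have [measurable]: "h \<in> borel_measurable D" using hm[OF x] by (simp add: h_def[abs_def])
    have gx: "g x = D.expectation h" by (simp add: g_def h_def[abs_def])
    have "(\<integral>\<^sup>+y. ennreal (exp (s * h y)) \<partial>D) = (\<integral>\<^sup>+y. ennreal (exp (s * g x)) * ennreal (exp (s * (h y - D.expectation h))) \<partial>D)"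
      by (intro nn_integral_cong) (simp add: gx algebra_simps flip: ennreal_mult' exp_add)
    also have "\<dots> = ennreal (exp (s * g x)) * (\<integral>\<^sup>+y. ennreal (exp (s * (h y - D.expectation h))) \<partial>D)"
      by (rule nn_integral_cmult) simp
    also have "\<dots> \<le> ennreal (exp (s * g x)) * ennreal (exp (s\<^sup>2 * (2 * c)\<^sup>2 / 8))"
      using h.Hoeffdings_lemma_nn_integral[OF s] by (intro mult_left_mono) simp_all
    finally show ?thesis by (simp add: h_def power_mult_distrib mult_ac)
  qed
  have "(\<integral>\<^sup>+x. ennreal (exp (s * f x)) \<partial>?P') = (\<integral>\<^sup>+x. (\<integral>\<^sup>+y. ennreal (exp (s * f (x(i := y)))) \<partial>D) \<partial>?P)"
    using insert.hyps by (intro product_nn_integral_insert) auto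
  also have "\<dots> \<le> (\<integral>\<^sup>+x. ennreal (exp (s * g x)) * ennreal (exp (s\<^sup>2 * c\<^sup>2 / 2)) \<partial>?P)"
    by (intro nn_integral_mono hoeff)
  also have "\<dots> = (\<integral>\<^sup>+x. ennreal (exp (s * g x)) \<partial>?P) * ennreal (exp (s\<^sup>2 * c\<^sup>2 / 2))"
    using gm by (intro nn_integral_multc) measurable
  also have "\<dots> \<le> ennreal (exp (s * (\<integral>x. g x \<partial>?P) + s\<^sup>2 * c\<^sup>2 * card J / 2)) * ennreal (exp (s\<^sup>2 * c\<^sup>2 / 2))"
    by (intro mult_right_mono insert.IH gm gB gc) auto
  also have "(\<integral>x. g x \<partial>?P) = (\<integral>x. f x \<partial>?P')"
    unfolding g_def using insert.hyps
    by (intro product_integral_insert[symmetric] P'.integrable_const_bound[of _ B]) (auto intro!: insert.prems(2) AE_I2)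
  also have "ennreal (exp (s * (\<integral>x. f x \<partial>?P') + s\<^sup>2 * c\<^sup>2 * card J / 2)) * ennreal (exp (s\<^sup>2 * c\<^sup>2 / 2))
      = ennreal (exp (s * (\<integral>x. f x \<partial>?P') + s\<^sup>2 * c\<^sup>2 * card (insert i J) / 2))"
    using insert.hyps by (simp add: algebra_simps add_divide_distrib flip: ennreal_mult' exp_add)
  finally show ?case .
qed

context prob_space
begin

lemma distr_restrict_eq_PiM:
  fixes X :: "'i \<Rightarrow> 'a \<Rightarrow> real"
  assumes ind: "indep_vars (\<lambda>_. borel) X I" and J: "J \<subseteq> I"
    and D: "\<And>i. i \<in> I \<Longrightarrow> distr M borel (X i) = D" and D': "prob_space D"
  shows "distr M (PiM J (\<lambda>_. borel)) (\<lambda>\<omega>. \<lambda>i\<in>J. X i \<omega>) = PiM J (\<lambda>_. D)"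
proof (cases "J = {}")
  case True
  have "distr M (PiM {} (\<lambda>_. borel)) (\<lambda>\<omega>. \<lambda>i\<in>{}. X i \<omega>) = PiM {} (\<lambda>_. D)"
  proof (rule measure_eqI)
    fix A assume "A \<in> sets (distr M (PiM {} (\<lambda>_. borel)) (\<lambda>\<omega>. \<lambda>i\<in>{}. X i \<omega>))"
    then have "A \<in> {{}, {\<lambda>_. undefined}}" by (auto simp: sets_PiM_empty)
    then show "emeasure (distr M (PiM {} (\<lambda>_. borel)) (\<lambda>\<omega>. \<lambda>i\<in>{}. X i \<omega>)) A = emeasure (PiM {} (\<lambda>_. D)) A"
      by (auto simp: emeasure_distr sets_PiM_empty space_PiM_empty emeasure_space_1 restrict_def vimage_def)
  qed (simp add: sets_PiM_empty)
  then show ?thesis using True by simp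
next
  case False
  have ind': "indep_vars (\<lambda>_. borel) X J" using indep_vars_subset[OF ind J] .
  then have rv: "random_variable borel (X i)" if "i \<in> J" for i using that by (auto simp: indep_vars_def)
  have "distr M (PiM J (\<lambda>_. borel)) (\<lambda>\<omega>. \<lambda>i\<in>J. X i \<omega>) = PiM J (\<lambda>i. distr M borel (X i))"
    using indep_vars_iff_distr_eq_PiM'[OF False rv] ind' by simp
  also have "\<dots> = PiM J (\<lambda>_. D)" using D J by (intro PiM_cong) auto
  finally show ?thesis .
qed

text \<open>The bound on the product space is used for \<open>f\<close> and for its negative;
  exp(s|z|) \<le> exp(sz) + exp(-sz) accounts for the factor 2.\<close>

lemma bounded_differences_mgf:
  fixes X :: "'i \<Rightarrow> 'a \<Rightarrow> real" and f :: "('i \<Rightarrow> real) \<Rightarrow> real" and s B c :: real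
  assumes ind: "indep_vars (\<lambda>_. borel) X I" and J: "J \<subseteq> I" "finite J"
    and D: "\<And>i. i \<in> I \<Longrightarrow> distr M borel (X i) = D"
    and f: "f \<in> borel_measurable (PiM J (\<lambda>_. borel))"
    and B: "\<And>x. \<bar>f x\<bar> \<le> B"
    and c: "\<And>x i y. i \<in> J \<Longrightarrow> \<bar>f (x(i := y)) - f x\<bar> \<le> c" and s: "s > 0"
  defines "Z \<equiv> (\<lambda>\<omega>. f (\<lambda>i\<in>J. X i \<omega>))"
  shows "expectation (\<lambda>\<omega>. exp (s * \<bar>Z \<omega> - expectation Z\<bar>)) \<le> 2 * exp (s\<^sup>2 * c\<^sup>2 * card J / 2)"
    and "integrable M (\<lambda>\<omega>. exp (s * \<bar>Z \<omega> - expectation Z\<bar>))"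
proof -
  have rv: "random_variable borel (X i)" if "i \<in> I" for i using that ind by (auto simp: indep_vars_def)
  have Xm: "(\<lambda>\<omega>. \<lambda>i\<in>J. X i \<omega>) \<in> M \<rightarrow>\<^sub>M PiM J (\<lambda>_. borel)"
    using J rv by (intro measurable_restrict) auto
  have Zm [measurable]: "Z \<in> borel_measurable M" unfolding Z_def using measurable_compose[OF Xm f] .
  have ZB: "\<bar>Z \<omega>\<bar> \<le> B" for \<omega> using B by (simp add: Z_def)
  have Zi: "integrable M Z" by (rule integrable_const_bound[of _ B]) (use ZB in auto)
  have one: "expectation (\<lambda>\<omega>. exp (s * (\<sigma> * (Z \<omega> - expectation Z)))) \<le> exp (s\<^sup>2 * c\<^sup>2 * card J / 2)"
    and int: "integrable M (\<lambda>\<omega>. exp (s * (\<sigma> * (Z \<omega> - expectation Z))))" if \<sigma>: "\<sigma> \<in> {1, -1}" for \<sigma>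
  proof -
    have ab: "\<bar>\<sigma> * (Z \<omega> - expectation Z)\<bar> \<le> B + \<bar>expectation Z\<bar>" for \<omega>
      using \<sigma> ZB[of \<omega>] by auto
    show int: "integrable M (\<lambda>\<omega>. exp (s * (\<sigma> * (Z \<omega> - expectation Z))))"
    proof (rule integrable_const_bound[of _ "exp (s * (B + \<bar>expectation Z\<bar>))"])
      show "AE \<omega> in M. norm (exp (s * (\<sigma> * (Z \<omega> - expectation Z)))) \<le> exp (s * (B + \<bar>expectation Z\<bar>))"
        using s ab by (auto intro!: AE_I2 mult_left_mono simp: abs_le_iff)
    qed measurable
    have bc: "\<bar>\<sigma> * f (x(i := y)) - \<sigma> * f x\<bar> \<le> c" if "i \<in> J" for x i y
      using c[OF that, of x y] \<sigma> by auto
    have bb: "\<bar>\<sigma> * f x\<bar> \<le> B" for x using B[of x] \<sigma> by auto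
    show "expectation (\<lambda>\<omega>. exp (s * (\<sigma> * (Z \<omega> - expectation Z)))) \<le> exp (s\<^sup>2 * c\<^sup>2 * card J / 2)"
    \<comment> \<open>Without any index nothing identifies \<open>D\<close> as the law of a
      variable, but then \<open>Z\<close> is constant.\<close>
    proof (cases "I = {}")
      case True
      then have "J = {}" using J by simp
      then show ?thesis using D by (simp add: Z_def prob_space restrict_def)
    next
      case False
      then obtain i0 where "i0 \<in> I" by blast
      then have Dp: "prob_space D" "sets D = sets borel" using D rv by (metis prob_space_distr, metis sets_distr)
      have eq: "distr M (PiM J (\<lambda>_. borel)) (\<lambda>\<omega>. \<lambda>i\<in>J. X i \<omega>) = PiM J (\<lambda>_. D)"
        by (rule distr_restrict_eq_PiM[OF ind J(1) D Dp(1)])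
      have fD: "(\<lambda>x. \<sigma> * f x) \<in> borel_measurable (PiM J (\<lambda>_. D))"
        unfolding measurable_cong_sets[OF sets_PiM_cong[OF refl Dp(2)] refl] using f by measurable
      have "(\<integral>\<^sup>+x. ennreal (exp (s * (\<sigma> * f x))) \<partial>PiM J (\<lambda>_. D))
         \<le> ennreal (exp (s * (\<integral>x. \<sigma> * f x \<partial>PiM J (\<lambda>_. D)) + s\<^sup>2 * c\<^sup>2 * card J / 2))"
        by (rule mgf_bounded_differences_PiM[OF Dp J(2) s fD bb bc])
      also have "(\<integral>x. \<sigma> * f x \<partial>PiM J (\<lambda>_. D)) = \<sigma> * expectation Z"
        unfolding eq[symmetric] Z_def using f by (subst integral_distr[OF Xm]) auto
      also have "(\<integral>\<^sup>+x. ennreal (exp (s * (\<sigma> * f x))) \<partial>PiM J (\<lambda>_. D)) = (\<integral>\<^sup>+\<omega>. ennreal (exp (s * (\<sigma> * Z \<omega>))) \<partial>M)"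
        unfolding eq[symmetric] Z_def using f by (subst nn_integral_distr[OF Xm]) auto
      finally have le: "(\<integral>\<^sup>+\<omega>. ennreal (exp (s * (\<sigma> * Z \<omega>))) \<partial>M)
          \<le> ennreal (exp (s * (\<sigma> * expectation Z) + s\<^sup>2 * c\<^sup>2 * card J / 2))" .
      have "ennreal (expectation (\<lambda>\<omega>. exp (s * (\<sigma> * (Z \<omega> - expectation Z)))))
          = (\<integral>\<^sup>+\<omega>. ennreal (exp (s * (\<sigma> * (Z \<omega> - expectation Z)))) \<partial>M)"
        by (rule nn_integral_eq_integral[symmetric]) (use int in auto)
      also have "\<dots> = (\<integral>\<^sup>+\<omega>. ennreal (exp (- (s * (\<sigma> * expectation Z)))) * ennreal (exp (s * (\<sigma> * Z \<omega>))) \<partial>M)"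
        by (intro nn_integral_cong) (simp add: algebra_simps flip: ennreal_mult' exp_add)
      also have "\<dots> = ennreal (exp (- (s * (\<sigma> * expectation Z)))) * (\<integral>\<^sup>+\<omega>. ennreal (exp (s * (\<sigma> * Z \<omega>))) \<partial>M)"
        by (rule nn_integral_cmult) measurable
      also have "\<dots> \<le> ennreal (exp (- (s * (\<sigma> * expectation Z)))) * ennreal (exp (s * (\<sigma> * expectation Z) + s\<^sup>2 * c\<^sup>2 * card J / 2))"
        using le by (rule mult_left_mono) simp
      also have "\<dots> = ennreal (exp (s\<^sup>2 * c\<^sup>2 * card J / 2))"
        by (simp flip: ennreal_mult' exp_add)
      finally show ?thesis by simp
    qed
  qed
  have le: "exp (s * \<bar>z\<bar>) \<le> exp (s * (1 * z)) + exp (s * ((-1) * z))" for z :: real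
    by (cases "z \<ge> 0") (auto simp: abs_if)
  show I: "integrable M (\<lambda>\<omega>. exp (s * \<bar>Z \<omega> - expectation Z\<bar>))"
  proof (rule Bochner_Integration.integrable_bound)
    show "integrable M (\<lambda>\<omega>. exp (s * (1 * (Z \<omega> - expectation Z))) + exp (s * ((-1) * (Z \<omega> - expectation Z))))"
      by (intro Bochner_Integration.integrable_add int) auto
    show "AE \<omega> in M. norm (exp (s * \<bar>Z \<omega> - expectation Z\<bar>))
       \<le> norm (exp (s * (1 * (Z \<omega> - expectation Z))) + exp (s * ((-1) * (Z \<omega> - expectation Z))))"
    proof (rule AE_I2)
      fix \<omega>
      show "norm (exp (s * \<bar>Z \<omega> - expectation Z\<bar>))
       \<le> norm (exp (s * (1 * (Z \<omega> - expectation Z))) + exp (s * ((-1) * (Z \<omega> - expectation Z))))"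
        using le[of "Z \<omega> - expectation Z"] by simp
    qed
  qed measurable
  have "expectation (\<lambda>\<omega>. exp (s * \<bar>Z \<omega> - expectation Z\<bar>))
     \<le> expectation (\<lambda>\<omega>. exp (s * (1 * (Z \<omega> - expectation Z))) + exp (s * ((-1) * (Z \<omega> - expectation Z))))"
    by (intro integral_mono I Bochner_Integration.integrable_add int le) auto
  also have "\<dots> = expectation (\<lambda>\<omega>. exp (s * (1 * (Z \<omega> - expectation Z)))) + expectation (\<lambda>\<omega>. exp (s * ((-1) * (Z \<omega> - expectation Z))))"
    by (intro Bochner_Integration.integral_add int) auto
  also have "\<dots> \<le> 2 * exp (s\<^sup>2 * c\<^sup>2 * card J / 2)"
    using one[of 1] one[of "-1"] by simp
  finally show "expectation (\<lambda>\<omega>. exp (s * \<bar>Z \<omega> - expectation Z\<bar>)) \<le> 2 * exp (s\<^sup>2 * c\<^sup>2 * card J / 2)" .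
qed

text \<open>Since y \<le> exp(sy) / s. This form is wanted where fluctuations are averaged over a
  random graph.\<close>

lemma expectation_abs_le_mgf:
  fixes Y :: "'a \<Rightarrow> real" and s C :: real
  assumes I: "integrable M (\<lambda>\<omega>. exp (s * \<bar>Y \<omega>\<bar>))" and Y: "Y \<in> borel_measurable M"
    and E: "expectation (\<lambda>\<omega>. exp (s * \<bar>Y \<omega>\<bar>)) \<le> C" and s: "s > 0"
  shows "expectation (\<lambda>\<omega>. \<bar>Y \<omega>\<bar>) \<le> C / s"
proof -
  have le: "\<bar>y\<bar> \<le> exp (s * \<bar>y\<bar>) / s" for y :: real
  proof -
    have "s * \<bar>y\<bar> \<le> exp (s * \<bar>y\<bar>)" using exp_ge_add_one_self[of "s * \<bar>y\<bar>"] by linarith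
    then show ?thesis using s by (simp add: field_simps)
  qed
  have I': "integrable M (\<lambda>\<omega>. exp (s * \<bar>Y \<omega>\<bar>) / s)" using I by simp
  have "expectation (\<lambda>\<omega>. \<bar>Y \<omega>\<bar>) \<le> expectation (\<lambda>\<omega>. exp (s * \<bar>Y \<omega>\<bar>) / s)"
  proof (rule integral_mono[OF _ I' le])
    show "integrable M (\<lambda>\<omega>. \<bar>Y \<omega>\<bar>)"
      by (rule Bochner_Integration.integrable_bound[OF I']) (use Y le s in \<open>auto\<close>)
  qed
  also have "\<dots> \<le> C / s" using E s by (simp add: divide_right_mono)
  finally show ?thesis .
qed

text \<open>Exponential Markov inequality, the source of the summable tails.\<close>

lemma prob_ge_le_mgf:
  fixes Y :: "'a \<Rightarrow> real" and s C e :: real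
  assumes I: "integrable M (\<lambda>\<omega>. exp (s * \<bar>Y \<omega>\<bar>))" and Y: "Y \<in> borel_measurable M"
    and E: "expectation (\<lambda>\<omega>. exp (s * \<bar>Y \<omega>\<bar>)) \<le> C" and s: "s > 0"
  shows "prob {\<omega> \<in> space M. \<bar>Y \<omega>\<bar> \<ge> e} \<le> C * exp (- (s * e))"
proof -
  have "prob {\<omega> \<in> space M. \<bar>Y \<omega>\<bar> \<ge> e} \<le> prob {\<omega> \<in> space M. exp (s * \<bar>Y \<omega>\<bar>) \<ge> exp (s * e)}"
    using Y s by (intro finite_measure_mono) auto
  also have "\<dots> \<le> expectation (\<lambda>\<omega>. exp (s * \<bar>Y \<omega>\<bar>)) / exp (s * e)"
    by (rule integral_Markov_inequality_measure[OF I, where A = "{}"]) auto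
  also have "\<dots> \<le> C / exp (s * e)" using E by (simp add: divide_right_mono)
  finally show ?thesis by (simp add: exp_minus field_simps)
qed

end

section \<open>Truncated weights and local functionals of rooted graphs\<close>

text \<open>Graphs enter through their neighbourhood function only, so that the same functionals
  apply to a graph on n vertices and to a rooted graph.\<close>

definition nb_deg :: "(nat \<Rightarrow> nat set) \<Rightarrow> (nat \<Rightarrow> nat \<Rightarrow> real) \<Rightarrow> nat \<Rightarrow> real" where
  "nb_deg N w i = (\<Sum>k\<in>N i. \<bar>w i k\<bar>)"

text \<open>All edges at a vertex of weighted degree above \<open>K\<close> are deleted. Degrees are
  taken before deletion, so the rule looks only one edge beyond the endpoints.\<close>

definition trunc_wt :: "real \<Rightarrow> (nat \<Rightarrow> nat set) \<Rightarrow> (nat \<Rightarrow> nat \<Rightarrow> real) \<Rightarrow> nat \<Rightarrow> nat \<Rightarrow> real" where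
  "trunc_wt K N w i j = (if nb_deg N w i \<le> K \<and> nb_deg N w j \<le> K then w i j else 0)"

text \<open>The action on \<open>x\<close> of the matrix \<open>Delta\<close> formed with truncated
  weights; the diagonal term is absorbed into the difference.\<close>

definition nb_op :: "real \<Rightarrow> real \<Rightarrow> (nat \<Rightarrow> nat set) \<Rightarrow> (nat \<Rightarrow> nat \<Rightarrow> real) \<Rightarrow> (nat \<Rightarrow> real) \<Rightarrow> nat \<Rightarrow> real" where
  "nb_op \<alpha> K N w x i = (\<Sum>j\<in>N i. trunc_wt K N w i j * (x j - \<alpha> * x i))"

text \<open>The diagonal entry at \<open>v\<close> of the k-th power of this operator: the total
  weight of closed walks of length \<open>k\<close>, with steps along the diagonal allowed if
  \<alpha> = 1.\<close>

definition loop_wt :: "real \<Rightarrow> real \<Rightarrow> (nat \<Rightarrow> nat set) \<Rightarrow> (nat \<Rightarrow> nat \<Rightarrow> real) \<Rightarrow> nat \<Rightarrow> nat \<Rightarrow> real" where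
  "loop_wt \<alpha> K N w k v = (nb_op \<alpha> K N w ^^ k) (\<lambda>u. if u = v then 1 else 0) v"

lemma sum_trunc_wt_le:
  assumes "K \<ge> 0"
  shows "(\<Sum>j\<in>N i. \<bar>trunc_wt K N w i j\<bar>) \<le> K"
proof (cases "nb_deg N w i \<le> K")
  case True
  have "(\<Sum>j\<in>N i. \<bar>trunc_wt K N w i j\<bar>) \<le> nb_deg N w i"
    unfolding nb_deg_def by (intro sum_mono) (simp add: trunc_wt_def)
  then show ?thesis using True by simp
qed (use assms in \<open>simp add: trunc_wt_def\<close>)

text \<open>In the supremum norm the operator has norm at most 2K: truncated row sums are at most
  \<open>K\<close>, and the difference \<open>x j - \<alpha> * x i\<close> at most doubles.\<close>

lemma funpow_nb_op_bound:
  assumes K: "K \<ge> 0" and \<alpha>: "\<alpha> \<in> {0, 1}" and x: "\<And>u. \<bar>x u\<bar> \<le> 1"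
  shows "\<bar>(nb_op \<alpha> K N w ^^ k) x i\<bar> \<le> (2 * K) ^ k"
proof (induction k arbitrary: i)
  case 0
  then show ?case using x by simp
next
  case (Suc k)
  let ?y = "(nb_op \<alpha> K N w ^^ k) x"
  have "\<bar>?y j - \<alpha> * ?y i\<bar> \<le> 2 * (2 * K) ^ k" for j
  proof -
    have "\<bar>\<alpha> * ?y i\<bar> \<le> (2 * K) ^ k" using \<alpha> Suc[of i] K by auto
    then show ?thesis using Suc[of j] by linarith
  qed
  then have "\<bar>nb_op \<alpha> K N w ?y i\<bar> \<le> (\<Sum>j\<in>N i. \<bar>trunc_wt K N w i j\<bar> * (2 * (2 * K) ^ k))"
    unfolding nb_op_def
    by (intro order_trans[OF sum_abs] sum_mono) (simp add: abs_mult mult_left_mono)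
  also have "\<dots> \<le> K * (2 * (2 * K) ^ k)"
    unfolding sum_distrib_right[symmetric] using K by (intro mult_right_mono sum_trunc_wt_le) auto
  finally show ?case by (simp add: mult_ac)
qed

lemma loop_wt_bound: "K \<ge> 0 \<Longrightarrow> \<alpha> \<in> {0, 1} \<Longrightarrow> \<bar>loop_wt \<alpha> K N w k v\<bar> \<le> (2 * K) ^ k"
  unfolding loop_wt_def by (rule funpow_nb_op_bound) auto

text \<open>Locality of walks. \<open>B t\<close> plays the role of the ball of radius
  \<open>t\<close>: \<open>m\<close> steps from \<open>B t\<close> end in \<open>B (t + m)\<close>,
  and truncation there inspects the neighbours of that layer, hence the strict bound
  \<open>t + m < r\<close>. The layers are abstract so that balls and whole components are both
  covered.\<close>

lemma funpow_nb_op_transport: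
  assumes nb: "\<And>t i. t < r \<Longrightarrow> i \<in> B t \<Longrightarrow> N i \<subseteq> B (Suc t)"
    and nb': "\<And>t i. t < r \<Longrightarrow> i \<in> B t \<Longrightarrow> N' (\<phi> i) = \<phi> ` N i"
    and inj: "inj_on \<phi> V" and BV: "\<And>t. t \<le> r \<Longrightarrow> B t \<subseteq> V" and v: "v \<in> V"
    and w: "\<And>t i j. t < r \<Longrightarrow> i \<in> B t \<Longrightarrow> j \<in> N i \<Longrightarrow> w' (\<phi> i) (\<phi> j) = w i j"
  shows "t + m < r \<Longrightarrow> i \<in> B t \<Longrightarrow>
    (nb_op \<alpha> K N' w' ^^ m) (\<lambda>u. if u = \<phi> v then 1 else 0) (\<phi> i) = (nb_op \<alpha> K N w ^^ m) (\<lambda>u. if u = v then 1 else 0) i"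
proof (induction m arbitrary: t i)
  case 0
  then have "i \<in> V" using BV[of t] by auto
  then show ?case using inj v by (auto simp: inj_on_eq_iff)
next
  case (Suc m)
  have injN: "inj_on \<phi> (N i)" if "t < r" "i \<in> B t" for t i
    by (rule inj_on_subset[OF inj]) (use nb[OF that] BV[of "Suc t"] that in auto)
  have deg: "nb_deg N' w' (\<phi> i) = nb_deg N w i" if "t < r" "i \<in> B t" for t i
    unfolding nb_deg_def nb'[OF that] using that w
    by (subst sum.reindex[OF injN[OF that]]) (auto intro!: sum.cong)
  let ?x' = "(nb_op \<alpha> K N' w' ^^ m) (\<lambda>u. if u = \<phi> v then 1 else 0)"
  let ?x = "(nb_op \<alpha> K N w ^^ m) (\<lambda>u. if u = v then 1 else 0)"
  have t: "t < r" "Suc t < r" "t + m < r" "Suc t + m < r" using Suc.prems by auto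
  have i: "i \<in> B t" by fact
  have "nb_op \<alpha> K N' w' ?x' (\<phi> i) = (\<Sum>j\<in>N i. trunc_wt K N' w' (\<phi> i) (\<phi> j) * (?x' (\<phi> j) - \<alpha> * ?x' (\<phi> i)))"
    unfolding nb_op_def nb'[OF t(1) i] by (subst sum.reindex[OF injN[OF t(1) i]]) simp
  also have "\<dots> = (\<Sum>j\<in>N i. trunc_wt K N w i j * (?x j - \<alpha> * ?x i))"
  proof (rule sum.cong[OF refl])
    fix j assume j: "j \<in> N i"
    then have jB: "j \<in> B (Suc t)" using nb[OF t(1) i] by auto
    show "trunc_wt K N' w' (\<phi> i) (\<phi> j) * (?x' (\<phi> j) - \<alpha> * ?x' (\<phi> i)) = trunc_wt K N w i j * (?x j - \<alpha> * ?x i)"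
      unfolding trunc_wt_def deg[OF t(1) i] deg[OF t(2) jB] w[OF t(1) i j] Suc.IH[OF t(3) i] Suc.IH[OF t(4) jB] ..
  qed
  also have "\<dots> = nb_op \<alpha> K N w ?x i" by (simp only: nb_op_def[of \<alpha> K N w ?x i])
  finally show ?case by simp
qed

section \<open>Balls in rooted graphs and the locality of closed-walk weights\<close>

definition rg_nb :: "rgraph \<Rightarrow> nat \<Rightarrow> nat set" where
  "rg_nb R i = {j. rg_edge R i j}"

abbreviation rg_root :: "rgraph \<Rightarrow> nat" where
  "rg_root R \<equiv> snd (snd R)"

abbreviation rg_verts :: "nat \<Rightarrow> rgraph \<Rightarrow> nat set" where
  "rg_verts r R \<equiv> fst (rg_ball r R)"

lemma rg_verts_eq: "rg_verts r R = {v \<in> fst R. \<exists>k\<le>r. (rg_edge R ^^ k) (rg_root R) v}"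
  by (simp add: rg_ball_def Let_def)

lemma rg_root_ball [simp]: "rg_root (rg_ball r R) = rg_root R"
  by (simp add: rg_ball_def Let_def)

lemma rg_edge_ball: "rg_edge (rg_ball r R) x y \<longleftrightarrow> x \<in> rg_verts r R \<and> y \<in> rg_verts r R \<and> rg_edge R x y"
  by (auto simp: rg_edge_def rg_ball_def Let_def)

lemma rg_nb_subset_verts: "t < r \<Longrightarrow> i \<in> rg_verts t R \<Longrightarrow> rg_nb R i \<subseteq> rg_verts (Suc t) R"
proof
  fix j assume "t < r" and i: "i \<in> rg_verts t R" and "j \<in> rg_nb R i"
  then have e: "rg_edge R i j" by (simp add: rg_nb_def)
  obtain k where k: "k \<le> t" "(rg_edge R ^^ k) (rg_root R) i" using i by (auto simp: rg_verts_eq)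
  then have "(rg_edge R ^^ Suc k) (rg_root R) j" using e by (auto intro: relpowp_Suc_I)
  moreover have "j \<in> fst R" using e by (simp add: rg_edge_def)
  ultimately show "j \<in> rg_verts (Suc t) R" using k(1) unfolding rg_verts_eq
    by (intro CollectI conjI exI[of _ "Suc k"]) auto
qed

lemma rg_verts_mono: "t \<le> r \<Longrightarrow> rg_verts t R \<subseteq> rg_verts r R"
  unfolding rg_verts_eq using order_trans by blast

lemma root_in_rg_verts: "rooted_graph R \<Longrightarrow> rg_root R \<in> rg_verts r R"
  unfolding rg_verts_eq rooted_graph_def by (auto intro!: exI[of _ 0])

text \<open>An isomorphism of balls of radius \<open>r\<close> is certain to match full
  neighbourhoods only at depth below \<open>r\<close>; a closed walk of length \<open>k < r\<close>
  and its truncated weights see nothing else.\<close>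

lemma rooted_iso_transport:
  assumes R: "rooted_graph R"
    and f: "bij_betw f (rg_verts r R) (rg_verts r R')" "f (rg_root R) = rg_root R'"
    and e: "\<And>u v. u \<in> rg_verts r R \<Longrightarrow> v \<in> rg_verts r R \<Longrightarrow> rg_edge R u v \<longleftrightarrow> rg_edge R' (f u) (f v)"
    and k: "k < r"
  shows "loop_wt \<alpha> K (rg_nb R') w k (rg_root R') = loop_wt \<alpha> K (rg_nb R) (\<lambda>i j. w (f i) (f j)) k (rg_root R)"
proof -
  have fV: "f i \<in> rg_verts r R'" if "i \<in> rg_verts r R" for i using f that by (auto simp: bij_betw_def)
  \<comment> \<open>A path of length at most \<open>r\<close> from the root stays in the ball, so
    \<open>f\<close> maps it to a path and does not increase depth.\<close>
  have path: "(rg_edge R ^^ m) (rg_root R) i \<Longrightarrow> m \<le> r \<Longrightarrow> (rg_edge R' ^^ m) (rg_root R') (f i)" for m i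
  proof (induction m arbitrary: i)
    case 0
    then show ?case using f by auto
  next
    case (Suc m)
    then obtain u where u: "(rg_edge R ^^ m) (rg_root R) u" "rg_edge R u i" by (auto elim: relpowp_Suc_E)
    have "u \<in> fst R" "i \<in> fst R" using u(2) by (auto simp: rg_edge_def)
    moreover have "\<exists>k\<le>r. (rg_edge R ^^ k) (rg_root R) u" "\<exists>k\<le>r. (rg_edge R ^^ k) (rg_root R) i"
      using u(1) Suc.prems Suc_leD by blast+
    ultimately have "u \<in> rg_verts r R" "i \<in> rg_verts r R" by (auto simp: rg_verts_eq)
    then have "rg_edge R' (f u) (f i)" using e u by simp
    then show ?case using Suc.IH[OF u(1)] Suc.prems by (auto intro: relpowp_Suc_I)
  qed
  have nb': "rg_nb R' (f i) = f ` rg_nb R i" if t: "t < r" and i: "i \<in> rg_verts t R" for t i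
  proof -
    have ir: "i \<in> rg_verts r R" using rg_verts_mono[of t r R] t i by auto
    obtain m where m: "m \<le> t" "(rg_edge R ^^ m) (rg_root R) i" using i by (auto simp: rg_verts_eq)
    have fi: "f i \<in> rg_verts t R'"
      using path[OF m(2)] m(1) t fV[OF ir] by (auto simp: rg_verts_eq)
    show ?thesis
    proof (intro equalityI subsetI)
      fix j' assume j': "j' \<in> rg_nb R' (f i)"
      then have "j' \<in> rg_verts r R'"
        using rg_nb_subset_verts[OF t fi] rg_verts_mono[of "Suc t" r R'] t by auto
      then obtain j where j: "j \<in> rg_verts r R" "j' = f j" using f by (auto simp: bij_betw_def)
      then show "j' \<in> f ` rg_nb R i" using e[OF ir j(1)] j' by (auto simp: rg_nb_def)
    next
      fix j' assume "j' \<in> f ` rg_nb R i"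
      then obtain j where j: "j \<in> rg_nb R i" "j' = f j" by auto
      then have "j \<in> rg_verts r R"
        using rg_nb_subset_verts[OF t i] rg_verts_mono[of "Suc t" r R] t by auto
      then show "j' \<in> rg_nb R' (f i)" using e[OF ir] j by (auto simp: rg_nb_def)
    qed
  qed
  have "(nb_op \<alpha> K (rg_nb R') w ^^ k) (\<lambda>u. if u = f (rg_root R) then 1 else 0) (f (rg_root R))
    = (nb_op \<alpha> K (rg_nb R) (\<lambda>i j. w (f i) (f j)) ^^ k) (\<lambda>u. if u = rg_root R then 1 else 0) (rg_root R)"
    by (rule funpow_nb_op_transport[where r = r and B = "\<lambda>t. rg_verts t R" and t = 0 and V = "rg_verts r R"])
       (use f k R in \<open>auto simp: nb' bij_betw_def root_in_rg_verts dest: rg_nb_subset_verts[THEN subsetD] rg_verts_mono[THEN subsetD]\<close>)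
  then show ?thesis by (simp add: loop_wt_def f)
qed

text \<open>Locality with the identity in place of an isomorphism. Rooted graphs have no loops, so
  diagonal weights are never read.\<close>

lemma loop_wt_cong_ball:
  assumes R: "rooted_graph R" and k: "k < r"
    and w: "\<And>i j. i \<in> rg_verts r R \<Longrightarrow> j \<in> rg_verts r R \<Longrightarrow> i \<noteq> j \<Longrightarrow> w i j = w' i j"
  shows "loop_wt \<alpha> K (rg_nb R) w k (rg_root R) = loop_wt \<alpha> K (rg_nb R) w' k (rg_root R)"
proof -
  have "w' i j = w i j" if "t < r" "i \<in> rg_verts t R" "j \<in> rg_nb R i" for t i j
  proof -
    have "i \<noteq> j" using R that by (auto simp: rooted_graph_def rg_nb_def)
    moreover have "i \<in> rg_verts r R" using rg_verts_mono[of t r R] that by auto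
    moreover have "j \<in> rg_verts r R" using rg_nb_subset_verts[OF that(1,2)] rg_verts_mono[of "Suc t" r R] that by auto
    ultimately show ?thesis using w by simp
  qed
  then have "(nb_op \<alpha> K (rg_nb R) w' ^^ k) (\<lambda>u. if u = id (rg_root R) then 1 else 0) (id (rg_root R))
    = (nb_op \<alpha> K (rg_nb R) w ^^ k) (\<lambda>u. if u = rg_root R then 1 else 0) (rg_root R)"
    by (intro funpow_nb_op_transport[where r = r and B = "\<lambda>t. rg_verts t R" and t = 0 and V = "rg_verts r R"])
       (use k R in \<open>auto simp: root_in_rg_verts dest: rg_nb_subset_verts[THEN subsetD] rg_verts_mono[THEN subsetD]\<close>)
  then show ?thesis by (simp add: loop_wt_def)
qed

text \<open>If the set of good radii is finite, its supremum is attained and exceeds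
  \<open>r\<close>. If it is infinite, the supremum of natural numbers carries no information, and a
  large radius is taken from the set itself. Hence the claim speaks of some radius at least
  \<open>r\<close>.\<close>

lemma ldist_small_imp_iso:
  assumes "ldist G H < 1 / (real r + 1)"
  shows "\<exists>r'\<ge>r. rooted_iso (rg_ball r' G) (rg_ball r' H)"
proof -
  define S where "S = {r. rooted_iso (rg_ball r G) (rg_ball r H)}"
  show ?thesis
  proof (cases "finite S")
    case False
    then have "\<exists>n\<ge>r. n \<in> S" by (simp add: infinite_nat_iff_unbounded_le)
    then show ?thesis by (auto simp: S_def)
  next
    case True
    have "\<not> (\<forall>r. rooted_iso (rg_ball r G) (rg_ball r H))"
    proof
      assume "\<forall>r. rooted_iso (rg_ball r G) (rg_ball r H)"
      then have "S = UNIV" by (simp add: S_def)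
      then show False using True by simp
    qed
    then have "ldist G H = 1 / (real (Sup S) + 1)" unfolding ldist_def S_def by (rule if_not_P)
    then have "1 / (real (Sup S) + 1) < 1 / (real r + 1)" using assms by simp
    then have "r < Sup S" by (simp add: field_simps)
    then have "S \<noteq> {}" "r < Max S" by (auto simp: Sup_nat_def split: if_splits)
    moreover have "Max S \<in> S" using Max_in[OF True] calculation(1) .
    ultimately show ?thesis by (intro exI[of _ "Max S"]) (simp add: S_def)
  qed
qed

text \<open>A component contains all neighbours of its vertices, so in the locality lemma every
  layer can be the whole component.\<close>

lemma loop_wt_comp_at:
  assumes A: "simple_graph_on n A" and v: "v < n"
  shows "loop_wt \<alpha> K (rg_nb (comp_at n A v)) w k (rg_root (comp_at n A v)) = loop_wt \<alpha> K (\<lambda>i. {j. A i j}) w k v"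
proof -
  let ?E = "\<lambda>x y. x < n \<and> y < n \<and> A x y"
  define V where "V = {u. u < n \<and> ?E\<^sup>*\<^sup>* v u}"
  have c: "comp_at n A v = (V, \<lambda>x y. x \<in> V \<and> y \<in> V \<and> A x y, v)" by (simp add: comp_at_def V_def Let_def)
  have cl: "j \<in> V" if "i \<in> V" "A i j" for i j
  proof -
    have "?E i j" using that A by (auto simp: simple_graph_on_def)
    then show ?thesis using that by (auto simp: V_def intro: rtranclp.rtrancl_into_rtrancl)
  qed
  have nb: "rg_nb (comp_at n A v) i = {j. A i j}" if "i \<in> V" for i
    using that cl by (auto simp: rg_nb_def rg_edge_def c)
  have vV: "v \<in> V" using v by (simp add: V_def)
  have "(nb_op \<alpha> K (\<lambda>i. {j. A i j}) w ^^ k) (\<lambda>u. if u = id v then 1 else 0) (id v)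
    = (nb_op \<alpha> K (rg_nb (comp_at n A v)) w ^^ k) (\<lambda>u. if u = v then 1 else 0) v"
    by (rule funpow_nb_op_transport[where r = "Suc k" and B = "\<lambda>t. V" and t = 0 and V = V])
       (use vV nb cl in auto)
  then show ?thesis by (simp add: loop_wt_def c)
qed

section \<open>Weighted adjacency and Laplacian matrices\<close>

lemma finite_nb:
  assumes "simple_graph_on n A"
  shows "{j. A i j} \<subseteq> {..<n}" "finite {j. A i j}"
proof -
  show "{j. A i j} \<subseteq> {..<n}" using assms by (auto simp: simple_graph_on_def)
  then show "finite {j. A i j}" by (rule finite_subset) simp
qed

lemma sum_adj:
  assumes "simple_graph_on n A"
  shows "(\<Sum>j<n. adj A i j * f j) = (\<Sum>j\<in>{j. A i j}. f j)"
proof -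
  have "(\<Sum>j\<in>{j. A i j}. f j) = (\<Sum>j\<in>{j. A i j}. adj A i j * f j)"
    by (intro sum.cong) (auto simp: adj_def)
  also have "\<dots> = (\<Sum>j<n. adj A i j * f j)"
    using finite_nb[OF assms] by (intro sum.mono_neutral_left) (auto simp: adj_def)
  finally show ?thesis by simp
qed

lemma sum_adj':
  assumes "simple_graph_on n A"
  shows "(\<Sum>j<n. f j * adj A i j) = (\<Sum>j\<in>{j. A i j}. f j)"
  using sum_adj[OF assms, of i f] by (simp add: mult.commute)

lemma wdeg_eq_nb_deg: "simple_graph_on n A \<Longrightarrow> wdeg n w A v = nb_deg (\<lambda>i. {j. A i j}) w v"
  by (simp add: wdeg_def nb_deg_def sum_adj)

lemma Delta_sym:
  assumes A: "simple_graph_on n A" and w: "\<And>i j. w i j = w j i"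
  shows "Delta \<alpha> n w A i j = Delta \<alpha> n w A j i"
proof -
  have "adj A i j = adj A j i" using A by (auto simp: simple_graph_on_def adj_def)
  then show ?thesis using w[of i j] by (auto simp: Delta_def)
qed

lemma trunc_wt_sym: "(\<And>i j. w i j = w j i) \<Longrightarrow> trunc_wt K N w i j = trunc_wt K N w j i"
  by (auto simp: trunc_wt_def)

lemma Delta_apply:
  assumes A: "simple_graph_on n A"
  shows "(\<Sum>b<n. Delta \<alpha> n u A a b * x b) = (\<Sum>j\<in>{j. A a j}. u a j * (x j - \<alpha> * x a))"
proof (cases "a < n")
  case True
  have "(\<Sum>b<n. Delta \<alpha> n u A a b * x b)
      = (\<Sum>b<n. (u a b * x b) * adj A a b) - (\<Sum>b<n. if a = b then \<alpha> * (\<Sum>k<n. u a k * adj A a k) * x b else 0)"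
    unfolding sum_subtractf[symmetric] by (intro sum.cong refl) (auto simp: Delta_def algebra_simps)
  also have "\<dots> = (\<Sum>j\<in>{j. A a j}. u a j * x j) - \<alpha> * (\<Sum>j\<in>{j. A a j}. u a j) * x a"
    using True by (simp add: sum_adj'[OF A])
  also have "\<dots> = (\<Sum>j\<in>{j. A a j}. u a j * (x j - \<alpha> * x a))"
    by (simp add: sum_subtractf sum_distrib_left sum_distrib_right algebra_simps)
  finally show ?thesis .
next
  case False
  then have "\<not> A a j" for j using A by (auto simp: simple_graph_on_def)
  then show ?thesis using False by (auto simp: Delta_def adj_def intro!: sum.neutral)
qed

lemma Delta_trunc_eq_nb_op:
  assumes A: "simple_graph_on n A"
  shows "(\<lambda>x a. \<Sum>b<n. Delta \<alpha> n (trunc_wt K (\<lambda>i. {j. A i j}) w) A a b * x b) = nb_op \<alpha> K (\<lambda>i. {j. A i j}) w"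
  unfolding Delta_apply[OF A] nb_op_def[abs_def] ..

lemma Delta_row_sum_le:
  assumes A: "simple_graph_on n A" and \<alpha>: "\<alpha> \<in> {0, 1}"
  shows "(\<Sum>b<n. \<bar>Delta \<alpha> n u A a b\<bar>) \<le> 2 * (\<Sum>j\<in>{j. A a j}. \<bar>u a j\<bar>)"
proof -
  let ?S = "\<Sum>j\<in>{j. A a j}. \<bar>u a j\<bar>"
  have "\<bar>Delta \<alpha> n u A a b\<bar> \<le> \<bar>u a b\<bar> * adj A a b + (if a = b then ?S else 0)" for b
  proof -
    have "\<bar>\<Sum>k<n. u a k * adj A a k\<bar> \<le> ?S" unfolding sum_adj'[OF A] by (rule sum_abs)
    moreover have "?S \<ge> 0" by (simp add: sum_nonneg)
    ultimately show ?thesis using \<alpha> by (auto simp: Delta_def adj_def)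
  qed
  then have "(\<Sum>b<n. \<bar>Delta \<alpha> n u A a b\<bar>) \<le> (\<Sum>b<n. \<bar>u a b\<bar> * adj A a b + (if a = b then ?S else 0))"
    by (intro sum_mono)
  also have "\<dots> = ?S + (\<Sum>b<n. if a = b then ?S else 0)"
    by (simp add: sum.distrib sum_adj'[OF A])
  also have "\<dots> \<le> 2 * ?S" by (simp add: sum_nonneg)
  finally show ?thesis .
qed

lemma Delta_diff: "Delta \<alpha> n u A i j - Delta \<alpha> n u' A i j = Delta \<alpha> n (\<lambda>i j. u i j - u' i j) A i j"
  by (simp add: Delta_def algebra_simps sum_subtractf)

text \<open>A deleted edge has an endpoint of degree above \<open>K\<close> and is charged to such
  endpoints. Each edge occurs in two rows, and the diagonal at most doubles a row sum; together this
  gives the factor 4.\<close>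

lemma Delta_trunc_l1_le:
  assumes A: "simple_graph_on n A" and \<alpha>: "\<alpha> \<in> {0, 1}" and w: "\<And>i j. w i j = w j i"
  shows "(\<Sum>i<n. \<Sum>j<n. \<bar>Delta \<alpha> n w A i j - Delta \<alpha> n (trunc_wt K (\<lambda>i. {j. A i j}) w) A i j\<bar>)
    \<le> 4 * (\<Sum>v<n. if wdeg n w A v > K then wdeg n w A v else 0)"
proof -
  let ?N = "\<lambda>i. {j. A i j}"
  define h where "h i j = (if nb_deg ?N w i > K then \<bar>w i j\<bar> else 0)" for i j
  have "(\<Sum>i<n. \<Sum>j<n. \<bar>Delta \<alpha> n w A i j - Delta \<alpha> n (trunc_wt K ?N w) A i j\<bar>)
      \<le> (\<Sum>i<n. 2 * (\<Sum>j\<in>?N i. \<bar>w i j - trunc_wt K ?N w i j\<bar>))"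
    unfolding Delta_diff by (intro sum_mono Delta_row_sum_le[OF A \<alpha>])
  also have "\<dots> \<le> (\<Sum>i<n. 2 * (\<Sum>j\<in>?N i. h i j + h j i))"
    using w by (intro sum_mono mult_left_mono) (auto simp: h_def trunc_wt_def)
  also have "\<dots> = 2 * (\<Sum>i<n. \<Sum>j<n. adj A i j * h i j) + 2 * (\<Sum>i<n. \<Sum>j<n. adj A i j * h j i)"
    by (simp add: sum_adj[OF A] sum.distrib sum_distrib_left)
  also have "(\<Sum>i<n. \<Sum>j<n. adj A i j * h j i) = (\<Sum>j<n. \<Sum>i<n. adj A j i * h j i)"
  proof -
    have "adj A i j = adj A j i" for i j using A by (auto simp: simple_graph_on_def adj_def)
    then show ?thesis by (subst sum.swap) simp
  qed
  also have "(\<Sum>i<n. \<Sum>j<n. adj A i j * h i j) = (\<Sum>v<n. if wdeg n w A v > K then wdeg n w A v else 0)"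
    unfolding sum_adj[OF A] wdeg_eq_nb_deg[OF A] by (intro sum.cong refl) (simp add: h_def nb_deg_def)
  finally show ?thesis by simp
qed

lemma ramp_sum_trunc_diff_le:
  assumes A: "simple_graph_on n A" and \<alpha>: "\<alpha> \<in> {0, 1}" and w: "\<And>i j. w i j = w j i" and ab: "a < b"
  shows "\<bar>ramp_sum n (Delta \<alpha> n w A) a b - ramp_sum n (Delta \<alpha> n (trunc_wt K (\<lambda>i. {j. A i j}) w) A) a b\<bar>
    \<le> 8 / (b - a) * (\<Sum>v<n. if wdeg n w A v > K then wdeg n w A v else 0)"
proof -
  let ?T = "trunc_wt K (\<lambda>i. {j. A i j}) w"
  have "\<bar>ramp_sum n (Delta \<alpha> n w A) a b - ramp_sum n (Delta \<alpha> n ?T A) a b\<bar>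
    \<le> 2 / (b - a) * (\<Sum>i<n. \<Sum>j<n. \<bar>Delta \<alpha> n w A i j - Delta \<alpha> n ?T A i j\<bar>)"
    by (rule ramp_sum_diff_le_l1[OF Delta_sym[OF A w] Delta_sym[OF A trunc_wt_sym[OF w]] ab])
  also have "\<dots> \<le> 2 / (b - a) * (4 * (\<Sum>v<n. if wdeg n w A v > K then wdeg n w A v else 0))"
    using ab by (intro mult_left_mono Delta_trunc_l1_le[OF A \<alpha> w]) auto
  finally show ?thesis by simp
qed

lemma eigensystem_poly_trace:
  assumes es: "eigensystem n M l u"
  shows "(\<Sum>i<n. \<Sum>k\<le>d. c k * l i ^ k) =
     (\<Sum>v<n. \<Sum>k\<le>d. c k * ((\<lambda>x a. \<Sum>b<n. M a b * x b) ^^ k) (\<lambda>b. if b = v then 1 else 0) v)"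
proof -
  have "(\<Sum>i<n. \<Sum>k\<le>d. c k * l i ^ k) = (\<Sum>k\<le>d. c k * (\<Sum>i<n. l i ^ k))"
    unfolding sum_distrib_left by (rule sum.swap)
  also have "\<dots> = (\<Sum>k\<le>d. c k * (\<Sum>v<n. ((\<lambda>x a. \<Sum>b<n. M a b * x b) ^^ k) (\<lambda>b. if b = v then 1 else 0) v))"
    by (simp add: eigensystem_trace_funpow[OF es])
  also have "\<dots> = (\<Sum>v<n. \<Sum>k\<le>d. c k * ((\<lambda>x a. \<Sum>b<n. M a b * x b) ^^ k) (\<lambda>b. if b = v then 1 else 0) v)"
    unfolding sum_distrib_left by (rule sum.swap)
  finally show ?thesis .
qed

lemma ramp_sum_trunc_approx:
  assumes A: "simple_graph_on n A" and \<alpha>: "\<alpha> \<in> {0, 1}" and w: "\<And>i j. w i j = w j i" and K: "K \<ge> 0"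
    and p: "\<And>x. x \<in> {-2 * K..2 * K} \<Longrightarrow> \<bar>ramp a b x - (\<Sum>k\<le>d. c k * x ^ k)\<bar> \<le> \<epsilon>"
  shows "\<bar>ramp_sum n (Delta \<alpha> n (trunc_wt K (\<lambda>i. {j. A i j}) w) A) a b
    - (\<Sum>v<n. \<Sum>k\<le>d. c k * loop_wt \<alpha> K (\<lambda>i. {j. A i j}) w k v)\<bar> \<le> real n * \<epsilon>"
proof -
  let ?T = "trunc_wt K (\<lambda>i. {j. A i j}) w"
  let ?D = "Delta \<alpha> n ?T A"
  have "?D i j = ?D j i" for i j by (rule Delta_sym[OF A], rule trunc_wt_sym, rule w)
  then obtain l u where l: "eigensystem n ?D l u" using eigensystem_exists[of n ?D] by blast
  \<comment> \<open>One \<open>K\<close> comes from the off-diagonal entries of the row, the other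
    from the diagonal.\<close>
  have "(\<Sum>b<n. \<bar>?D a' b\<bar>) \<le> 2 * K" for a'
    using Delta_row_sum_le[OF A \<alpha>, of ?T a'] sum_trunc_wt_le[OF K, of "\<lambda>i. {j. A i j}" w a'] by simp
  then have lb: "\<bar>l i\<bar> \<le> 2 * K" if "i < n" for i
    using eigensystem_abs_le_row_sum[OF l] that by blast
  have "ramp_sum n ?D a b - (\<Sum>v<n. \<Sum>k\<le>d. c k * loop_wt \<alpha> K (\<lambda>i. {j. A i j}) w k v)
      = (\<Sum>i<n. ramp a b (l i) - (\<Sum>k\<le>d. c k * l i ^ k))"
    unfolding loop_wt_def Delta_trunc_eq_nb_op[OF A, symmetric] sum_subtractf eigensystem_poly_trace[OF l, symmetric]
      ramp_sum_eigensystem[OF l] ..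
  also have "\<bar>\<dots>\<bar> \<le> (\<Sum>i<n. \<epsilon>)"
  proof (rule order_trans[OF sum_abs], rule sum_mono)
    fix i assume "i \<in> {..<n}"
    then show "\<bar>ramp a b (l i) - (\<Sum>k\<le>d. c k * l i ^ k)\<bar> \<le> \<epsilon>" using lb[of i] by (intro p) (auto simp: abs_le_iff)
  qed
  finally show ?thesis by simp
qed

lemma ramp_bounds: "a < b \<Longrightarrow> 0 \<le> ramp a b x" "a < b \<Longrightarrow> ramp a b x \<le> 1"
  by (auto simp: ramp_def)

lemma ramp_poly_approx:
  assumes "a < b" "\<epsilon> > 0"
  shows "\<exists>c d. \<forall>x\<in>{-R..R}. \<bar>ramp a b x - (\<Sum>k\<le>d. c k * x ^ k)\<bar> \<le> \<epsilon>"
proof -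
  have eq: "ramp a b = (\<lambda>x. max 0 (min 1 ((b - x) / (b - a))))"
    using assms by (auto simp: ramp_def fun_eq_iff min_def max_def field_simps)
  have "continuous_on {-R..R} (ramp a b)"
    unfolding eq using assms by (intro continuous_intros) auto
  then obtain g where g: "real_polynomial_function g" "\<And>x. x \<in> {-R..R} \<Longrightarrow> \<bar>ramp a b x - g x\<bar> < \<epsilon>"
    using Stone_Weierstrass_real_polynomial_function[of "{-R..R}" "ramp a b" \<epsilon>] assms by auto
  obtain c d where "g = (\<lambda>x. \<Sum>i\<le>d. c i * x ^ i)" using g(1) by (auto simp: real_polynomial_function_iff_sum)
  then show ?thesis using g(2) by (intro exI[of _ c] exI[of _ d]) (auto intro: less_imp_le)
qed

text \<open>Eigenvalues are not selected measurably. Instead, the ramp sum is a pointwise limit of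
  traces of polynomials in the matrix, and these are polynomials in its entries.\<close>

lemma measurable_ramp_sum:
  fixes F :: "'x \<Rightarrow> nat \<Rightarrow> nat \<Rightarrow> real"
  assumes m [measurable]: "\<And>i j. (\<lambda>x. F x i j) \<in> borel_measurable M" and sym: "\<And>x i j. F x i j = F x j i" and ab: "a < b"
  shows "(\<lambda>x. ramp_sum n (F x) a b) \<in> borel_measurable M"
proof -
  \<comment> \<open>\<open>m\<close> governs both the accuracy and the interval, so for a fixed
    matrix all eigenvalues are covered as soon as \<open>m\<close> is large.\<close>
  have "\<forall>m::nat. \<exists>c d. \<forall>x\<in>{-real m..real m}. \<bar>ramp a b x - (\<Sum>k\<le>d. c k * x ^ k)\<bar> \<le> 1 / real (Suc m)"
    by (intro allI ramp_poly_approx ab) simp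
  then obtain c d where cd: "\<And>m x. x \<in> {-real m..real m} \<Longrightarrow> \<bar>ramp a b x - (\<Sum>k\<le>d m. c m k * x ^ k)\<bar> \<le> 1 / real (Suc m)"
    by metis
  define g where "g m x = (\<Sum>v<n. \<Sum>k\<le>d m. c m k * ((\<lambda>y a. \<Sum>b<n. F x a b * y b) ^^ k) (\<lambda>b. if b = v then 1 else 0) v)" for m x
  have fm: "(\<lambda>x. ((\<lambda>y a. \<Sum>b<n. F x a b * y b) ^^ k) (\<lambda>b. if b = v then 1 else 0) i) \<in> borel_measurable M" for k v i
  proof (induction k arbitrary: i)
    case (Suc k)
    have "(\<lambda>x. \<Sum>b<n. F x i b * ((\<lambda>y a. \<Sum>b<n. F x a b * y b) ^^ k) (\<lambda>b. if b = v then 1 else 0) b) \<in> borel_measurable M"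
      by (intro borel_measurable_sum borel_measurable_times m Suc)
    then show ?case by simp
  qed simp
  have "g m \<in> borel_measurable M" for m
    unfolding g_def by (intro borel_measurable_sum borel_measurable_times fm borel_measurable_const)
  moreover have "(\<lambda>m. g m x) \<longlonglongrightarrow> ramp_sum n (F x) a b" for x
  proof -
    obtain l u where l: "eigensystem n (F x) l u" using eigensystem_exists[of n "F x"] sym by blast
    have eq: "g m x = (\<Sum>i<n. \<Sum>k\<le>d m. c m k * l i ^ k)" for m
      unfolding g_def eigensystem_poly_trace[OF l] ..
    have "(\<lambda>m. \<Sum>k\<le>d m. c m k * l i ^ k) \<longlonglongrightarrow> ramp a b (l i)" for i
    proof (rule LIM_zero_cancel, rule tendsto_rabs_zero_cancel, rule tendsto_sandwich[of "\<lambda>_. 0" _ _ "\<lambda>m. 1 / real (Suc m)"])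
      show "\<forall>\<^sub>F m in sequentially. \<bar>(\<Sum>k\<le>d m. c m k * l i ^ k) - ramp a b (l i)\<bar> \<le> 1 / real (Suc m)"
        using eventually_ge_at_top[of "nat \<lceil>\<bar>l i\<bar>\<rceil>"]
      proof eventually_elim
        case (elim m)
        then have "\<bar>l i\<bar> \<le> real m" by linarith
        then have "l i \<in> {-real m..real m}" by auto
        then show ?case using cd[of "l i" m] by (simp add: abs_minus_commute)
      qed
      show "(\<lambda>m. 1 / real (Suc m)) \<longlonglongrightarrow> 0" by (rule LIMSEQ_Suc[OF lim_1_over_n])
    qed auto
    then show ?thesis unfolding eq ramp_sum_eigensystem[OF l] by (intro tendsto_sum)
  qed
  ultimately show ?thesis by (rule borel_measurable_LIMSEQ_real[rotated])
qed

text \<open>The ramp lies between the indicators of the half-lines ending at \<open>a\<close> and at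
  \<open>b\<close>; this is the link from ramps back to distribution functions.\<close>

lemma esd_cdf_bounds:
  assumes sym: "\<And>i j. M i j = M j i" and n: "n > 0" and ab: "a < b"
  shows "measure (esd n M) {..a} \<le> ramp_sum n M a b / real n"
    "ramp_sum n M a b / real n \<le> measure (esd n M) {..b}"
    "0 \<le> ramp_sum n M a b / real n" "ramp_sum n M a b / real n \<le> 1"
proof -
  obtain l u where l: "eigensystem n M l u" using eigensystem_exists[of n M] sym by blast
  have ne: "{..<n} \<noteq> {}" using n by auto
  have "esd n M = measure_pmf (map_pmf l (pmf_of_set {..<n}))"
    unfolding esd_def using l ne by (simp add: map_pmf_of_set eigensystem_def)
  then have eq: "measure (esd n M) {..x} = card ({..<n} \<inter> l -` {..x}) / real n" for x
    using ne by (simp add: measure_pmf_of_set)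
  have sum_card: "real (card ({..<n} \<inter> l -` {..x})) = (\<Sum>i<n. if l i \<le> x then 1 else 0)" for x
    by (subst sum.inter_filter[symmetric]) (auto intro!: arg_cong[of _ _ card])
  show "measure (esd n M) {..a} \<le> ramp_sum n M a b / real n"
    unfolding eq sum_card ramp_sum_eigensystem[OF l] using ab
    by (intro divide_right_mono sum_mono) (auto simp: ramp_def)
  show "ramp_sum n M a b / real n \<le> measure (esd n M) {..b}"
    unfolding eq sum_card ramp_sum_eigensystem[OF l] using ab
    by (intro divide_right_mono sum_mono) (auto simp: ramp_def field_simps)
  show "0 \<le> ramp_sum n M a b / real n"
    unfolding ramp_sum_eigensystem[OF l] by (intro divide_nonneg_nonneg sum_nonneg ramp_bounds ab) auto
  have "(\<Sum>i<n. ramp a b (l i)) \<le> (\<Sum>i<n. 1)" by (intro sum_mono ramp_bounds ab)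
  then show "ramp_sum n M a b / real n \<le> 1"
    unfolding ramp_sum_eigensystem[OF l] using n by simp
qed

lemma ramp_sum_zero:
  assumes "\<And>i j. M i j = (0 :: real)"
  shows "ramp_sum n M a b = real n * ramp a b 0"
proof -
  obtain l u where l: "eigensystem n M l u" using eigensystem_exists[of n M] assms by auto
  have "\<bar>l i\<bar> \<le> 0" if "i < n" for i
    by (rule eigensystem_abs_le_row_sum[OF l _ that]) (simp add: assms)
  then show ?thesis unfolding ramp_sum_eigensystem[OF l] by simp
qed

section \<open>Independent weights\<close>

definition upair :: "nat \<Rightarrow> nat \<Rightarrow> nat \<times> nat" where
  "upair i j = (min i j, max i j)"

text \<open>Rebuilds a symmetric weight matrix from one number per unordered pair, with 0 outside
  \<open>J\<close>. Functionals of the matrix thereby become functions on a product space.\<close>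

definition ext_wt :: "(nat \<times> nat) set \<Rightarrow> (nat \<times> nat \<Rightarrow> real) \<Rightarrow> nat \<Rightarrow> nat \<Rightarrow> real" where
  "ext_wt J x i j = (if upair i j \<in> J then x (upair i j) else 0)"

lemma upair_commute: "upair i j = upair j i"
  by (simp add: upair_def min.commute max.commute)

lemma ext_wt_sym: "ext_wt J x i j = ext_wt J x j i"
  by (simp add: ext_wt_def upair_commute)

lemma measurable_ext_wt [measurable]: "(\<lambda>x. ext_wt J x i j) \<in> borel_measurable (PiM J (\<lambda>_. borel))"
  unfolding ext_wt_def by (cases "upair i j \<in> J") (auto intro: measurable_component_singleton)

lemma measurable_nb_deg:
  assumes "\<And>i j. (\<lambda>x. F x i j) \<in> borel_measurable M"
  shows "(\<lambda>x. nb_deg N (F x) i) \<in> borel_measurable M"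
  unfolding nb_deg_def using assms by (intro borel_measurable_sum borel_measurable_abs)

lemma measurable_loop_wt:
  assumes m: "\<And>i j. (\<lambda>x. F x i j) \<in> borel_measurable M"
  shows "(\<lambda>x. loop_wt \<alpha> K N (F x) k v) \<in> borel_measurable M"
proof -
  note [measurable] = m measurable_nb_deg[of F, OF m]
  have t: "(\<lambda>x. trunc_wt K N (F x) i j) \<in> borel_measurable M" for i j
    unfolding trunc_wt_def by measurable
  have "(\<lambda>x. (nb_op \<alpha> K N (F x) ^^ k) (\<lambda>u. if u = v then 1 else 0) i) \<in> borel_measurable M" for i
  proof (induction k arbitrary: i)
    case (Suc k)
    have "(\<lambda>x. nb_op \<alpha> K N (F x) ((nb_op \<alpha> K N (F x) ^^ k) (\<lambda>u. if u = v then 1 else 0)) i) \<in> borel_measurable M"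
      by (subst nb_op_def) (intro borel_measurable_sum borel_measurable_times borel_measurable_diff borel_measurable_const t Suc)
    then show ?case by simp
  qed simp
  then show ?thesis by (simp add: loop_wt_def)
qed

lemma measurable_Delta:
  assumes m [measurable]: "\<And>i j. (\<lambda>x. F x i j) \<in> borel_measurable M"
  shows "(\<lambda>x. Delta \<alpha> n (F x) A i j) \<in> borel_measurable M"
  unfolding Delta_def by (cases "i = j") (auto intro!: borel_measurable_sum borel_measurable_times borel_measurable_diff)

lemma measurable_wdeg:
  assumes m: "\<And>i j. (\<lambda>x. F x i j) \<in> borel_measurable M"
  shows "(\<lambda>x. wdeg n (F x) A v) \<in> borel_measurable M"
  unfolding wdeg_def using m by (intro borel_measurable_sum borel_measurable_times borel_measurable_abs) auto

lemma Delta_cong: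
  assumes "\<And>i j. A i j \<Longrightarrow> u i j = u' i j"
  shows "Delta \<alpha> n u A = Delta \<alpha> n u' A"
proof -
  have "u i j * adj A i j = u' i j * adj A i j" for i j using assms[of i j] by (auto simp: adj_def)
  then show ?thesis by (intro ext) (simp only: Delta_def)
qed

locale iid_weights = prob_space M for M :: "'a measure" +
  fixes w :: "'a \<Rightarrow> nat \<Rightarrow> nat \<Rightarrow> real" and \<alpha> :: real
  assumes alpha: "\<alpha> \<in> {0, 1}"
    and w_sym: "\<And>\<omega> i j. w \<omega> i j = w \<omega> j i"
    and w_indep: "indep_vars (\<lambda>_. borel) (\<lambda>p \<omega>. w \<omega> (fst p) (snd p)) {p. fst p \<le> snd p}"
    and w_ident: "\<And>p q. fst p \<le> snd p \<Longrightarrow> fst q \<le> snd q \<Longrightarrow>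
      distr M borel (\<lambda>\<omega>. w \<omega> (fst p) (snd p)) = distr M borel (\<lambda>\<omega>. w \<omega> (fst q) (snd q))"
begin

definition law :: "real measure" where
  "law = distr M borel (\<lambda>\<omega>. w \<omega> 0 0)"

lemma w_upair: "w \<omega> (fst (upair i j)) (snd (upair i j)) = w \<omega> i j"
  using w_sym by (auto simp: upair_def min_def max_def)

lemma measurable_w [measurable]: "(\<lambda>\<omega>. w \<omega> i j) \<in> borel_measurable M"
proof -
  have "(\<lambda>\<omega>. w \<omega> (fst (upair i j)) (snd (upair i j))) \<in> borel_measurable M"
    using w_indep by (auto simp: indep_vars_def upair_def)
  then show ?thesis by (simp add: w_upair)
qed

lemma law_w: "distr M borel (\<lambda>\<omega>. w \<omega> i j) = law"
  using w_ident[of "upair i j" "(0, 0)"] unfolding w_upair law_def by (simp add: upair_def)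

lemma prob_space_law: "prob_space law"
  unfolding law_def by (rule prob_space_distr) simp

lemma sets_law: "sets law = sets borel" by (simp add: law_def)

text \<open>The law on the image of \<open>J\<close> is a product by independence, and reindexing
  along an injection preserves products of equal factors.\<close>

lemma distr_relabel:
  assumes inj: "inj_on \<sigma> J" and \<sigma>: "\<And>p. p \<in> J \<Longrightarrow> fst (\<sigma> p) \<le> snd (\<sigma> p)"
  shows "distr M (PiM J (\<lambda>_. borel)) (\<lambda>\<omega>. \<lambda>p\<in>J. w \<omega> (fst (\<sigma> p)) (snd (\<sigma> p))) = PiM J (\<lambda>_. law)"
proof -
  let ?X = "\<lambda>\<omega>. \<lambda>p\<in>\<sigma> ` J. w \<omega> (fst p) (snd p)" and ?t = "\<lambda>y. \<lambda>p\<in>J. y (\<sigma> p)"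
  have eq: "distr M (PiM (\<sigma> ` J) (\<lambda>_. borel)) ?X = PiM (\<sigma> ` J) (\<lambda>_. law)"
    by (rule distr_restrict_eq_PiM[OF w_indep]) (use \<sigma> law_w prob_space_law in auto)
  have X: "?X \<in> M \<rightarrow>\<^sub>M PiM (\<sigma> ` J) (\<lambda>_. borel)" by (intro measurable_restrict) simp
  have t: "?t \<in> PiM (\<sigma> ` J) (\<lambda>_. borel) \<rightarrow>\<^sub>M PiM J (\<lambda>_. borel :: real measure)"
    by (intro measurable_restrict measurable_component_singleton) auto
  have "distr M (PiM J (\<lambda>_. borel)) (\<lambda>\<omega>. \<lambda>p\<in>J. w \<omega> (fst (\<sigma> p)) (snd (\<sigma> p)))
      = distr M (PiM J (\<lambda>_. borel)) (?t \<circ> ?X)"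
    by (intro distr_cong) (auto simp: fun_eq_iff)
  also have "\<dots> = distr (PiM (\<sigma> ` J) (\<lambda>_. law)) (PiM J (\<lambda>_. borel)) ?t"
    unfolding eq[symmetric] by (rule distr_distr[OF t X, symmetric])
  also have "\<dots> = distr (PiM (\<sigma> ` J) (\<lambda>_. law)) (PiM J (\<lambda>_. law)) ?t"
    by (intro distr_cong refl sets_PiM_cong) (simp_all add: sets_law)
  also have "\<dots> = PiM J (\<lambda>_. law)"
    using distr_PiM_reindex[of "\<sigma> ` J" "\<lambda>_. law" \<sigma> J] prob_space_law inj by auto
  finally show ?thesis .
qed

text \<open>The right-hand side is free of \<open>f\<close>: injective relabelling of the vertices
  leaves the joint law of the weights on the ball unchanged.\<close>

lemma expectation_loop_wt_relabel:
  assumes R: "rooted_graph R" and k: "k < r" and f: "inj_on f (rg_verts r R)"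
  shows "expectation (\<lambda>\<omega>. loop_wt \<alpha> K (rg_nb R) (\<lambda>i j. w \<omega> (f i) (f j)) k (rg_root R))
    = (\<integral>y. loop_wt \<alpha> K (rg_nb R) (ext_wt {p. fst p < snd p \<and> fst p \<in> rg_verts r R \<and> snd p \<in> rg_verts r R} y) k (rg_root R)
         \<partial>PiM {p. fst p < snd p \<and> fst p \<in> rg_verts r R \<and> snd p \<in> rg_verts r R} (\<lambda>_. law))"
proof -
  define J where "J = {p. fst p < snd p \<and> fst p \<in> rg_verts r R \<and> snd p \<in> rg_verts r R}"
  define \<sigma> where "\<sigma> p = upair (f (fst p)) (f (snd p))" for p
  let ?X = "\<lambda>\<omega>. \<lambda>p\<in>J. w \<omega> (fst (\<sigma> p)) (snd (\<sigma> p))"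
  \<comment> \<open>Pairs in \<open>J\<close> have increasing components and \<open>f\<close> is
    injective, so the unordered pair of images determines the pair.\<close>
  have inj: "inj_on \<sigma> J"
  proof (rule inj_onI)
    fix p q assume p: "p \<in> J" and q: "q \<in> J" and eq: "\<sigma> p = \<sigma> q"
    have "{f (fst p), f (snd p)} = {f (fst q), f (snd q)}"
      using eq unfolding \<sigma>_def upair_def by (auto simp: min_def max_def split: if_splits)
    then have "f ` {fst p, snd p} = f ` {fst q, snd q}" by simp
    then have "{fst p, snd p} = {fst q, snd q}"
      by (subst (asm) inj_on_image_eq_iff[OF f]) (use p q in \<open>auto simp: J_def\<close>)
    then show "p = q" using p q by (auto simp: J_def doubleton_eq_iff prod_eq_iff)
  qed
  have X: "?X \<in> M \<rightarrow>\<^sub>M PiM J (\<lambda>_. borel)" by (intro measurable_restrict) simp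
  have m: "(\<lambda>y. loop_wt \<alpha> K (rg_nb R) (ext_wt J y) k (rg_root R)) \<in> borel_measurable (PiM J (\<lambda>_. borel))"
    by (rule measurable_loop_wt) simp
  have "loop_wt \<alpha> K (rg_nb R) (\<lambda>i j. w \<omega> (f i) (f j)) k (rg_root R) = loop_wt \<alpha> K (rg_nb R) (ext_wt J (?X \<omega>)) k (rg_root R)" for \<omega>
  proof (rule loop_wt_cong_ball[OF R k])
    fix i j assume ij: "i \<in> rg_verts r R" "j \<in> rg_verts r R" "i \<noteq> j"
    then have J: "upair i j \<in> J" by (auto simp: J_def upair_def min_def max_def)
    then have "ext_wt J (?X \<omega>) i j = w \<omega> (fst (\<sigma> (upair i j))) (snd (\<sigma> (upair i j)))"
      by (simp add: ext_wt_def)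
    also have "\<dots> = w \<omega> (f (fst (upair i j))) (f (snd (upair i j)))"
      unfolding \<sigma>_def w_upair ..
    also have "\<dots> = w \<omega> (f i) (f j)" using w_sym by (auto simp: upair_def min_def max_def)
    finally show "w \<omega> (f i) (f j) = ext_wt J (?X \<omega>) i j" by simp
  qed
  then have "expectation (\<lambda>\<omega>. loop_wt \<alpha> K (rg_nb R) (\<lambda>i j. w \<omega> (f i) (f j)) k (rg_root R))
    = (\<integral>y. loop_wt \<alpha> K (rg_nb R) (ext_wt J y) k (rg_root R) \<partial>distr M (PiM J (\<lambda>_. borel)) ?X)"
    by (simp add: integral_distr[OF X m])
  also have "distr M (PiM J (\<lambda>_. borel)) ?X = PiM J (\<lambda>_. law)"
    by (rule distr_relabel[OF inj]) (simp add: \<sigma>_def upair_def)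
  finally show ?thesis by (simp add: J_def)
qed

text \<open>The weights are attached to the vertex labels of \<open>R\<close>; that the expectation
  does not depend on the labelling is a consequence of identical distribution, not of the
  definition.\<close>

definition local_mean :: "real \<Rightarrow> nat \<Rightarrow> rgraph \<Rightarrow> real" where
  "local_mean K k R = expectation (\<lambda>\<omega>. loop_wt \<alpha> K (rg_nb R) (w \<omega>) k (rg_root R))"

lemma integrable_loop_wt:
  assumes "K \<ge> 0"
  shows "integrable M (\<lambda>\<omega>. loop_wt \<alpha> K N (w \<omega>) k v)"
  by (rule integrable_const_bound[of _ "(2 * K) ^ k"])
     (use loop_wt_bound[OF assms alpha] in \<open>auto intro: measurable_loop_wt\<close>)

lemma local_mean_bound:
  assumes K: "K \<ge> 0"
  shows "\<bar>local_mean K k R\<bar> \<le> (2 * K) ^ k"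
proof -
  have "\<bar>local_mean K k R\<bar> \<le> expectation (\<lambda>\<omega>. \<bar>loop_wt \<alpha> K (rg_nb R) (w \<omega>) k (rg_root R)\<bar>)"
    unfolding local_mean_def by (rule integral_abs_bound)
  also have "\<dots> \<le> expectation (\<lambda>\<omega>. (2 * K) ^ k)"
    by (intro integral_mono integrable_abs integrable_loop_wt loop_wt_bound K alpha) simp
  finally show ?thesis by (simp add: prob_space)
qed

text \<open>Pulling the weights back along the isomorphism only relabels them, which the expectation
  does not notice.\<close>

lemma local_mean_iso:
  assumes R: "rooted_graph R" and iso: "rooted_iso (rg_ball r R) (rg_ball r R')" and k: "k < r"
  shows "local_mean K k R' = local_mean K k R"
proof -
  obtain f where f: "bij_betw f (rg_verts r R) (rg_verts r R')" "f (rg_root R) = rg_root R'"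
    and e: "\<And>u v. u \<in> rg_verts r R \<Longrightarrow> v \<in> rg_verts r R \<Longrightarrow> rg_edge (rg_ball r R) u v \<longleftrightarrow> rg_edge (rg_ball r R') (f u) (f v)"
    using iso unfolding rooted_iso_def rg_root_ball by blast
  have e': "rg_edge R u v \<longleftrightarrow> rg_edge R' (f u) (f v)" if "u \<in> rg_verts r R" "v \<in> rg_verts r R" for u v
  proof -
    have "f u \<in> rg_verts r R'" "f v \<in> rg_verts r R'" using f(1) that by (auto simp: bij_betw_def)
    then show ?thesis using e[OF that] that by (simp add: rg_edge_ball)
  qed
  have inj: "inj_on f (rg_verts r R)" using f(1) by (simp add: bij_betw_def)
  have "local_mean K k R' = expectation (\<lambda>\<omega>. loop_wt \<alpha> K (rg_nb R) (\<lambda>i j. w \<omega> (f i) (f j)) k (rg_root R))"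
    unfolding local_mean_def by (simp add: rooted_iso_transport[OF R f e' k])
  also have "\<dots> = expectation (\<lambda>\<omega>. loop_wt \<alpha> K (rg_nb R) (\<lambda>i j. w \<omega> (id i) (id j)) k (rg_root R))"
    using expectation_loop_wt_relabel[OF R k inj] expectation_loop_wt_relabel[OF R k inj_on_id] by simp
  finally show ?thesis by (simp add: local_mean_def)
qed

text \<open>Closed walks of length at most \<open>d\<close> with truncated weights are determined by
  the ball of radius \<open>Suc d\<close>, so the function is even locally constant.\<close>

lemma gs_bcont_local_mean:
  assumes K: "K \<ge> 0"
  shows "gs_bcont (\<lambda>R. \<Sum>k\<le>d. c k * local_mean K k R)"
  unfolding gs_bcont_def
proof (intro conjI ballI allI impI)
  have "\<bar>\<Sum>k\<le>d. c k * local_mean K k R\<bar> \<le> (\<Sum>k\<le>d. \<bar>c k\<bar> * (2 * K) ^ k)" for R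
    by (intro order_trans[OF sum_abs] sum_mono, unfold abs_mult, intro mult_left_mono local_mean_bound[OF K]) simp
  then show "\<exists>B. \<forall>x\<in>Gstar. \<bar>\<Sum>k\<le>d. c k * local_mean K k x\<bar> \<le> B" by blast
next
  fix R :: rgraph and e :: real assume R: "R \<in> Gstar" and e: "e > 0"
  have "\<bar>(\<Sum>k\<le>d. c k * local_mean K k R') - (\<Sum>k\<le>d. c k * local_mean K k R)\<bar> < e"
    if "ldist R R' < 1 / (real (Suc d) + 1)" for R'
  proof -
    obtain r where r: "r \<ge> Suc d" "rooted_iso (rg_ball r R) (rg_ball r R')"
      using ldist_small_imp_iso \<open>ldist R R' < _\<close> by blast
    have "local_mean K k R' = local_mean K k R" if "k \<le> d" for k
      using R r that by (intro local_mean_iso[OF _ r(2)]) (auto simp: Gstar_def)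
    then show ?thesis using e by simp
  qed
  then show "\<exists>d'>0. \<forall>y\<in>Gstar. ldist R y < d' \<longrightarrow>
      \<bar>(\<Sum>k\<le>d. c k * local_mean K k y) - (\<Sum>k\<le>d. c k * local_mean K k R)\<bar> < e"
    by (intro exI[of _ "1 / (real (Suc d) + 1)"]) auto
qed

definition ramp_stat :: "nat \<Rightarrow> (nat \<Rightarrow> nat \<Rightarrow> bool) \<Rightarrow> real \<Rightarrow> real \<Rightarrow> 'a \<Rightarrow> real" where
  "ramp_stat n A a b \<omega> = ramp_sum n (Delta \<alpha> n (w \<omega>) A) a b / real n"

lemma measurable_ramp_stat:
  assumes A: "simple_graph_on n A" and ab: "a < b"
  shows "ramp_stat n A a b \<in> borel_measurable M"
  unfolding ramp_stat_def[abs_def]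
  by (intro borel_measurable_divide borel_measurable_const measurable_ramp_sum measurable_Delta measurable_w Delta_sym[OF A w_sym] ab)

lemma ramp_stat_bounds:
  assumes A: "simple_graph_on n A" and ab: "a < b"
  shows "0 \<le> ramp_stat n A a b \<omega>" "ramp_stat n A a b \<omega> \<le> 1"
  using esd_cdf_bounds(3,4)[OF Delta_sym[OF A w_sym] _ ab, of n \<alpha>] unfolding ramp_stat_def
  by (cases "n = 0"; simp)+

lemma integrable_ramp_stat:
  assumes A: "simple_graph_on n A" and ab: "a < b"
  shows "integrable M (ramp_stat n A a b)"
  by (rule integrable_const_bound[of _ 1])
     (use ramp_stat_bounds[OF A ab] measurable_ramp_stat[OF A ab] in auto)

definition edge_pairs :: "(nat \<Rightarrow> nat \<Rightarrow> bool) \<Rightarrow> (nat \<times> nat) set" where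
  "edge_pairs A = {p. fst p < snd p \<and> A (fst p) (snd p)}"

lemma finite_edge_pairs:
  assumes "simple_graph_on n A"
  shows "finite (edge_pairs A)" "card (edge_pairs A) \<le> (\<Sum>v<n. card {j. A v j})"
proof -
  have sub: "edge_pairs A \<subseteq> Sigma {..<n} (\<lambda>v. {j. A v j})"
    using assms by (auto simp: edge_pairs_def simple_graph_on_def)
  have fin: "finite (Sigma {..<n} (\<lambda>v. {j. A v j}))" using finite_nb[OF assms] by auto
  show "finite (edge_pairs A)" using finite_subset[OF sub fin] .
  show "card (edge_pairs A) \<le> (\<Sum>v<n. card {j. A v j})"
    using card_mono[OF fin sub] finite_nb[OF assms] by simp
qed

text \<open>The independent coordinates are the edge weights. Changing one of them alters only the
  rows and columns of its two endpoints, diagonal included, so the ramp sum moves by at most 2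
  however large the change is.\<close>

lemma ramp_stat_mgf:
  assumes A: "simple_graph_on n A" and ab: "a < b" and s: "s > 0" and n: "n > 0"
  defines "Z \<equiv> ramp_stat n A a b"
  shows "expectation (\<lambda>\<omega>. exp (s * \<bar>Z \<omega> - expectation Z\<bar>)) \<le> 2 * exp (s\<^sup>2 * (2 / real n)\<^sup>2 * card (edge_pairs A) / 2)"
    and "integrable M (\<lambda>\<omega>. exp (s * \<bar>Z \<omega> - expectation Z\<bar>))"
proof -
  let ?J = "edge_pairs A"
  define f where "f x = ramp_sum n (Delta \<alpha> n (ext_wt ?J x) A) a b / real n" for x
  let ?X = "\<lambda>p \<omega>. w \<omega> (fst p) (snd p)"
  have Zf: "Z \<omega> = f (\<lambda>p\<in>?J. ?X p \<omega>)" for \<omega>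
  proof -
    have "Delta \<alpha> n (w \<omega>) A = Delta \<alpha> n (ext_wt ?J (\<lambda>p\<in>?J. ?X p \<omega>)) A"
    proof (rule Delta_cong)
      fix i j assume "A i j"
      then have "upair i j \<in> ?J"
        using A by (auto simp: edge_pairs_def upair_def simple_graph_on_def min_def max_def)
           (metis le_neq_implies_less)+
      then show "w \<omega> i j = ext_wt ?J (\<lambda>p\<in>?J. ?X p \<omega>) i j" by (simp add: ext_wt_def w_upair)
    qed
    then show ?thesis by (simp add: Z_def ramp_stat_def f_def)
  qed
  have fm: "f \<in> borel_measurable (PiM ?J (\<lambda>_. borel))"
    unfolding f_def[abs_def]
    by (intro borel_measurable_divide borel_measurable_const measurable_ramp_sum measurable_Delta measurable_ext_wt
        Delta_sym[OF A ext_wt_sym] ab)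
  have ds: "Delta \<alpha> n (ext_wt ?J x) A i j = Delta \<alpha> n (ext_wt ?J x) A j i" for x i j
    by (rule Delta_sym[OF A ext_wt_sym])
  have fB: "\<bar>f x\<bar> \<le> 1" for x
    using esd_cdf_bounds(3,4)[of "Delta \<alpha> n (ext_wt ?J x) A", OF ds n ab] by (simp add: f_def)
  have fc: "\<bar>f (x(p := y)) - f x\<bar> \<le> 2 / real n" if p: "p \<in> ?J" for x p y
  proof -
    let ?D = "Delta \<alpha> n (ext_wt ?J x) A" and ?D' = "Delta \<alpha> n (ext_wt ?J (x(p := y))) A"
    let ?Q = "{fst p, snd p}"
    have ext: "ext_wt ?J (x(p := y)) i k = ext_wt ?J x i k" if "i \<notin> ?Q" for i k
      using that by (auto simp: ext_wt_def upair_def min_def max_def)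
    have eq: "?D i j = ?D' i j" if "i \<notin> ?Q" "j \<notin> ?Q" for i j
      unfolding Delta_def ext[OF that(1)] ..
    have "ramp_sum n ?D a b - ramp_sum n ?D' a b \<le> real (card ?Q)"
      by (rule ramp_sum_diff_le_restricted) (use eq ab ds in auto)
    moreover have "ramp_sum n ?D' a b - ramp_sum n ?D a b \<le> real (card ?Q)"
      by (rule ramp_sum_diff_le_restricted) (use eq ab ds in auto)
    moreover have "card ?Q \<le> 2" by (simp add: card_insert_if)
    ultimately have "\<bar>ramp_sum n ?D' a b - ramp_sum n ?D a b\<bar> \<le> 2" by linarith
    then show ?thesis using n unfolding f_def diff_divide_distrib[symmetric] by (simp add: divide_right_mono)
  qed
  have J: "?J \<subseteq> {p. fst p \<le> snd p}" "finite ?J" using finite_edge_pairs[OF A] by (auto simp: edge_pairs_def)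
  note * = bounded_differences_mgf[OF w_indep J law_w fm fB fc s]
  have ZZ: "Z = (\<lambda>\<omega>. f (\<lambda>p\<in>?J. ?X p \<omega>))" using Zf by auto
  show "expectation (\<lambda>\<omega>. exp (s * \<bar>Z \<omega> - expectation Z\<bar>)) \<le> 2 * exp (s\<^sup>2 * (2 / real n)\<^sup>2 * card (edge_pairs A) / 2)"
    unfolding ZZ by (rule *(1))
  show "integrable M (\<lambda>\<omega>. exp (s * \<bar>Z \<omega> - expectation Z\<bar>))"
    unfolding ZZ by (rule *(2))
qed

end

section \<open>Edge counts, fluctuations and means of the ramp statistic\<close>

context iid_weights
begin

lemma Delta_w_sym: "simple_graph_on n A \<Longrightarrow> Delta \<alpha> n (w \<omega>) A i j = Delta \<alpha> n (w \<omega>) A j i"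
  by (rule Delta_sym) (auto intro: w_sym)

text \<open>If the weights are not integrable, this is 0 by convention; under integrable weighted
  degrees that can happen only for graphs without edges.\<close>

definition mean_abs :: real where
  "mean_abs = expectation (\<lambda>\<omega>. \<bar>w \<omega> 0 0\<bar>)"

lemma expectation_abs_w: "expectation (\<lambda>\<omega>. \<bar>w \<omega> i j\<bar>) = mean_abs"
proof -
  have "expectation (\<lambda>\<omega>. \<bar>w \<omega> i j\<bar>) = (\<integral>x. \<bar>x\<bar> \<partial>law)" for i j
    unfolding law_w[of i j, symmetric] by (subst integral_distr) auto
  then show ?thesis by (simp add: mean_abs_def)
qed

lemma mean_abs_nonneg: "mean_abs \<ge> 0"
  unfolding mean_abs_def by simp

lemma wdeg_nonneg: "wdeg n u A v \<ge> 0"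
  unfolding wdeg_def adj_def by (intro sum_nonneg) simp

lemma integrable_w_edge:
  assumes A: "simple_graph_on n A" and i: "\<And>v. v < n \<Longrightarrow> integrable M (\<lambda>\<omega>. wdeg n (w \<omega>) A v)" and e: "A v j"
  shows "integrable M (\<lambda>\<omega>. \<bar>w \<omega> v j\<bar>)"
proof (rule Bochner_Integration.integrable_bound)
  show "integrable M (\<lambda>\<omega>. wdeg n (w \<omega>) A v)" using A e by (intro i) (auto simp: simple_graph_on_def)
  show "AE \<omega> in M. norm \<bar>w \<omega> v j\<bar> \<le> norm (wdeg n (w \<omega>) A v)"
  proof (rule AE_I2)
    fix \<omega>
    have "\<bar>w \<omega> v j\<bar> \<le> wdeg n (w \<omega>) A v"
      unfolding wdeg_eq_nb_deg[OF A] nb_deg_def using finite_nb[OF A] e by (intro member_le_sum) auto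
    then show "norm \<bar>w \<omega> v j\<bar> \<le> norm (wdeg n (w \<omega>) A v)" by simp
  qed
qed simp

text \<open>The expected weighted degree of a vertex is \<open>mean_abs\<close> times its degree.
  This converts condition (B) into a bound on the number of edges.\<close>

lemma mean_abs_edges_le:
  assumes A: "simple_graph_on n A" and i: "\<And>v. v < n \<Longrightarrow> integrable M (\<lambda>\<omega>. wdeg n (w \<omega>) A v)"
  shows "mean_abs * card (edge_pairs A) \<le> (\<Sum>v<n. expectation (\<lambda>\<omega>. wdeg n (w \<omega>) A v))"
proof -
  have "expectation (\<lambda>\<omega>. wdeg n (w \<omega>) A v) = mean_abs * card {j. A v j}" for v
  proof -
    have "expectation (\<lambda>\<omega>. wdeg n (w \<omega>) A v) = (\<Sum>j\<in>{j. A v j}. expectation (\<lambda>\<omega>. \<bar>w \<omega> v j\<bar>))"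
      unfolding wdeg_eq_nb_deg[OF A] nb_deg_def
      by (intro Bochner_Integration.integral_sum) (auto intro!: integrable_w_edge[OF A i])
    then show ?thesis by (simp add: expectation_abs_w)
  qed
  then have "(\<Sum>v<n. expectation (\<lambda>\<omega>. wdeg n (w \<omega>) A v)) = mean_abs * real (\<Sum>v<n. card {j. A v j})"
    by (simp add: sum_distrib_left)
  then show ?thesis
    using finite_edge_pairs(2)[OF A] mean_abs_nonneg by (simp only:) (intro mult_left_mono of_nat_mono)
qed

text \<open>The weight on an edge is integrable with mean absolute value 0, hence vanishes almost
  surely, and the matrix is zero. No edge count is available in this case.\<close>

lemma ramp_stat_degenerate:
  assumes A: "simple_graph_on n A" and i: "\<And>v. v < n \<Longrightarrow> integrable M (\<lambda>\<omega>. wdeg n (w \<omega>) A v)"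
    and 0: "mean_abs = 0" and n: "n > 0"
  shows "AE \<omega> in M. ramp_stat n A a b \<omega> = ramp a b 0"
proof -
  have "AE \<omega> in M. A v j \<longrightarrow> w \<omega> v j = 0" for v j
  proof (cases "A v j")
    case True
    then have "AE \<omega> in M. \<bar>w \<omega> v j\<bar> = 0"
      using integral_nonneg_eq_0_iff_AE[OF integrable_w_edge[OF A i True]] expectation_abs_w[of v j] 0 by simp
    then show ?thesis by simp
  qed simp
  then have "AE \<omega> in M. \<forall>v j. A v j \<longrightarrow> w \<omega> v j = 0" by (simp add: AE_all_countable)
  then show ?thesis
  proof eventually_elim
    case (elim \<omega>)
    then have "Delta \<alpha> n (w \<omega>) A = Delta \<alpha> n (\<lambda>_ _. 0) A" by (intro Delta_cong) auto
    then have "ramp_sum n (Delta \<alpha> n (w \<omega>) A) a b = real n * ramp a b 0"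
      by (simp add: ramp_sum_zero Delta_def)
    then show ?case using n by (simp add: ramp_stat_def)
  qed
qed

text \<open>The bound is linear in the total expected degree, so that it can be averaged over a
  random graph.\<close>

lemma ramp_stat_L1:
  assumes A: "simple_graph_on n A" and i: "\<And>v. v < n \<Longrightarrow> integrable M (\<lambda>\<omega>. wdeg n (w \<omega>) A v)"
    and ab: "a < b" and n: "n > 0"
  shows "expectation (\<lambda>\<omega>. \<bar>ramp_stat n A a b \<omega> - expectation (ramp_stat n A a b)\<bar>)
    \<le> exp 2 * ((\<Sum>v<n. expectation (\<lambda>\<omega>. wdeg n (w \<omega>) A v)) / mean_abs + 1 + real n) / (real n * sqrt (real n))"
    (is "?L \<le> exp 2 * (?S / mean_abs + 1 + real n) / _")
proof (cases "mean_abs = 0")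
  case True
  have ae: "AE \<omega> in M. ramp_stat n A a b \<omega> = ramp a b 0" by (rule ramp_stat_degenerate[OF A i True n])
  have "expectation (ramp_stat n A a b) = expectation (\<lambda>\<omega>. ramp a b 0)"
    using measurable_ramp_stat[OF A ab] ae by (intro integral_cong_AE) auto
  then have E: "expectation (ramp_stat n A a b) = ramp a b 0" by (simp add: prob_space)
  have "?L = expectation (\<lambda>\<omega>. 0)"
    using measurable_ramp_stat[OF A ab] ae by (intro integral_cong_AE) (auto simp: E)
  \<comment> \<open>Division by \<open>mean_abs = 0\<close> yields 0, so the right-hand side is
    merely nonnegative, while the left-hand side is 0.\<close>
  then show ?thesis using True by simp
next
  case False
  then have k: "mean_abs > 0" using mean_abs_nonneg by simp
  define m where "m = real (card (edge_pairs A))"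
  \<comment> \<open>This choice keeps the exponent s^2 (2/n)^2 m / 2 below 2; the added 1 covers
    graphs without edges.\<close>
  define s where "s = real n / sqrt (m + 1)"
  have m: "m \<ge> 0" by (simp add: m_def)
  have s: "s > 0" using n m by (simp add: s_def)
  have "s * (2 / real n) = 2 / sqrt (m + 1)" using n by (simp add: s_def)
  then have sq: "(s * (2 / real n))\<^sup>2 = 4 / (m + 1)" using m by (simp only:) (simp add: power_divide)
  have "s\<^sup>2 * (2 / real n)\<^sup>2 * m / 2 = (s * (2 / real n))\<^sup>2 * m / 2" by (simp only: power_mult_distrib)
  also have "\<dots> = 2 * m / (m + 1)" unfolding sq using m by (simp add: divide_simps)
  also have "\<dots> \<le> 2" using m by (simp add: field_simps)
  finally have e2: "s\<^sup>2 * (2 / real n)\<^sup>2 * m / 2 \<le> 2" .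
  have "expectation (\<lambda>\<omega>. exp (s * \<bar>ramp_stat n A a b \<omega> - expectation (ramp_stat n A a b)\<bar>)) \<le> 2 * exp 2"
    by (rule order_trans[OF ramp_stat_mgf(1)[OF A ab s n]]) (use e2 in \<open>simp add: m_def\<close>)
  then have "?L \<le> 2 * exp 2 / s"
    using measurable_ramp_stat[OF A ab] by (intro expectation_abs_le_mgf ramp_stat_mgf(2)[OF A ab s n] s) auto
  also have "\<dots> = 2 * exp 2 * sqrt (m + 1) / real n" by (simp add: s_def)
  also have "\<dots> \<le> exp 2 * (m + 1 + real n) / (real n * sqrt (real n))"
  proof -
    \<comment> \<open>The inequality of arithmetic and geometric means replaces the square root of
      the edge count by a linear expression.\<close>
    have "2 * (sqrt (m + 1) * sqrt (real n)) \<le> m + 1 + real n"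
      using arith_geo_mean_sqrt[of "m + 1" "real n"] m by (simp add: real_sqrt_mult)
    then have "exp 2 * (2 * (sqrt (m + 1) * sqrt (real n))) \<le> exp 2 * (m + 1 + real n)"
      by (rule mult_left_mono) simp
    then show ?thesis using n by (simp add: field_simps)
  qed
  also have "\<dots> \<le> exp 2 * (?S / mean_abs + 1 + real n) / (real n * sqrt (real n))"
    using mean_abs_edges_le[OF A i] k
    by (intro divide_right_mono mult_left_mono add_right_mono) (auto simp: m_def field_simps)
  finally show ?thesis .
qed

lemma ramp_stat_tail:
  assumes A: "simple_graph_on n A" and ab: "a < b" and n: "n > 0" and C: "C > 0" "card (edge_pairs A) \<le> C * real n"
    and e: "e > 0"
  shows "prob {\<omega> \<in> space M. \<bar>ramp_stat n A a b \<omega> - expectation (ramp_stat n A a b)\<bar> \<ge> e} \<le> 2 * exp (- (e\<^sup>2 / (8 * C))) ^ n"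
proof -
  define m where "m = real (card (edge_pairs A))"
  \<comment> \<open>The minimiser of 2 C t^2 - t e, with minimum -e^2 / (8 C).\<close>
  define t where "t = e / (4 * C)"
  have t: "t > 0" using e C by (simp add: t_def)
  have s: "t * real n > 0" using t n by simp
  have "prob {\<omega> \<in> space M. \<bar>ramp_stat n A a b \<omega> - expectation (ramp_stat n A a b)\<bar> \<ge> e}
      \<le> 2 * exp ((t * real n)\<^sup>2 * (2 / real n)\<^sup>2 * m / 2) * exp (- (t * real n * e))"
    unfolding m_def
    by (rule prob_ge_le_mgf[OF ramp_stat_mgf(2)[OF A ab s n] _ ramp_stat_mgf(1)[OF A ab s n] s])
       (use measurable_ramp_stat[OF A ab] in auto)
  also have "\<dots> = 2 * exp (2 * t\<^sup>2 * m - t * real n * e)"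
    using n by (simp add: power_mult_distrib power_divide flip: exp_add)
  also have "\<dots> \<le> 2 * exp (2 * t\<^sup>2 * (C * real n) - t * real n * e)"
    using C by (intro mult_left_mono) (auto simp: m_def intro!: mult_left_mono)
  also have "2 * t\<^sup>2 * (C * real n) - t * real n * e = real n * (- (e\<^sup>2 / (8 * C)))"
    using C by (simp add: t_def power2_eq_square field_simps)
  finally show ?thesis unfolding exp_of_nat_mult .
qed

text \<open>For each \<omega>, deletion costs the degree tail and the polynomial costs \<epsilon>.
  What is left is an average of closed-walk weights, and the mean of each depends only on the
  component of its vertex.\<close>

lemma ramp_stat_mean_approx:
  assumes A: "simple_graph_on n A" and i: "\<And>v. v < n \<Longrightarrow> integrable M (\<lambda>\<omega>. wdeg n (w \<omega>) A v)"
    and ab: "a < b" and n: "n > 0" and K: "K \<ge> 0"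
    and p: "\<And>x. x \<in> {-2 * K..2 * K} \<Longrightarrow> \<bar>ramp a b x - (\<Sum>k\<le>d. c k * x ^ k)\<bar> \<le> \<epsilon>"
  shows "\<bar>expectation (ramp_stat n A a b) - (\<Sum>v<n. \<Sum>k\<le>d. c k * local_mean K k (comp_at n A v)) / real n\<bar>
    \<le> \<epsilon> + 8 / (b - a) * ((\<Sum>v<n. expectation (\<lambda>\<omega>. if wdeg n (w \<omega>) A v > K then wdeg n (w \<omega>) A v else 0)) / real n)"
proof -
  let ?N = "\<lambda>i. {j. A i j}"
  define L where "L \<omega> = (\<Sum>v<n. \<Sum>k\<le>d. c k * loop_wt \<alpha> K ?N (w \<omega>) k v) / real n" for \<omega>
  define T where "T \<omega> = (\<Sum>v<n. if wdeg n (w \<omega>) A v > K then wdeg n (w \<omega>) A v else 0) / real n" for \<omega>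
  have Li: "integrable M L"
    unfolding L_def by (intro integrable_divide Bochner_Integration.integrable_sum integrable_mult_right integrable_loop_wt K)
  have ti: "integrable M (\<lambda>\<omega>. if wdeg n (w \<omega>) A v > K then wdeg n (w \<omega>) A v else 0)" if "v < n" for v
  proof (rule Bochner_Integration.integrable_bound[OF i[OF that]])
    note [measurable] = measurable_wdeg[of w M n A v, OF measurable_w]
    show "(\<lambda>\<omega>. if wdeg n (w \<omega>) A v > K then wdeg n (w \<omega>) A v else 0) \<in> borel_measurable M" by measurable
  qed simp
  have Ti: "integrable M T"
    unfolding T_def by (intro integrable_divide Bochner_Integration.integrable_sum ti) simp
  have pt: "\<bar>ramp_stat n A a b \<omega> - L \<omega>\<bar> \<le> \<epsilon> + 8 / (b - a) * T \<omega>" for \<omega>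
  proof -
    let ?r = "ramp_sum n (Delta \<alpha> n (w \<omega>) A) a b" and ?r' = "ramp_sum n (Delta \<alpha> n (trunc_wt K ?N (w \<omega>)) A) a b"
    have ws: "w \<omega> i j = w \<omega> j i" for i j by (rule w_sym)
    have "\<bar>?r - real n * L \<omega>\<bar> \<le> \<bar>?r - ?r'\<bar> + \<bar>?r' - real n * L \<omega>\<bar>" by linarith
    also have "\<dots> \<le> 8 / (b - a) * (real n * T \<omega>) + real n * \<epsilon>"
      using ramp_sum_trunc_diff_le[where w = "w \<omega>" and K = K, OF A alpha ws ab]
        ramp_sum_trunc_approx[where w = "w \<omega>", OF A alpha ws K p] n
      by (intro add_mono) (simp_all add: L_def T_def)
    finally have "\<bar>?r - real n * L \<omega>\<bar> / real n \<le> (8 / (b - a) * (real n * T \<omega>) + real n * \<epsilon>) / real n"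
      by (rule divide_right_mono) simp
    moreover have "\<bar>?r - real n * L \<omega>\<bar> / real n = \<bar>ramp_stat n A a b \<omega> - L \<omega>\<bar>"
    proof -
      have "ramp_stat n A a b \<omega> - L \<omega> = (?r - real n * L \<omega>) / real n"
        using n by (simp add: ramp_stat_def field_simps)
      then show ?thesis by simp
    qed
    moreover have "(8 / (b - a) * (real n * T \<omega>) + real n * \<epsilon>) / real n = \<epsilon> + 8 / (b - a) * T \<omega>"
      using n ab by (simp add: field_simps)
    ultimately show ?thesis by simp
  qed
  have Zi: "integrable M (ramp_stat n A a b)" by (rule integrable_ramp_stat[OF A ab])
  have EL: "expectation L = (\<Sum>v<n. \<Sum>k\<le>d. c k * local_mean K k (comp_at n A v)) / real n"
  proof -
    have "expectation L = (\<Sum>v<n. \<Sum>k\<le>d. c k * expectation (\<lambda>\<omega>. loop_wt \<alpha> K ?N (w \<omega>) k v)) / real n"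
      unfolding L_def using integrable_loop_wt[OF K] by simp
    also have "\<dots> = (\<Sum>v<n. \<Sum>k\<le>d. c k * local_mean K k (comp_at n A v)) / real n"
      unfolding local_mean_def using loop_wt_comp_at[OF A, of _ \<alpha> K]
      by (intro arg_cong2[where f = "(/)"] sum.cong refl) simp
    finally show ?thesis .
  qed
  have "\<bar>expectation (ramp_stat n A a b) - expectation L\<bar> = \<bar>expectation (\<lambda>\<omega>. ramp_stat n A a b \<omega> - L \<omega>)\<bar>"
    using Zi Li by simp
  also have "\<dots> \<le> expectation (\<lambda>\<omega>. \<bar>ramp_stat n A a b \<omega> - L \<omega>\<bar>)" by (rule integral_abs_bound)
  also have "\<dots> \<le> expectation (\<lambda>\<omega>. \<epsilon> + 8 / (b - a) * T \<omega>)"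
    using Zi Li Ti by (intro integral_mono pt) auto
  also have "\<dots> = \<epsilon> + 8 / (b - a) * expectation T" using Ti by (simp add: prob_space)
  also have "expectation T = (\<Sum>v<n. expectation (\<lambda>\<omega>. if wdeg n (w \<omega>) A v > K then wdeg n (w \<omega>) A v else 0)) / real n"
    unfolding T_def using ti by (simp add: Bochner_Integration.integral_sum)
  finally show ?thesis unfolding EL .
qed

text \<open>Comparison with the zero matrix, at l1 distance at most twice the total weighted degree.
  This prevents mass of the limit from escaping to infinity.\<close>

lemma ramp_stat_mean_near_zero:
  assumes A: "simple_graph_on n A" and i: "\<And>v. v < n \<Longrightarrow> integrable M (\<lambda>\<omega>. wdeg n (w \<omega>) A v)"
    and ab: "a < b" and n: "n > 0"
  shows "\<bar>expectation (ramp_stat n A a b) - ramp a b 0\<bar>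
    \<le> 4 / (b - a) * ((\<Sum>v<n. expectation (\<lambda>\<omega>. wdeg n (w \<omega>) A v)) / real n)"
proof -
  define T where "T \<omega> = (\<Sum>v<n. wdeg n (w \<omega>) A v) / real n" for \<omega>
  have Ti: "integrable M T" unfolding T_def
    by (intro integrable_divide Bochner_Integration.integrable_sum i) simp
  have pt: "\<bar>ramp_stat n A a b \<omega> - ramp a b 0\<bar> \<le> 4 / (b - a) * T \<omega>" for \<omega>
  proof -
    let ?r = "ramp_sum n (Delta \<alpha> n (w \<omega>) A) a b"
    have "\<bar>?r - real n * ramp a b 0\<bar> = \<bar>?r - ramp_sum n (\<lambda>_ _. 0) a b\<bar>" by (simp add: ramp_sum_zero)
    also have "\<dots> \<le> 2 / (b - a) * (\<Sum>i<n. \<Sum>j<n. \<bar>Delta \<alpha> n (w \<omega>) A i j - 0\<bar>)"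
      by (rule ramp_sum_diff_le_l1[OF Delta_w_sym[OF A] refl ab])
    also have "\<dots> \<le> 2 / (b - a) * (\<Sum>i<n. 2 * wdeg n (w \<omega>) A i)"
      using Delta_row_sum_le[OF A alpha, of "w \<omega>"] ab
      by (intro mult_left_mono sum_mono) (auto simp: wdeg_eq_nb_deg[OF A] nb_deg_def)
    also have "\<dots> = 4 / (b - a) * (real n * T \<omega>)" using n by (simp add: T_def flip: sum_distrib_left)
    finally have "\<bar>?r - real n * ramp a b 0\<bar> / real n \<le> 4 / (b - a) * (real n * T \<omega>) / real n"
      by (rule divide_right_mono) simp
    moreover have "\<bar>?r - real n * ramp a b 0\<bar> / real n = \<bar>ramp_stat n A a b \<omega> - ramp a b 0\<bar>"
    proof -
      have "ramp_stat n A a b \<omega> - ramp a b 0 = (?r - real n * ramp a b 0) / real n"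
        using n by (simp add: ramp_stat_def field_simps)
      then show ?thesis by simp
    qed
    ultimately show ?thesis using n by simp
  qed
  have Zi: "integrable M (ramp_stat n A a b)" by (rule integrable_ramp_stat[OF A ab])
  have "\<bar>expectation (ramp_stat n A a b) - ramp a b 0\<bar> = \<bar>expectation (\<lambda>\<omega>. ramp_stat n A a b \<omega> - ramp a b 0)\<bar>"
    using Zi by (simp add: prob_space)
  also have "\<dots> \<le> expectation (\<lambda>\<omega>. \<bar>ramp_stat n A a b \<omega> - ramp a b 0\<bar>)" by (rule integral_abs_bound)
  also have "\<dots> \<le> expectation (\<lambda>\<omega>. 4 / (b - a) * T \<omega>)"
    using Zi Ti by (intro integral_mono pt) auto
  also have "\<dots> = 4 / (b - a) * expectation T" using Ti by simp
  also have "expectation T = (\<Sum>v<n. expectation (\<lambda>\<omega>. wdeg n (w \<omega>) A v)) / real n"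
    unfolding T_def using i by (simp add: Bochner_Integration.integral_sum)
  finally show ?thesis .
qed

text \<open>The first ramp has reached 0 before the second one leaves 1.\<close>

lemma ramp_stat_mono:
  assumes A: "simple_graph_on n A" and ab: "a < b" "b \<le> a'" "a' < b'"
  shows "ramp_stat n A a b \<omega> \<le> ramp_stat n A a' b' \<omega>"
proof -
  let ?D = "Delta \<alpha> n (w \<omega>) A"
  obtain l u where l: "eigensystem n ?D l u" using eigensystem_exists[of n ?D] Delta_w_sym[OF A] by blast
  show ?thesis unfolding ramp_stat_def ramp_sum_eigensystem[OF l] using ab
    by (intro divide_right_mono sum_mono) (auto simp: ramp_def)
qed

end

section \<open>Limit distributions from ramp statistics\<close>

text \<open>The distribution function at \<open>x\<close> is the infimum of \<open>lm\<close> over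
  ramps starting strictly to the right of \<open>x\<close>, which makes it right-continuous. The
  hypothesis \<open>tail\<close> compares with a point mass at 0 and gives the limits at both
  infinities.\<close>

lemma distribution_from_ramp_limits:
  fixes lm :: "real \<Rightarrow> real \<Rightarrow> real" and C :: real
  assumes bd: "\<And>a b. a < b \<Longrightarrow> 0 \<le> lm a b" "\<And>a b. a < b \<Longrightarrow> lm a b \<le> 1"
    and mono: "\<And>a b a' b'. a < b \<Longrightarrow> b \<le> a' \<Longrightarrow> a' < b' \<Longrightarrow> lm a b \<le> lm a' b'"
    and tail: "\<And>a b. a < b \<Longrightarrow> \<bar>lm a b - ramp a b 0\<bar> \<le> C / (b - a)"
  shows "\<exists>\<nu>. real_distribution \<nu> \<and> (\<forall>x a b. x < a \<and> a < b \<longrightarrow> cdf \<nu> x \<le> lm a b) \<and> (\<forall>a b. a < b \<longrightarrow> lm a b \<le> cdf \<nu> b)"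
proof -
  define P where "P x = {p :: real \<times> real. x < fst p \<and> fst p < snd p}" for x
  define F where "F x = (INF p\<in>P x. lm (fst p) (snd p))" for x
  have ne: "P x \<noteq> {}" for x
  proof -
    have "(x + 1, x + 2) \<in> P x" by (simp add: P_def)
    then show ?thesis by blast
  qed
  have bdd: "bdd_below ((\<lambda>p. lm (fst p) (snd p)) ` P x)" for x
    using bd by (intro bdd_belowI[of _ 0]) (auto simp: P_def)
  have Fle: "F x \<le> lm a b" if "x < a" "a < b" for x a b
    using cINF_lower[OF bdd, of "(a, b)" x] that by (simp add: F_def P_def)
  have Fge: "c \<le> F x" if "\<And>a b. x < a \<Longrightarrow> a < b \<Longrightarrow> c \<le> lm a b" for c x
    unfolding F_def by (rule cINF_greatest[OF ne]) (use that in \<open>auto simp: P_def\<close>)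
  have Fmono: "F x \<le> F y" if "x \<le> y" for x y
    by (rule Fge) (use that in \<open>auto intro: Fle\<close>)
  have leF: "lm a b \<le> F b" if "a < b" for a b
    by (rule Fge) (use that in \<open>auto intro: mono\<close>)
  have F1: "F x \<le> 1" for x using Fle[of x "x + 1" "x + 2"] bd(2)[of "x + 1" "x + 2"] by simp
  have F0: "0 \<le> F x" for x by (rule Fge) (auto intro: bd)
  have right: "continuous (at_right x) F" for x
    unfolding continuous_within
  proof (rule order_tendstoI)
    fix y assume "y < F x"
    then have "y < F z" if "x < z" for z using Fmono[of x z] that by simp
    then show "\<forall>\<^sub>F z in at_right x. y < F z"
      by (auto simp: eventually_at_filter intro!: always_eventually)
  next
    fix y assume "F x < y"
    \<comment> \<open>A ramp that nearly attains the infimum starts at some \<open>a > x\<close> and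
      is still admissible for every \<open>z < a\<close>.\<close>
    then obtain a b where ab: "x < a" "a < b" "lm a b < y"
      using cINF_less_iff[OF ne bdd, of x y] by (auto simp: F_def P_def)
    have "F z < y" if "z < a" for z using Fle[OF that ab(2)] ab(3) by simp
    then show "\<forall>\<^sub>F z in at_right x. F z < y"
      using eventually_at_right_real[OF ab(1)] by (auto elim!: eventually_mono)
  qed
  have C: "C \<ge> 0" using tail[of 0 1] by simp
  have bot: "(F \<longlongrightarrow> 0) at_bot"
  proof (rule tendsto_sandwich[of "\<lambda>_. 0" _ _ "\<lambda>x. 4 * C / (- x)"])
    show "\<forall>\<^sub>F x in at_bot. F x \<le> 4 * C / (- x)"
      using eventually_gt_at_bot[of 0]
    proof eventually_elim
      case (elim x)
      \<comment> \<open>The ramp stays away from 0 and has width proportional to |x|. Here its value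
        at 0 is 0; for positive \<open>x\<close>, the ramp from \<open>x / 2\<close> to
        \<open>x\<close> has value 1 at 0.\<close>
      have "F x \<le> lm (x / 2) (x / 4)" by (rule Fle) (use elim in auto)
      also have "\<dots> \<le> C / (x / 4 - x / 2)" using tail[of "x / 2" "x / 4"] elim by (simp add: ramp_def)
      also have "\<dots> = 4 * C / (- x)" using elim by (simp add: field_simps)
      finally show ?case .
    qed
    show "((\<lambda>x. 4 * C / (- x)) \<longlongrightarrow> 0) at_bot"
      by (intro tendsto_divide_0[OF tendsto_const] filterlim_at_top_imp_at_infinity filterlim_uminus_at_top_at_bot)
  qed (use F0 in auto)
  have top: "(F \<longlongrightarrow> 1) at_top"
  proof (rule tendsto_sandwich[of "\<lambda>x. 1 - 2 * C / x" _ _ "\<lambda>_. 1"])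
    show "\<forall>\<^sub>F x in at_top. 1 - 2 * C / x \<le> F x"
      using eventually_gt_at_top[of 0]
    proof eventually_elim
      case (elim x)
      have "1 - 2 * C / x = 1 - C / (x - x / 2)" using elim by (simp add: field_simps)
      also have "\<dots> \<le> lm (x / 2) x" using tail[of "x / 2" x] elim by (simp add: ramp_def)
      also have "\<dots> \<le> F x" by (rule leF) (use elim in auto)
      finally show ?case .
    qed
    have "((\<lambda>x. 1 - 2 * C / x) \<longlongrightarrow> 1 - 0) at_top"
      by (intro tendsto_diff tendsto_const tendsto_divide_0[OF tendsto_const] filterlim_at_top_imp_at_infinity filterlim_ident)
    then show "((\<lambda>x. 1 - 2 * C / x) \<longlongrightarrow> 1) at_top" by simp
  qed (use F1 in auto)
  define \<nu> where "\<nu> = interval_measure F"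
  have rd: "real_distribution \<nu>"
    unfolding \<nu>_def by (rule real_distribution_interval_measure[OF Fmono right bot top])
  have "cdf \<nu> = F"
    unfolding \<nu>_def by (rule ext) (simp add: cdf_def2 measure_interval_measure_Iic[OF Fmono right bot])
  then show ?thesis using rd Fle leF by (intro exI[of _ \<nu>]) auto
qed

text \<open>At a continuity point, a rational ramp placed close enough on either side suffices.
  Rational endpoints leave only countably many exceptional null sets in the application.\<close>

lemma weak_conv_m_from_ramps:
  fixes \<mu> :: "nat \<Rightarrow> real measure" and R :: "nat \<Rightarrow> real \<Rightarrow> real \<Rightarrow> real"
    and lm :: "real \<Rightarrow> real \<Rightarrow> real"
  assumes nu: "real_distribution \<nu>"
    and lo: "\<And>x a b. x < a \<Longrightarrow> a < b \<Longrightarrow> cdf \<nu> x \<le> lm a b" and up: "\<And>a b. a < b \<Longrightarrow> lm a b \<le> cdf \<nu> b"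
    and R: "\<And>n a b. n > 0 \<Longrightarrow> a < b \<Longrightarrow> measure (\<mu> n) {..a} \<le> R n a b \<and> R n a b \<le> measure (\<mu> n) {..b}"
    and conv: "\<And>a b. a \<in> \<rat> \<Longrightarrow> b \<in> \<rat> \<Longrightarrow> a < b \<Longrightarrow> (\<lambda>n. R n a b) \<longlonglongrightarrow> lm a b"
  shows "weak_conv_m \<mu> \<nu>"
  unfolding weak_conv_m_def weak_conv_def
proof (intro allI impI)
  fix x assume cont: "isCont (cdf \<nu>) x"
  show "(\<lambda>n. cdf (\<mu> n) x) \<longlonglongrightarrow> cdf \<nu> x"
  proof (rule order_tendstoI)
    fix y assume "y < cdf \<nu> x"
    then have "\<forall>\<^sub>F z in at x. y < cdf \<nu> z" using cont order_tendstoD(1) unfolding isCont_def by blast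
    then have "\<forall>\<^sub>F z in at_left x. y < cdf \<nu> z" by (rule filter_leD[OF at_le, rotated]) simp
    then obtain d where d: "d < x" "\<And>z. d < z \<Longrightarrow> z < x \<Longrightarrow> y < cdf \<nu> z"
      unfolding eventually_at_left_field by blast
    obtain z where z: "d < z" "z < x" using dense[OF d(1)] by blast
    obtain a where a: "a \<in> \<rat>" "z < a" "a < x" using Rats_dense_in_real[OF z(2)] by blast
    obtain b where b: "b \<in> \<rat>" "a < b" "b < x" using Rats_dense_in_real[OF a(3)] by blast
    have "y < lm a b" using d(2)[OF z] lo[OF a(2) b(2)] by simp
    then have "\<forall>\<^sub>F n in sequentially. y < R n a b" using order_tendstoD(1)[OF conv[OF a(1) b(1,2)]] by blast
    then show "\<forall>\<^sub>F n in sequentially. y < cdf (\<mu> n) x"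
      using eventually_gt_at_top[of 0]
    proof eventually_elim
      case (elim n)
      have "R n a b \<le> cdf (\<mu> n) b" using R[OF elim(2) b(2)] by (simp add: cdf_def2)
      also have "\<dots> \<le> cdf (\<mu> n) x" using R[OF elim(2) b(3)] by (auto simp: cdf_def2)
      finally show ?case using elim(1) by simp
    qed
  next
    fix y assume "cdf \<nu> x < y"
    then have "\<forall>\<^sub>F z in at x. cdf \<nu> z < y" using cont order_tendstoD(2) unfolding isCont_def by blast
    then have "\<forall>\<^sub>F z in at_right x. cdf \<nu> z < y" by (rule filter_leD[OF at_le, rotated]) simp
    then obtain d where d: "x < d" "\<And>z. x < z \<Longrightarrow> z < d \<Longrightarrow> cdf \<nu> z < y"
      unfolding eventually_at_right_field by blast
    obtain a where a: "a \<in> \<rat>" "x < a" "a < d" using Rats_dense_in_real[OF d(1)] by blast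
    obtain b where b: "b \<in> \<rat>" "a < b" "b < d" using Rats_dense_in_real[OF a(3)] by blast
    have "lm a b < y" using up[OF b(2)] d(2)[of b] a b by simp
    then have "\<forall>\<^sub>F n in sequentially. R n a b < y" using order_tendstoD(2)[OF conv[OF a(1) b(1,2)]] by blast
    then show "\<forall>\<^sub>F n in sequentially. cdf (\<mu> n) x < y"
      using eventually_gt_at_top[of 0]
    proof eventually_elim
      case (elim n)
      have "cdf (\<mu> n) x \<le> cdf (\<mu> n) a" using R[OF elim(2) a(2)] by (auto simp: cdf_def2)
      also have "\<dots> \<le> R n a b" using R[OF elim(2) b(2)] by (simp add: cdf_def2)
      finally show ?case using elim(1) by simp
    qed
  qed
qed

text \<open>\<open>h = 1\<close> always qualifies, because distribution functions have values in
  [0, 1].\<close>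

lemma levy_dist_bounds:
  assumes "prob_space \<mu>" "prob_space \<nu>"
  shows "0 \<le> levy_dist \<mu> \<nu>" "levy_dist \<mu> \<nu> \<le> 1"
proof -
  interpret \<mu>: prob_space \<mu> by fact
  interpret \<nu>: prob_space \<nu> by fact
  let ?S = "{h. h \<ge> 0 \<and> (\<forall>x. measure \<mu> {..x - h} - h \<le> measure \<nu> {..x} \<and> measure \<nu> {..x} \<le> measure \<mu> {..x + h} + h)}"
  have "measure \<mu> {..x - 1} - 1 \<le> measure \<nu> {..x} \<and> measure \<nu> {..x} \<le> measure \<mu> {..x + 1} + 1" for x
    using \<mu>.prob_le_1[of "{..x - 1}"] \<nu>.prob_le_1[of "{..x}"] measure_nonneg[of \<mu> "{..x + 1}"] measure_nonneg[of \<nu> "{..x}"]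
    by linarith
  then have 1: "1 \<in> ?S" by simp
  show "0 \<le> levy_dist \<mu> \<nu>" unfolding levy_dist_def
  proof (rule cInf_greatest)
    show "?S \<noteq> {}" using 1 by blast
  qed simp
  show "levy_dist \<mu> \<nu> \<le> 1" unfolding levy_dist_def by (rule cInf_lower[OF 1]) (auto intro: bdd_belowI[of _ 0])
qed

text \<open>Finitely many ramps suffice. Ramps on a grid of mesh \<delta> compare the two
  distribution functions at grid points up to one mesh and an error \<delta>; outside the grid both
  are nearly 0 or nearly 1. Rounding an arbitrary \<open>x\<close> to the grid leads to
  \<open>4 * \<delta>\<close>.\<close>

lemma levy_dist_le_grid:
  fixes R lm :: "real \<Rightarrow> real \<Rightarrow> real" and N :: int and \<delta> :: real
  assumes mu: "prob_space \<mu>" and nu: "real_distribution \<nu>"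
    and lo: "\<And>x a b. x < a \<Longrightarrow> a < b \<Longrightarrow> cdf \<nu> x \<le> lm a b" and up: "\<And>a b. a < b \<Longrightarrow> lm a b \<le> cdf \<nu> b"
    and R: "\<And>a b. a < b \<Longrightarrow> measure \<mu> {..a} \<le> R a b" "\<And>a b. a < b \<Longrightarrow> R a b \<le> measure \<mu> {..b}"
    and \<delta>: "\<delta> > 0" and N: "cdf \<nu> ((1 - N) * \<delta>) \<le> \<delta>" "1 - \<delta> \<le> cdf \<nu> ((N - 1) * \<delta>)" "N \<ge> 0"
    and close: "\<And>j. j \<in> {-N..N} \<Longrightarrow> \<bar>R (j * \<delta>) ((j + 1) * \<delta>) - lm (j * \<delta>) ((j + 1) * \<delta>)\<bar> \<le> \<delta>"
  shows "levy_dist \<mu> \<nu> \<le> 4 * \<delta>"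
proof -
  interpret \<mu>: prob_space \<mu> by fact
  interpret \<nu>: real_distribution \<nu> by fact
  define f where "f x = measure \<mu> {..x}" for x
  have fm: "f x \<le> f y" if "x \<le> y" for x y
    using R[of x y] that by (cases "x = y") (auto simp: f_def)
  have f1: "f x \<le> 1" "0 \<le> f x" for x by (auto simp: f_def)
  let ?g = "cdf \<nu>"
  note gm = \<nu>.cdf_nondecreasing
  have g0: "0 \<le> ?g x" and g1: "?g x \<le> 1" for x using \<nu>.cdf_nonneg \<nu>.cdf_bounded_prob by auto
  have st: "real_of_int j * \<delta> < (real_of_int j + 1) * \<delta>" for j using \<delta> by simp
  have fg: "f (j * \<delta>) \<le> ?g ((j + 1) * \<delta>) + \<delta>" if "j \<in> {-N..N}" for j :: int
    using close[OF that] R(1)[OF st, of j] up[OF st, of j] by (simp add: f_def)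
  have gf: "?g x \<le> f ((j + 1) * \<delta>) + \<delta>" if "j \<in> {-N..N}" "x < j * \<delta>" for j :: int and x
    using close[OF that(1)] R(2)[OF st, of j] lo[OF that(2) st] by (simp add: f_def)
  have "f (x - 4 * \<delta>) - 4 * \<delta> \<le> ?g x \<and> ?g x \<le> f (x + 4 * \<delta>) + 4 * \<delta>" for x
  proof -
    define i where "i = \<lfloor>x / \<delta>\<rfloor>"
    have i: "i * \<delta> \<le> x" "x < (i + 1) * \<delta>"
    proof -
      have "i \<le> x / \<delta>" "x / \<delta> < i + 1" using floor_correct[of "x / \<delta>"] by (simp_all add: i_def)
      then show "i * \<delta> \<le> x" "x < (i + 1) * \<delta>" using \<delta> by (simp_all only: pos_le_divide_eq pos_divide_less_eq)
    qed
    have m: "real_of_int k * \<delta> \<le> real_of_int l * \<delta>" if "k \<le> l" for k l using that \<delta> by (simp add: mult_right_mono)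
    have A: "f (x - 4 * \<delta>) \<le> ?g x + 4 * \<delta>"
    proof -
      \<comment> \<open>\<open>(i - 3) * \<delta>\<close> is the first grid point above
        \<open>x - 4 * \<delta>\<close>, and its right neighbour is still at most
        \<open>x\<close>.\<close>
      consider "i - 3 \<in> {-N..N}" | "i - 3 > N" | "i - 3 < - N" by force
      then show ?thesis
      proof cases
        case 1
        have "f (x - 4 * \<delta>) \<le> f ((i - 3) * \<delta>)" using i by (intro fm) (simp add: algebra_simps)
        also have "\<dots> \<le> ?g ((i - 3 + 1) * \<delta>) + \<delta>" using fg[OF 1] by simp
        also have "?g ((i - 3 + 1) * \<delta>) \<le> ?g x" using i \<delta> by (intro gm) (simp add: algebra_simps)
        finally show ?thesis using \<delta> by simp
      next
        case 2
        have "(N - 1) * \<delta> \<le> x" using m[of "N - 1" i] 2 i by simp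
        then have "?g ((N - 1) * \<delta>) \<le> ?g x" by (rule gm)
        then show ?thesis using N f1(1)[of "x - 4 * \<delta>"] \<delta> by linarith
      next
        case 3
        have "x - 4 * \<delta> \<le> (- N) * \<delta>" using m[of "i - 3" "- N"] 3 i by (simp add: algebra_simps)
        then have "f (x - 4 * \<delta>) \<le> f ((- N) * \<delta>)" by (rule fm)
        also have "\<dots> \<le> ?g ((1 - N) * \<delta>) + \<delta>" using fg[of "- N"] N by (simp add: algebra_simps)
        finally show ?thesis using N g0[of x] \<delta> by linarith
      qed
    qed
    have B: "?g x \<le> f (x + 4 * \<delta>) + 4 * \<delta>"
    proof -
      \<comment> \<open>The ramp has to start strictly to the right of \<open>x\<close> and to end
        no later than \<open>x + 4 * \<delta>\<close>; the one from
        \<open>(i + 2) * \<delta>\<close> to \<open>(i + 3) * \<delta>\<close> does both.\<close>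
      consider "i + 2 \<in> {-N..N}" | "i + 2 > N" | "i + 2 < - N" by force
      then show ?thesis
      proof cases
        case 1
        have "?g x \<le> f ((i + 2 + 1) * \<delta>) + \<delta>" using gf[OF 1, of x] i \<delta> by (simp add: algebra_simps)
        also have "f ((i + 2 + 1) * \<delta>) \<le> f (x + 4 * \<delta>)" using i \<delta> by (intro fm) (simp add: algebra_simps)
        finally show ?thesis using \<delta> by simp
      next
        case 2
        have "?g ((N - 1) * \<delta>) \<le> f ((N + 1) * \<delta>) + \<delta>" using gf[of N "(N - 1) * \<delta>"] N \<delta> by (simp add: algebra_simps)
        also have "f ((N + 1) * \<delta>) \<le> f (x + 4 * \<delta>)"
          using m[of "N - 1" i] 2 i \<delta> by (intro fm) (simp add: algebra_simps)
        finally show ?thesis using N g1[of x] \<delta> by linarith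
      next
        case 3
        have "x \<le> (1 - N) * \<delta>" using m[of "i + 1" "1 - N"] 3 i by simp
        then have "?g x \<le> ?g ((1 - N) * \<delta>)" by (rule gm)
        then show ?thesis using N f1(2)[of "x + 4 * \<delta>"] \<delta> by linarith
      qed
    qed
    show ?thesis using A B by simp
  qed
  then have "4 * \<delta> \<in> {h. h \<ge> 0 \<and> (\<forall>x. measure \<mu> {..x - h} - h \<le> measure \<nu> {..x} \<and> measure \<nu> {..x} \<le> measure \<mu> {..x + h} + h)}"
    using \<delta> by (simp add: f_def cdf_def2)
  then show ?thesis unfolding levy_dist_def by (rule cInf_lower) (auto intro: bdd_belowI[of _ 0])
qed

section \<open>Decoupling and convergence in mean\<close>

context prob_space
begin

text \<open>For indicators this is independence; sums, multiples and monotone limits extend it to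
  nonnegative functions.\<close>

lemma nn_integral_indep_event:
  assumes ind: "indep_set F (sets N)" and E: "E \<in> F" and sp: "space N = space M"
    and h: "h \<in> borel_measurable N"
  shows "(\<integral>\<^sup>+\<omega>. indicator E \<omega> * h \<omega> \<partial>M) = emeasure M E * (\<integral>\<^sup>+\<omega>. h \<omega> \<partial>M)"
proof -
  have sub: "F \<subseteq> events" "sets N \<subseteq> events" using ind by (auto simp: indep_set_def indep_sets_def split: bool.splits)
  have E' [measurable]: "E \<in> events" using sub E by auto
  have mM: "g \<in> borel_measurable M" if "g \<in> borel_measurable N" for g :: "'a \<Rightarrow> ennreal"
    using that sub(2) sp by (auto simp: measurable_def)
  from h show ?thesis
  proof (induction h rule: borel_measurable_induct)
    case (cong f g)
    have "(\<integral>\<^sup>+\<omega>. indicator E \<omega> * f \<omega> \<partial>M) = (\<integral>\<^sup>+\<omega>. indicator E \<omega> * g \<omega> \<partial>M)" "(\<integral>\<^sup>+\<omega>. f \<omega> \<partial>M) = (\<integral>\<^sup>+\<omega>. g \<omega> \<partial>M)"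
      using cong(3) sp by (auto intro!: nn_integral_cong)
    then show ?case using cong(4) by simp
  next
    case (set A)
    then have A [measurable]: "A \<in> events" using sub by auto
    have "prob (E \<inter> A) = prob E * prob A" by (rule indep_setD[OF ind E set])
    then have "emeasure M (E \<inter> A) = emeasure M E * emeasure M A"
      by (simp add: emeasure_eq_measure ennreal_mult')
    moreover have "(\<integral>\<^sup>+\<omega>. indicator E \<omega> * indicator A \<omega> \<partial>M) = emeasure M (E \<inter> A)"
    proof -
      have "(\<integral>\<^sup>+\<omega>. indicator E \<omega> * indicator A \<omega> \<partial>M) = (\<integral>\<^sup>+\<omega>. indicator (E \<inter> A) \<omega> \<partial>M)"
        by (intro nn_integral_cong) (simp add: indicator_inter_arith)
      then show ?thesis by simp
    qed
    ultimately show ?case by simp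
  next
    case (mult u c)
    note [measurable] = mM[OF mult(2)]
    have "(\<integral>\<^sup>+\<omega>. indicator E \<omega> * (c * u \<omega>) \<partial>M) = c * (\<integral>\<^sup>+\<omega>. indicator E \<omega> * u \<omega> \<partial>M)"
      by (subst nn_integral_cmult[symmetric]) (auto intro!: nn_integral_cong simp: mult_ac)
    then show ?case using mult.IH by (simp add: nn_integral_cmult mult_ac)
  next
    case (add u v)
    note [measurable] = mM[OF \<open>u \<in> borel_measurable N\<close>] mM[OF \<open>v \<in> borel_measurable N\<close>]
    have "(\<integral>\<^sup>+\<omega>. indicator E \<omega> * (v \<omega> + u \<omega>) \<partial>M) = (\<integral>\<^sup>+\<omega>. indicator E \<omega> * v \<omega> \<partial>M) + (\<integral>\<^sup>+\<omega>. indicator E \<omega> * u \<omega> \<partial>M)"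
      by (subst nn_integral_add[symmetric]) (auto intro!: nn_integral_cong simp: distrib_left)
    then show ?case using add.IH by (simp add: nn_integral_add distrib_left)
  next
    case (seq U)
    have [measurable]: "U i \<in> borel_measurable M" for i using seq.hyps(1) by (rule mM)
    have "(\<integral>\<^sup>+\<omega>. indicator E \<omega> * (SUP i. U i) \<omega> \<partial>M) = (\<integral>\<^sup>+\<omega>. (SUP i. indicator E \<omega> * U i \<omega>) \<partial>M)"
      by (intro nn_integral_cong) (simp add: SUP_mult_left_ennreal image_comp)
    also have "\<dots> = (SUP i. \<integral>\<^sup>+\<omega>. indicator E \<omega> * U i \<omega> \<partial>M)"
      using \<open>incseq U\<close> by (intro nn_integral_monotone_convergence_SUP) (auto simp: incseq_def le_fun_def intro!: mult_left_mono)
    also have "\<dots> = (SUP i. emeasure M E * (\<integral>\<^sup>+\<omega>. U i \<omega> \<partial>M))" using seq.IH by simp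
    also have "\<dots> = emeasure M E * (SUP i. \<integral>\<^sup>+\<omega>. U i \<omega> \<partial>M)" by (rule SUP_mult_left_ennreal[symmetric])
    also have "(SUP i. \<integral>\<^sup>+\<omega>. U i \<omega> \<partial>M) = (\<integral>\<^sup>+\<omega>. (SUP i. U i) \<omega> \<partial>M)"
    proof -
      have "(SUP i. U i) = (\<lambda>\<omega>. SUP i. U i \<omega>)" by (simp add: fun_eq_iff image_comp)
      then show ?thesis using \<open>incseq U\<close> by (simp add: nn_integral_monotone_convergence_SUP)
    qed
    finally show ?case .
  qed
qed

text \<open>A substitute for conditioning on the graph. As \<open>G\<close> takes finitely many
  values, the integral splits over the events \<open>G = A\<close>, and on each of them the
  independent \<open>f A\<close> can be integrated separately. In the inner expectation the graph is
  frozen.\<close>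

lemma decouple_finite:
  fixes f :: "'g \<Rightarrow> 'a \<Rightarrow> real"
  assumes ind: "indep_set F (sets N)" and sp: "space N = space M"
    and ev: "\<And>A. {\<omega> \<in> space M. G \<omega> = A} \<in> F" and G: "G \<in> M \<rightarrow>\<^sub>M count_space UNIV"
    and S: "finite S" "\<And>\<omega>. G \<omega> \<in> S"
    and f: "\<And>A. A \<in> S \<Longrightarrow> f A \<in> borel_measurable N" and f0: "\<And>A \<omega>. 0 \<le> f A \<omega>"
    and int: "integrable M (\<lambda>\<omega>. f (G \<omega>) \<omega>)"
  shows "AE \<omega> in M. integrable M (f (G \<omega>))"
    and "expectation (\<lambda>\<omega>. expectation (f (G \<omega>))) = expectation (\<lambda>\<omega>. f (G \<omega>) \<omega>)"
proof -
  have sub: "F \<subseteq> events" "sets N \<subseteq> events" using ind by (auto simp: indep_set_def indep_sets_def split: bool.splits)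
  have fM: "f A \<in> borel_measurable M" if "A \<in> S" for A
    using f[OF that] sub(2) sp by (auto simp: measurable_def)
  define I where "I A = (\<integral>\<^sup>+\<omega>. ennreal (f A \<omega>) \<partial>M)" for A
  let ?E = "\<lambda>A. {\<omega> \<in> space M. G \<omega> = A}"
  have E [measurable]: "?E A \<in> events" for A using ev sub by auto
  have split: "(\<Sum>A\<in>S. indicator (?E A) \<omega> * k A) = k (G \<omega>)" if "\<omega> \<in> space M" for \<omega> and k :: "'g \<Rightarrow> ennreal"
  proof -
    have "(\<Sum>A\<in>S. indicator (?E A) \<omega> * k A) = (\<Sum>A\<in>S. if A = G \<omega> then k A else 0)"
      using that by (intro sum.cong) (auto simp: indicator_def)
    then show ?thesis using S by simp
  qed
  have "(\<integral>\<^sup>+\<omega>. I (G \<omega>) \<partial>M) = (\<integral>\<^sup>+\<omega>. (\<Sum>A\<in>S. indicator (?E A) \<omega> * I A) \<partial>M)"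
    by (intro nn_integral_cong) (simp add: split)
  also have "\<dots> = (\<Sum>A\<in>S. emeasure M (?E A) * I A)"
    by (subst nn_integral_sum) (auto simp: nn_integral_multc)
  also have "\<dots> = (\<Sum>A\<in>S. \<integral>\<^sup>+\<omega>. indicator (?E A) \<omega> * ennreal (f A \<omega>) \<partial>M)"
    unfolding I_def using f
    by (intro sum.cong refl nn_integral_indep_event[symmetric, OF ind ev sp]) simp
  also have "\<dots> = (\<integral>\<^sup>+\<omega>. (\<Sum>A\<in>S. indicator (?E A) \<omega> * ennreal (f A \<omega>)) \<partial>M)"
    using fM by (subst nn_integral_sum) auto
  also have "\<dots> = (\<integral>\<^sup>+\<omega>. ennreal (f (G \<omega>) \<omega>) \<partial>M)"
    by (intro nn_integral_cong) (rule split)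
  also have "\<dots> = ennreal (expectation (\<lambda>\<omega>. f (G \<omega>) \<omega>))"
    using int f0 by (intro nn_integral_eq_integral) auto
  finally have eq: "(\<integral>\<^sup>+\<omega>. I (G \<omega>) \<partial>M) = ennreal (expectation (\<lambda>\<omega>. f (G \<omega>) \<omega>))" .
  have Im: "(\<lambda>\<omega>. I (G \<omega>)) \<in> borel_measurable M" using G by (rule measurable_compose) simp
  \<comment> \<open>By nonnegativity, a finite total forces finite inner integrals for almost every
    frozen graph.\<close>
  have "AE \<omega> in M. I (G \<omega>) \<noteq> \<infinity>" by (rule nn_integral_noteq_infinite[OF Im]) (simp add: eq)
  then show ae: "AE \<omega> in M. integrable M (f (G \<omega>))"
  proof eventually_elim
    case (elim \<omega>)
    then show ?case using f0 fM[OF S(2)] by (intro integrableI_nonneg) (auto simp: I_def top.not_eq_extremum)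
  qed
  have em: "(\<lambda>\<omega>. expectation (f (G \<omega>))) \<in> borel_measurable M" using G by (rule measurable_compose) simp
  have "(\<integral>\<^sup>+\<omega>. ennreal (expectation (f (G \<omega>))) \<partial>M) = (\<integral>\<^sup>+\<omega>. I (G \<omega>) \<partial>M)"
    using ae by (intro nn_integral_cong_AE) (auto elim!: eventually_mono simp: I_def f0 nn_integral_eq_integral)
  then have "(\<integral>\<^sup>+\<omega>. ennreal (expectation (f (G \<omega>))) \<partial>M) = ennreal (expectation (\<lambda>\<omega>. f (G \<omega>) \<omega>))" by (simp add: eq)
  then show "expectation (\<lambda>\<omega>. expectation (f (G \<omega>))) = expectation (\<lambda>\<omega>. f (G \<omega>) \<omega>)"
    using em f0 by (subst integral_eq_nn_integral) (auto intro!: AE_I2 integral_nonneg enn2real_ennreal)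
qed

lemma tendsto_expectation_of_L1:
  fixes X :: "nat \<Rightarrow> 'a \<Rightarrow> real"
  assumes X: "\<And>n. integrable M (X n)" and c: "(\<lambda>n. expectation (\<lambda>\<omega>. \<bar>X n \<omega> - c\<bar>)) \<longlonglongrightarrow> 0"
  shows "(\<lambda>n. expectation (X n)) \<longlonglongrightarrow> c"
proof (rule LIM_zero_cancel, rule tendsto_rabs_zero_cancel, rule tendsto_sandwich[OF _ _ tendsto_const c])
  show "\<forall>\<^sub>F n in sequentially. \<bar>expectation (X n) - c\<bar> \<le> expectation (\<lambda>\<omega>. \<bar>X n \<omega> - c\<bar>)"
  proof (rule always_eventually, rule allI)
    fix n
    have "\<bar>expectation (X n) - c\<bar> = \<bar>expectation (\<lambda>\<omega>. X n \<omega> - c)\<bar>" using X by (simp add: prob_space)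
    also have "\<dots> \<le> expectation (\<lambda>\<omega>. \<bar>X n \<omega> - c\<bar>)" by (rule integral_abs_bound)
    finally show "\<bar>expectation (X n) - c\<bar> \<le> expectation (\<lambda>\<omega>. \<bar>X n \<omega> - c\<bar>)" .
  qed
qed simp

lemma L1_dist_triangle:
  fixes X Y Z :: "'a \<Rightarrow> real"
  assumes "integrable M X" "integrable M Y" "integrable M Z"
  shows "expectation (\<lambda>\<omega>. \<bar>X \<omega> - Z \<omega>\<bar>) \<le> expectation (\<lambda>\<omega>. \<bar>X \<omega> - Y \<omega>\<bar>) + expectation (\<lambda>\<omega>. \<bar>Y \<omega> - Z \<omega>\<bar>)"
proof -
  have "expectation (\<lambda>\<omega>. \<bar>X \<omega> - Z \<omega>\<bar>) \<le> expectation (\<lambda>\<omega>. \<bar>X \<omega> - Y \<omega>\<bar> + \<bar>Y \<omega> - Z \<omega>\<bar>)"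
    using assms by (intro integral_mono) auto
  also have "\<dots> = expectation (\<lambda>\<omega>. \<bar>X \<omega> - Y \<omega>\<bar>) + expectation (\<lambda>\<omega>. \<bar>Y \<omega> - Z \<omega>\<bar>)"
    using assms by (intro Bochner_Integration.integral_add) auto
  finally show ?thesis .
qed

text \<open>Each accuracy comes with its own constant, and these are not known to converge. The
  means of \<open>X n\<close> are eventually close to each of them, hence form a Cauchy sequence,
  and its limit is the constant.\<close>

lemma L1_limit_const_closed:
  fixes X :: "nat \<Rightarrow> 'a \<Rightarrow> real"
  assumes X: "\<And>n. integrable M (X n)"
    and ap: "\<And>\<epsilon>. \<epsilon> > 0 \<Longrightarrow> \<exists>Y c. (\<forall>n. integrable M (Y n)) \<and> (\<forall>n>0. expectation (\<lambda>\<omega>. \<bar>X n \<omega> - Y n \<omega>\<bar>) \<le> \<epsilon>) \<and>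
        (\<lambda>n. expectation (\<lambda>\<omega>. \<bar>Y n \<omega> - c\<bar>)) \<longlonglongrightarrow> 0"
  shows "\<exists>c. (\<lambda>n. expectation (\<lambda>\<omega>. \<bar>X n \<omega> - c\<bar>)) \<longlonglongrightarrow> 0"
proof -
  have ap2: "\<exists>c N. \<forall>n\<ge>N. expectation (\<lambda>\<omega>. \<bar>X n \<omega> - c\<bar>) < \<epsilon>" if \<epsilon>: "\<epsilon> > 0" for \<epsilon>
  proof -
    obtain Y c where Y: "\<And>n. integrable M (Y n)" "\<And>n. n > 0 \<Longrightarrow> expectation (\<lambda>\<omega>. \<bar>X n \<omega> - Y n \<omega>\<bar>) \<le> \<epsilon> / 2"
      "(\<lambda>n. expectation (\<lambda>\<omega>. \<bar>Y n \<omega> - c\<bar>)) \<longlonglongrightarrow> 0" using ap[of "\<epsilon> / 2"] \<epsilon> by auto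
    have "\<forall>\<^sub>F n in sequentially. expectation (\<lambda>\<omega>. \<bar>Y n \<omega> - c\<bar>) < \<epsilon> / 2"
      using order_tendstoD(2)[OF Y(3), of "\<epsilon> / 2"] \<epsilon> by simp
    then have "\<forall>\<^sub>F n in sequentially. expectation (\<lambda>\<omega>. \<bar>X n \<omega> - c\<bar>) < \<epsilon>"
      using eventually_gt_at_top[of 0]
    proof eventually_elim
      case (elim n)
      then show ?case using L1_dist_triangle[OF X Y(1), of "\<lambda>_. c" n n] Y(2)[of n] by simp
    qed
    then show ?thesis by (auto simp: eventually_sequentially)
  qed
  have near: "\<bar>expectation (X n) - c\<bar> \<le> expectation (\<lambda>\<omega>. \<bar>X n \<omega> - c\<bar>)" for n c
  proof -
    have "\<bar>expectation (X n) - c\<bar> = \<bar>expectation (\<lambda>\<omega>. X n \<omega> - c)\<bar>" using X by (simp add: prob_space)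
    also have "\<dots> \<le> expectation (\<lambda>\<omega>. \<bar>X n \<omega> - c\<bar>)" by (rule integral_abs_bound)
    finally show ?thesis .
  qed
  have "Cauchy (\<lambda>n. expectation (X n))"
    unfolding Cauchy_def
  proof (intro allI impI)
    fix e :: real assume "e > 0"
    then obtain c N where cN: "\<And>n. n \<ge> N \<Longrightarrow> expectation (\<lambda>\<omega>. \<bar>X n \<omega> - c\<bar>) < e / 2" using ap2[of "e / 2"] by auto
    have "dist (expectation (X m)) (expectation (X n)) < e" if "m \<ge> N" "n \<ge> N" for m n
      using near[of m c] near[of n c] cN[OF that(1)] cN[OF that(2)] unfolding dist_real_def by linarith
    then show "\<exists>N. \<forall>m\<ge>N. \<forall>n\<ge>N. dist (expectation (X m)) (expectation (X n)) < e" by blast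
  qed
  then obtain c where c: "(\<lambda>n. expectation (X n)) \<longlonglongrightarrow> c" using Cauchy_convergent convergent_def by blast
  have "(\<lambda>n. expectation (\<lambda>\<omega>. \<bar>X n \<omega> - c\<bar>)) \<longlonglongrightarrow> 0"
  proof (rule LIMSEQ_I)
    fix e :: real assume e: "e > 0"
    then obtain c' N where cN: "\<And>n. n \<ge> N \<Longrightarrow> expectation (\<lambda>\<omega>. \<bar>X n \<omega> - c'\<bar>) < e / 2" using ap2[of "e / 2"] by auto
    have "(\<lambda>n. \<bar>expectation (X n) - c'\<bar>) \<longlonglongrightarrow> \<bar>c - c'\<bar>" by (intro tendsto_intros c)
    moreover have "\<bar>expectation (X n) - c'\<bar> \<le> e / 2" if "n \<ge> N" for n using near[of n c'] cN[OF that] by simp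
    ultimately have cc: "\<bar>c - c'\<bar> \<le> e / 2" by (intro LIMSEQ_le_const2) auto
    have tri: "expectation (\<lambda>\<omega>. \<bar>X n \<omega> - c\<bar>) \<le> expectation (\<lambda>\<omega>. \<bar>X n \<omega> - c'\<bar>) + \<bar>c - c'\<bar>" for n
      using L1_dist_triangle[OF X, of "\<lambda>_. c'" "\<lambda>_. c" n] by (simp add: prob_space abs_minus_commute)
    have "norm (expectation (\<lambda>\<omega>. \<bar>X n \<omega> - c\<bar>) - 0) < e" if "n \<ge> N" for n
    proof -
      have "expectation (\<lambda>\<omega>. \<bar>X n \<omega> - c\<bar>) \<ge> 0" by simp
      then show ?thesis using cN[OF that] tri[of n] cc by simp
    qed
    then show "\<exists>no. \<forall>n\<ge>no. norm (expectation (\<lambda>\<omega>. \<bar>X n \<omega> - c\<bar>) - 0) < e" by blast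
  qed
  then show ?thesis by blast
qed

end

section \<open>Convergence of the expected ramp statistics\<close>

lemma finite_simple_graphs: "finite {A. simple_graph_on n A}"
proof (rule finite_imageD)
  have "(\<lambda>A. {p. A (fst p) (snd p)}) ` {A. simple_graph_on n A} \<subseteq> Pow ({..<n} \<times> {..<n})"
    by (auto simp: simple_graph_on_def)
  then show "finite ((\<lambda>A. {p. A (fst p) (snd p)}) ` {A. simple_graph_on n A})"
    by (rule finite_subset) simp
  show "inj_on (\<lambda>A. {p. A (fst p) (snd p)}) {A. simple_graph_on n A}"
    by (rule inj_onI) (auto simp: set_eq_iff fun_eq_iff)
qed

lemma (in prob_space) integrable_graph_function:
  assumes simple: "\<And>\<omega>. simple_graph_on n (H \<omega>)" and meas: "H \<in> M \<rightarrow>\<^sub>M count_space UNIV"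
  shows "integrable M (\<lambda>\<omega>. h (H \<omega>) :: real)"
proof (rule integrable_const_bound[of _ "\<Sum>A\<in>{A. simple_graph_on n A}. \<bar>h A\<bar>"])
  have "\<bar>h (H \<omega>)\<bar> \<le> (\<Sum>A\<in>{A. simple_graph_on n A}. \<bar>h A\<bar>)" for \<omega>
    using simple[of \<omega>] finite_simple_graphs[of n]
    by (intro member_le_sum[where f = "\<lambda>A. \<bar>h A\<bar>"]) auto
  then show "AE \<omega> in M. norm (h (H \<omega>)) \<le> (\<Sum>A\<in>{A. simple_graph_on n A}. \<bar>h A\<bar>)" by simp
  show "(\<lambda>\<omega>. h (H \<omega>)) \<in> borel_measurable M" using meas by (rule measurable_compose) simp
qed

text \<open>A common setting for both parts of the theorem. Integrals over \<open>\<omega>'\<close>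
  average the weights with the graph frozen at \<open>\<omega>\<close>. Convergence in mean to a
  constant in \<open>G_local\<close> is ordinary convergence if the graphs are
  deterministic.\<close>

locale converging_graphs = iid_weights +
  fixes G :: "nat \<Rightarrow> 'a \<Rightarrow> nat \<Rightarrow> nat \<Rightarrow> bool"
  assumes G_simple: "\<And>n \<omega>. simple_graph_on n (G n \<omega>)"
    and G_meas: "\<And>n. G n \<in> M \<rightarrow>\<^sub>M count_space UNIV"
    and G_int: "\<And>n. AE \<omega> in M. \<forall>v<n. integrable M (\<lambda>\<omega>'. wdeg n (w \<omega>') (G n \<omega>) v)"
    and G_ui: "\<And>\<epsilon>. \<epsilon> > 0 \<Longrightarrow> \<exists>K. \<forall>n>0. expectation (\<lambda>\<omega>. (\<Sum>v<n. expectation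
       (\<lambda>\<omega>'. if wdeg n (w \<omega>') (G n \<omega>) v > K then wdeg n (w \<omega>') (G n \<omega>) v else 0)) / real n) < \<epsilon>"
    and G_local: "\<And>f. gs_bcont f \<Longrightarrow>
       \<exists>r. (\<lambda>n. expectation (\<lambda>\<omega>. \<bar>(\<Sum>v<n. f (comp_at n (G n \<omega>) v)) / real n - r\<bar>)) \<longlonglongrightarrow> 0"
begin

lemma integrable_G: "integrable M (\<lambda>\<omega>. h (G n \<omega>) :: real)"
  by (rule integrable_graph_function[OF G_simple G_meas])

definition tail_deg :: "real \<Rightarrow> nat \<Rightarrow> (nat \<Rightarrow> nat \<Rightarrow> bool) \<Rightarrow> real" where
  "tail_deg K n A = (\<Sum>v<n. expectation (\<lambda>\<omega>. if wdeg n (w \<omega>) A v > K then wdeg n (w \<omega>) A v else 0)) / real n"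

definition mean_deg :: "nat \<Rightarrow> (nat \<Rightarrow> nat \<Rightarrow> bool) \<Rightarrow> real" where
  "mean_deg n A = (\<Sum>v<n. expectation (\<lambda>\<omega>. wdeg n (w \<omega>) A v)) / real n"

lemma integrable_tail_wdeg:
  assumes "integrable M (\<lambda>\<omega>. wdeg n (w \<omega>) A v)"
  shows "integrable M (\<lambda>\<omega>. if wdeg n (w \<omega>) A v > K then wdeg n (w \<omega>) A v else 0)"
proof (rule Bochner_Integration.integrable_bound[OF assms])
  note [measurable] = measurable_wdeg[of w M n A v, OF measurable_w]
  show "(\<lambda>\<omega>. if wdeg n (w \<omega>) A v > K then wdeg n (w \<omega>) A v else 0) \<in> borel_measurable M" by measurable
qed simp

text \<open>The level supplied by condition (B) may be negative; raising it to at least 0 only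
  decreases the tail.\<close>

lemma tail_deg_small:
  assumes "\<epsilon> > 0"
  shows "\<exists>K\<ge>0. \<forall>n>0. expectation (\<lambda>\<omega>. tail_deg K n (G n \<omega>)) < \<epsilon>"
proof -
  obtain K where K: "\<And>n. n > 0 \<Longrightarrow> expectation (\<lambda>\<omega>. tail_deg K n (G n \<omega>)) < \<epsilon>"
    using G_ui[OF assms] unfolding tail_deg_def by blast
  have "expectation (\<lambda>\<omega>. tail_deg (max K 0) n (G n \<omega>)) \<le> expectation (\<lambda>\<omega>. tail_deg K n (G n \<omega>))" for n
  proof (rule integral_mono_AE[OF integrable_G integrable_G])
    show "AE \<omega> in M. tail_deg (max K 0) n (G n \<omega>) \<le> tail_deg K n (G n \<omega>)"
      using G_int[of n]
    proof eventually_elim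
      case (elim \<omega>)
      then show ?case unfolding tail_deg_def
        by (intro divide_right_mono sum_mono integral_mono integrable_tail_wdeg) (auto simp: wdeg_nonneg)
    qed
  qed
  then show ?thesis using K by (intro exI[of _ "max K 0"]) (auto intro: le_less_trans)
qed

text \<open>A degree is at most \<open>K\<close> plus its part above level \<open>K\<close>, and the
  mean of the latter is uniformly below 1 for suitable \<open>K\<close>.\<close>

lemma mean_deg_bounded: "\<exists>C. \<forall>n>0. expectation (\<lambda>\<omega>. mean_deg n (G n \<omega>)) \<le> C"
proof -
  obtain K where K: "K \<ge> 0" "\<And>n. n > 0 \<Longrightarrow> expectation (\<lambda>\<omega>. tail_deg K n (G n \<omega>)) < 1"
    using tail_deg_small[of 1] by auto
  have "expectation (\<lambda>\<omega>. mean_deg n (G n \<omega>)) \<le> K + 1" if n: "n > 0" for n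
  proof -
    have "expectation (\<lambda>\<omega>. mean_deg n (G n \<omega>)) \<le> expectation (\<lambda>\<omega>. K + tail_deg K n (G n \<omega>))"
    proof (rule integral_mono_AE[OF integrable_G])
      show "integrable M (\<lambda>\<omega>. K + tail_deg K n (G n \<omega>))" using integrable_G[of "\<lambda>A. K + tail_deg K n A" n] .
      show "AE \<omega> in M. mean_deg n (G n \<omega>) \<le> K + tail_deg K n (G n \<omega>)"
        using G_int[of n]
      proof eventually_elim
        case (elim \<omega>)
        let ?A = "G n \<omega>"
        have "expectation (\<lambda>\<omega>'. wdeg n (w \<omega>') ?A v) \<le> K + expectation (\<lambda>\<omega>'. if wdeg n (w \<omega>') ?A v > K then wdeg n (w \<omega>') ?A v else 0)" if v: "v < n" for v
        proof -
          have i: "integrable M (\<lambda>\<omega>'. wdeg n (w \<omega>') ?A v)" using elim v by simp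
          have "expectation (\<lambda>\<omega>'. wdeg n (w \<omega>') ?A v) \<le> expectation (\<lambda>\<omega>'. K + (if wdeg n (w \<omega>') ?A v > K then wdeg n (w \<omega>') ?A v else 0))"
            using K(1) by (intro integral_mono i Bochner_Integration.integrable_add integrable_tail_wdeg) auto
          also have "\<dots> = K + expectation (\<lambda>\<omega>'. if wdeg n (w \<omega>') ?A v > K then wdeg n (w \<omega>') ?A v else 0)"
            using integrable_tail_wdeg[OF i] by (simp add: prob_space)
          finally show ?thesis .
        qed
        then have "(\<Sum>v<n. expectation (\<lambda>\<omega>'. wdeg n (w \<omega>') ?A v))
            \<le> (\<Sum>v<n. K + expectation (\<lambda>\<omega>'. if wdeg n (w \<omega>') ?A v > K then wdeg n (w \<omega>') ?A v else 0))"
          by (intro sum_mono) simp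
        also have "\<dots> = real n * K + real n * tail_deg K n ?A"
          using n by (simp add: sum.distrib tail_deg_def)
        finally show ?case using n by (simp add: mean_deg_def field_simps)
      qed
    qed
    also have "\<dots> = K + expectation (\<lambda>\<omega>. tail_deg K n (G n \<omega>))" using integrable_G by (simp add: prob_space)
    finally show ?thesis using K(2)[OF n] by simp
  qed
  then show ?thesis by blast
qed

definition mean_ramp :: "real \<Rightarrow> real \<Rightarrow> nat \<Rightarrow> (nat \<Rightarrow> nat \<Rightarrow> bool) \<Rightarrow> real" where
  "mean_ramp a b n A = expectation (ramp_stat n A a b)"

text \<open>The order of choices matters: the degree tail fixes \<open>K\<close>, and only then is
  the polynomial fitted on the interval that \<open>K\<close> dictates.\<close>

lemma mean_ramp_converges:
  assumes ab: "a < b"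
  shows "\<exists>c. (\<lambda>n. expectation (\<lambda>\<omega>. \<bar>mean_ramp a b n (G n \<omega>) - c\<bar>)) \<longlonglongrightarrow> 0"
proof (rule L1_limit_const_closed)
  show "integrable M (\<lambda>\<omega>. mean_ramp a b n (G n \<omega>))" for n by (rule integrable_G)
  fix \<epsilon> :: real assume \<epsilon>: "\<epsilon> > 0"
  \<comment> \<open>Chosen so that the deletion error \<open>8 / (b - a) * \<eta>\<close> equals
    \<open>\<epsilon> / 2\<close>.\<close>
  define \<eta> where "\<eta> = \<epsilon> / 2 * ((b - a) / 8)"
  have \<eta>: "\<eta> > 0" using \<epsilon> ab by (simp add: \<eta>_def)
  obtain K where K: "K \<ge> 0" "\<And>n. n > 0 \<Longrightarrow> expectation (\<lambda>\<omega>. tail_deg K n (G n \<omega>)) < \<eta>"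
    using tail_deg_small[OF \<eta>] by auto
  have "\<exists>c d. \<forall>x\<in>{-(2 * K)..2 * K}. \<bar>ramp a b x - (\<Sum>k\<le>d. c k * x ^ k)\<bar> \<le> \<epsilon> / 2"
    by (rule ramp_poly_approx[OF ab]) (use \<epsilon> in simp)
  then obtain c d where cd: "\<forall>x\<in>{-(2 * K)..2 * K}. \<bar>ramp a b x - (\<Sum>k\<le>d. c k * x ^ k)\<bar> \<le> \<epsilon> / 2" by blast
  have p: "\<bar>ramp a b x - (\<Sum>k\<le>d. c k * x ^ k)\<bar> \<le> \<epsilon> / 2" if "x \<in> {-2 * K..2 * K}" for x
    by (rule bspec[OF cd]) (use that in simp)
  define g where "g R = (\<Sum>k\<le>d. c k * local_mean K k R)" for R
  define Y where "Y n \<omega> = (\<Sum>v<n. g (comp_at n (G n \<omega>) v)) / real n" for n \<omega>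
  have "gs_bcont g" unfolding g_def[abs_def] by (rule gs_bcont_local_mean[OF K(1)])
  then obtain r where r: "(\<lambda>n. expectation (\<lambda>\<omega>. \<bar>Y n \<omega> - r\<bar>)) \<longlonglongrightarrow> 0" using G_local unfolding Y_def by blast
  have Yi: "integrable M (Y n)" for n unfolding Y_def using integrable_G[of "\<lambda>A. (\<Sum>v<n. g (comp_at n A v)) / real n" n] .
  have "expectation (\<lambda>\<omega>. \<bar>mean_ramp a b n (G n \<omega>) - Y n \<omega>\<bar>) \<le> \<epsilon>" if n: "n > 0" for n
  proof -
    have "expectation (\<lambda>\<omega>. \<bar>mean_ramp a b n (G n \<omega>) - Y n \<omega>\<bar>) \<le> expectation (\<lambda>\<omega>. \<epsilon> / 2 + 8 / (b - a) * tail_deg K n (G n \<omega>))"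
    proof (rule integral_mono_AE)
      show "integrable M (\<lambda>\<omega>. \<bar>mean_ramp a b n (G n \<omega>) - Y n \<omega>\<bar>)"
        by (intro integrable_abs Bochner_Integration.integrable_diff integrable_G Yi)
      show "integrable M (\<lambda>\<omega>. \<epsilon> / 2 + 8 / (b - a) * tail_deg K n (G n \<omega>))"
        using integrable_G[of "\<lambda>A. \<epsilon> / 2 + 8 / (b - a) * tail_deg K n A" n] .
      show "AE \<omega> in M. \<bar>mean_ramp a b n (G n \<omega>) - Y n \<omega>\<bar> \<le> \<epsilon> / 2 + 8 / (b - a) * tail_deg K n (G n \<omega>)"
        using G_int[of n]
      proof eventually_elim
        case (elim \<omega>)
        then show ?case unfolding mean_ramp_def Y_def g_def tail_deg_def
          by (intro ramp_stat_mean_approx[OF G_simple _ ab n K(1) p]) auto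
      qed
    qed
    also have "\<dots> = \<epsilon> / 2 + 8 / (b - a) * expectation (\<lambda>\<omega>. tail_deg K n (G n \<omega>))"
      using integrable_G[of "tail_deg K n" n] by (simp add: prob_space)
    also have "\<dots> \<le> \<epsilon> / 2 + 8 / (b - a) * \<eta>"
      using K(2)[OF n] ab by (intro add_left_mono mult_left_mono) auto
    also have "\<dots> = \<epsilon>" using ab by (simp add: \<eta>_def)
    finally show ?thesis .
  qed
  then show "\<exists>Y c. (\<forall>n. integrable M (Y n)) \<and> (\<forall>n>0. expectation (\<lambda>\<omega>. \<bar>mean_ramp a b n (G n \<omega>) - Y n \<omega>\<bar>) \<le> \<epsilon>) \<and>
        (\<lambda>n. expectation (\<lambda>\<omega>. \<bar>Y n \<omega> - c\<bar>)) \<longlonglongrightarrow> 0"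
    using Yi r by blast
qed

definition lim_ramp :: "real \<Rightarrow> real \<Rightarrow> real" where
  "lim_ramp a b = (SOME c. (\<lambda>n. expectation (\<lambda>\<omega>. \<bar>mean_ramp a b n (G n \<omega>) - c\<bar>)) \<longlonglongrightarrow> 0)"

lemma lim_ramp:
  assumes "a < b"
  shows "(\<lambda>n. expectation (\<lambda>\<omega>. \<bar>mean_ramp a b n (G n \<omega>) - lim_ramp a b\<bar>)) \<longlonglongrightarrow> 0"
  unfolding lim_ramp_def by (rule someI_ex[OF mean_ramp_converges[OF assms]])

lemma expectation_mean_ramp_tendsto:
  assumes "a < b"
  shows "(\<lambda>n. expectation (\<lambda>\<omega>. mean_ramp a b n (G n \<omega>))) \<longlonglongrightarrow> lim_ramp a b"
  by (rule tendsto_expectation_of_L1[OF integrable_G lim_ramp[OF assms]])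

text \<open>Bounds, monotonicity and the comparison with a point mass at 0 pass to the limit from
  finite \<open>n\<close>; the comparison is uniform in \<open>n\<close> because the mean degree is
  bounded.\<close>

lemma limit_distribution:
  "\<exists>\<nu>. real_distribution \<nu> \<and> (\<forall>x a b. x < a \<and> a < b \<longrightarrow> cdf \<nu> x \<le> lim_ramp a b) \<and> (\<forall>a b. a < b \<longrightarrow> lim_ramp a b \<le> cdf \<nu> b)"
proof -
  obtain C where C: "\<And>n. n > 0 \<Longrightarrow> expectation (\<lambda>\<omega>. mean_deg n (G n \<omega>)) \<le> C" using mean_deg_bounded by blast
  show ?thesis
  proof (rule distribution_from_ramp_limits[where C = "4 * C"])
    fix a b :: real assume ab: "a < b"
    have "0 \<le> mean_ramp a b n (G n \<omega>)" for n \<omega>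
      unfolding mean_ramp_def using ramp_stat_bounds[OF G_simple ab] by simp
    then have "0 \<le> expectation (\<lambda>\<omega>. mean_ramp a b n (G n \<omega>))" for n by simp
    then show "0 \<le> lim_ramp a b" by (intro LIMSEQ_le_const[OF expectation_mean_ramp_tendsto[OF ab]]) auto
    have "mean_ramp a b n (G n \<omega>) \<le> expectation (\<lambda>_. 1)" for n \<omega>
      unfolding mean_ramp_def by (intro integral_mono integrable_ramp_stat G_simple ab ramp_stat_bounds) simp
    then have "mean_ramp a b n (G n \<omega>) \<le> 1" for n \<omega> by (simp add: prob_space)
    then have "expectation (\<lambda>\<omega>. mean_ramp a b n (G n \<omega>)) \<le> expectation (\<lambda>_. 1)" for n
      by (intro integral_mono integrable_G) simp_all
    then show "lim_ramp a b \<le> 1"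
      by (intro LIMSEQ_le_const2[OF expectation_mean_ramp_tendsto[OF ab]]) (auto simp: prob_space)
    have "\<bar>expectation (\<lambda>\<omega>. mean_ramp a b n (G n \<omega>)) - ramp a b 0\<bar> \<le> 4 * C / (b - a)" if n: "n > 0" for n
    proof -
      have "\<bar>expectation (\<lambda>\<omega>. mean_ramp a b n (G n \<omega>)) - ramp a b 0\<bar> = \<bar>expectation (\<lambda>\<omega>. mean_ramp a b n (G n \<omega>) - ramp a b 0)\<bar>"
        using integrable_G by (simp add: prob_space)
      also have "\<dots> \<le> expectation (\<lambda>\<omega>. \<bar>mean_ramp a b n (G n \<omega>) - ramp a b 0\<bar>)" by (rule integral_abs_bound)
      also have "\<dots> \<le> expectation (\<lambda>\<omega>. 4 / (b - a) * mean_deg n (G n \<omega>))"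
      proof (rule integral_mono_AE)
        show "integrable M (\<lambda>\<omega>. \<bar>mean_ramp a b n (G n \<omega>) - ramp a b 0\<bar>)" using integrable_G by simp
        show "integrable M (\<lambda>\<omega>. 4 / (b - a) * mean_deg n (G n \<omega>))" by (intro integrable_mult_right integrable_G)
        show "AE \<omega> in M. \<bar>mean_ramp a b n (G n \<omega>) - ramp a b 0\<bar> \<le> 4 / (b - a) * mean_deg n (G n \<omega>)"
          using G_int[of n]
        proof eventually_elim
          case (elim \<omega>)
          then show ?case unfolding mean_ramp_def mean_deg_def by (intro ramp_stat_mean_near_zero[OF G_simple _ ab n]) auto
        qed
      qed
      also have "\<dots> = 4 / (b - a) * expectation (\<lambda>\<omega>. mean_deg n (G n \<omega>))" by simp
      also have "\<dots> \<le> 4 / (b - a) * C" using C[OF n] ab by (intro mult_left_mono) auto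
      finally show ?thesis by simp
    qed
    moreover have "(\<lambda>n. \<bar>expectation (\<lambda>\<omega>. mean_ramp a b n (G n \<omega>)) - ramp a b 0\<bar>) \<longlonglongrightarrow> \<bar>lim_ramp a b - ramp a b 0\<bar>"
      by (intro tendsto_intros expectation_mean_ramp_tendsto ab)
    ultimately show "\<bar>lim_ramp a b - ramp a b 0\<bar> \<le> 4 * C / (b - a)"
      by (intro LIMSEQ_le_const2[where X = "\<lambda>n. \<bar>expectation (\<lambda>\<omega>. mean_ramp a b n (G n \<omega>)) - ramp a b 0\<bar>"]) (auto intro!: exI[of _ 1])
    fix a' b' :: real assume ab': "b \<le> a'" "a' < b'"
    have "mean_ramp a b n (G n \<omega>) \<le> mean_ramp a' b' n (G n \<omega>)" for n \<omega>
      unfolding mean_ramp_def by (intro integral_mono integrable_ramp_stat G_simple ab ab' ramp_stat_mono)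
    then have "expectation (\<lambda>\<omega>. mean_ramp a b n (G n \<omega>)) \<le> expectation (\<lambda>\<omega>. mean_ramp a' b' n (G n \<omega>))" for n
      by (intro integral_mono integrable_G)
    then show "lim_ramp a b \<le> lim_ramp a' b'"
      by (intro LIMSEQ_le[OF expectation_mean_ramp_tendsto[OF ab] expectation_mean_ramp_tendsto[OF ab'(2)]]) auto
  qed
qed

end

section \<open>Convergence of the spectral measures\<close>

text \<open>Borel-Cantelli at each of the countably many levels 1 / (m + 1).\<close>

lemma (in iid_weights) ramp_stat_AE_concentration:
  fixes G :: "nat \<Rightarrow> nat \<Rightarrow> nat \<Rightarrow> bool"
  assumes G: "\<And>n. simple_graph_on n (G n)" and ab: "a < b" and C: "C > 0"
    and edges: "\<And>n. n > 0 \<Longrightarrow> card (edge_pairs (G n)) \<le> C * real n"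
  shows "AE \<omega> in M. (\<lambda>n. ramp_stat n (G n) a b \<omega> - expectation (ramp_stat n (G n) a b)) \<longlonglongrightarrow> 0"
proof -
  let ?Z = "\<lambda>n \<omega>. ramp_stat n (G n) a b \<omega> - expectation (ramp_stat n (G n) a b)"
  have "AE \<omega> in M. \<forall>\<^sub>F n in sequentially. \<bar>?Z n \<omega>\<bar> < 1 / real (Suc m)" for m
  proof -
    define e where "e = 1 / real (Suc m)"
    have e: "e > 0" by (simp add: e_def)
    define q where "q = exp (- (e\<^sup>2 / (8 * C)))"
    have q: "0 \<le> q" "q < 1" using e C by (auto simp: q_def)
    define B where "B n = {\<omega> \<in> space M. \<bar>?Z n \<omega>\<bar> \<ge> e}" for n
    have B: "B n \<in> events" for n
      unfolding B_def using measurable_ramp_stat[OF G ab] by measurable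
    have "summable (\<lambda>n. prob (B n))"
    proof (rule summable_comparison_test_ev)
      show "summable (\<lambda>n. 2 * q ^ n)" using q by (intro summable_mult summable_geometric) auto
      show "\<forall>\<^sub>F n in sequentially. norm (prob (B n)) \<le> 2 * q ^ n"
        using eventually_gt_at_top[of 0]
      proof eventually_elim
        case (elim n)
        then show ?case unfolding B_def q_def using ramp_stat_tail[OF G ab elim C edges[OF elim] e] by simp
      qed
    qed
    then have "AE \<omega> in M. \<forall>\<^sub>F n in sequentially. \<omega> \<in> space M - B n"
      by (intro borel_cantelli_AE1 B) (auto simp: emeasure_eq_measure)
    then show ?thesis
    proof eventually_elim
      case (elim \<omega>)
      then show ?case by eventually_elim (auto simp: B_def e_def)
    qed
  qed
  then have "AE \<omega> in M. \<forall>m. \<forall>\<^sub>F n in sequentially. \<bar>?Z n \<omega>\<bar> < 1 / real (Suc m)" by (simp add: AE_all_countable)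
  then show ?thesis
  proof eventually_elim
    case (elim \<omega>)
    show ?case
    proof (rule tendstoI)
      fix e :: real assume "e > 0"
      then obtain m where m: "1 / real (Suc m) < e" using nat_approx_posE by blast
      show "\<forall>\<^sub>F n in sequentially. dist (?Z n \<omega>) 0 < e"
        using spec[OF elim, of m] by eventually_elim (use m in auto)
    qed
  qed
qed

lemma (in converging_graphs) esd_AE_weak_conv:
  assumes const: "\<And>n \<omega>. G n \<omega> = H n"
  shows "\<exists>\<nu>. prob_space \<nu> \<and> sets \<nu> = sets borel \<and> (AE \<omega> in M. weak_conv_m (\<lambda>n. esd n (Delta \<alpha> n (w \<omega>) (H n))) \<nu>)"
proof -
  have H: "simple_graph_on n (H n)" for n using G_simple[of n undefined] const by simp
  have Hi: "integrable M (\<lambda>\<omega>. wdeg n (w \<omega>) (H n) v)" if "v < n" for n v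
    using G_int[of n] that by (simp add: const AE_const)
  obtain \<nu> where nu: "real_distribution \<nu>" and lo: "\<And>x a b. x < a \<Longrightarrow> a < b \<Longrightarrow> cdf \<nu> x \<le> lim_ramp a b"
    and up: "\<And>a b. a < b \<Longrightarrow> lim_ramp a b \<le> cdf \<nu> b" using limit_distribution by blast
  have mean: "(\<lambda>n. expectation (ramp_stat n (H n) a b)) \<longlonglongrightarrow> lim_ramp a b" if "a < b" for a b
    using expectation_mean_ramp_tendsto[OF that] by (simp add: const mean_ramp_def prob_space)
  have conc: "AE \<omega> in M. (\<lambda>n. ramp_stat n (H n) a b \<omega> - expectation (ramp_stat n (H n) a b)) \<longlonglongrightarrow> 0" if ab: "a < b" for a b
  proof (cases "mean_abs = 0")
    case False
    then have k: "mean_abs > 0" using mean_abs_nonneg by simp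
    obtain C where C: "\<And>n. n > 0 \<Longrightarrow> mean_deg n (H n) \<le> C"
      using mean_deg_bounded by (auto simp: const prob_space)
    \<comment> \<open>The added 1 makes the constant positive, as the tail bound requires.\<close>
    have edges: "card (edge_pairs (H n)) \<le> (\<bar>C\<bar> / mean_abs + 1) * real n" if n: "n > 0" for n
    proof -
      have "mean_abs * card (edge_pairs (H n)) \<le> real n * mean_deg n (H n)"
        using mean_abs_edges_le[OF H Hi] n by (simp add: mean_deg_def)
      also have "\<dots> \<le> real n * \<bar>C\<bar>" using C[OF n] by (intro mult_left_mono) auto
      finally have "card (edge_pairs (H n)) \<le> real n * \<bar>C\<bar> / mean_abs" using k by (simp add: field_simps)
      also have "\<dots> \<le> (\<bar>C\<bar> / mean_abs + 1) * real n" by (simp add: algebra_simps)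
      finally show ?thesis .
    qed
    have "\<bar>C\<bar> / mean_abs + 1 > 0" using k by (simp add: add_nonneg_pos)
    then show ?thesis by (rule ramp_stat_AE_concentration[OF H ab _ edges])
  next
    case True
    have "AE \<omega> in M. n > 0 \<longrightarrow> ramp_stat n (H n) a b \<omega> - expectation (ramp_stat n (H n) a b) = 0" for n
    proof (cases "n > 0")
      case n: True
      have ae: "AE \<omega> in M. ramp_stat n (H n) a b \<omega> = ramp a b 0" by (rule ramp_stat_degenerate[OF H Hi True n])
      then have "expectation (ramp_stat n (H n) a b) = expectation (\<lambda>_. ramp a b 0)"
        using measurable_ramp_stat[OF H ab] by (intro integral_cong_AE) auto
      then show ?thesis using ae by (auto simp: prob_space)
    qed simp
    then have "AE \<omega> in M. \<forall>n. n > 0 \<longrightarrow> ramp_stat n (H n) a b \<omega> - expectation (ramp_stat n (H n) a b) = 0"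
      by (simp add: AE_all_countable)
    then show ?thesis
    proof eventually_elim
      case (elim \<omega>)
      have "\<forall>\<^sub>F n in sequentially. ramp_stat n (H n) a b \<omega> - expectation (ramp_stat n (H n) a b) = 0"
        using eventually_gt_at_top[of 0] by eventually_elim (use elim in auto)
      then show ?case by (rule tendsto_eventually)
    qed
  qed
  \<comment> \<open>Countability of the rational pairs gives a single null set for all ramps that
    are needed.\<close>
  have "AE \<omega> in M. \<forall>p\<in>{p \<in> \<rat> \<times> \<rat>. fst p < snd p}. (\<lambda>n. ramp_stat n (H n) (fst p) (snd p) \<omega>) \<longlonglongrightarrow> lim_ramp (fst p) (snd p)"
  proof (subst AE_ball_countable)
    show "countable {p \<in> \<rat> \<times> \<rat>. fst p < (snd p :: real)}"
      by (rule countable_subset[of _ "\<rat> \<times> \<rat>"]) (auto intro: countable_rat)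
    show "\<forall>p\<in>{p \<in> \<rat> \<times> \<rat>. fst p < snd p}. AE \<omega> in M. (\<lambda>n. ramp_stat n (H n) (fst p) (snd p) \<omega>) \<longlonglongrightarrow> lim_ramp (fst p) (snd p)"
    proof
      fix p :: "real \<times> real" assume "p \<in> {p \<in> \<rat> \<times> \<rat>. fst p < snd p}"
      then have p: "fst p < snd p" by simp
      show "AE \<omega> in M. (\<lambda>n. ramp_stat n (H n) (fst p) (snd p) \<omega>) \<longlonglongrightarrow> lim_ramp (fst p) (snd p)"
        using conc[OF p]
      proof eventually_elim
        case (elim \<omega>)
        from tendsto_add[OF elim mean[OF p]] show ?case by simp
      qed
    qed
  qed
  then have "AE \<omega> in M. weak_conv_m (\<lambda>n. esd n (Delta \<alpha> n (w \<omega>) (H n))) \<nu>"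
  proof eventually_elim
    case (elim \<omega>)
    show ?case
    proof (rule weak_conv_m_from_ramps[OF nu lo up, where R = "\<lambda>n a b. ramp_stat n (H n) a b \<omega>"])
      show "measure (esd n (Delta \<alpha> n (w \<omega>) (H n))) {..a} \<le> ramp_stat n (H n) a b \<omega> \<and>
          ramp_stat n (H n) a b \<omega> \<le> measure (esd n (Delta \<alpha> n (w \<omega>) (H n))) {..b}" if "n > 0" "a < b" for n a b
        unfolding ramp_stat_def using esd_cdf_bounds(1,2)[of "Delta \<alpha> n (w \<omega>) (H n)", OF Delta_w_sym[OF H] that] by simp
    qed (use elim in auto)
  qed
  then show ?thesis using nu by (intro exI[of _ \<nu>]) (auto simp: real_distribution_def real_distribution_axioms_def)
qed

text \<open>Either all grid errors are at most \<delta> and the distance is at most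
  \<open>4 * \<delta>\<close>, or their sum divided by \<delta> exceeds 1, which bounds the distance
  anyway. In both cases finitely many L1 errors control the mean.\<close>

lemma (in converging_graphs) levy_dist_tendsto:
  assumes conv: "\<And>a b. a < b \<Longrightarrow> (\<lambda>n. expectation (\<lambda>\<omega>. \<bar>ramp_stat n (G n \<omega>) a b \<omega> - lim_ramp a b\<bar>)) \<longlonglongrightarrow> 0"
    and int: "\<And>n a b. a < b \<Longrightarrow> integrable M (\<lambda>\<omega>. ramp_stat n (G n \<omega>) a b \<omega>)"
  shows "\<exists>\<nu>. prob_space \<nu> \<and> sets \<nu> = sets borel \<and>
    (\<lambda>n. expectation (\<lambda>\<omega>. levy_dist (esd n (Delta \<alpha> n (w \<omega>) (G n \<omega>))) \<nu>)) \<longlonglongrightarrow> 0"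
proof -
  obtain \<nu> where nu: "real_distribution \<nu>" and lo: "\<And>x a b. x < a \<Longrightarrow> a < b \<Longrightarrow> cdf \<nu> x \<le> lim_ramp a b"
    and up: "\<And>a b. a < b \<Longrightarrow> lim_ramp a b \<le> cdf \<nu> b" using limit_distribution by blast
  interpret \<nu>: real_distribution \<nu> by fact
  define L where "L n \<omega> = levy_dist (esd n (Delta \<alpha> n (w \<omega>) (G n \<omega>))) \<nu>" for n \<omega>
  have pe: "prob_space (esd n A)" for n A unfolding esd_def by (rule prob_space_measure_pmf)
  have L: "0 \<le> L n \<omega>" "L n \<omega> \<le> 1" for n \<omega> unfolding L_def using levy_dist_bounds[OF pe \<nu>.prob_space_axioms] by auto
  have "(\<lambda>n. expectation (L n)) \<longlonglongrightarrow> 0"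
  proof (rule LIMSEQ_I)
    fix e :: real assume e: "e > 0"
    define \<delta> where "\<delta> = e / 8"
    have \<delta>: "\<delta> > 0" using e by (simp add: \<delta>_def)
    have "\<forall>\<^sub>F x in at_bot. cdf \<nu> x < \<delta>" using order_tendstoD(2)[OF \<nu>.cdf_lim_at_bot] \<delta> by blast
    then obtain x0 where x0: "\<And>x. x \<le> x0 \<Longrightarrow> cdf \<nu> x < \<delta>" by (auto simp: eventually_at_bot_linorder)
    have "\<forall>\<^sub>F x in at_top. 1 - \<delta> < cdf \<nu> x" using order_tendstoD(1)[OF \<nu>.cdf_lim_at_top_prob] \<delta> by simp
    then obtain x1 where x1: "\<And>x. x \<ge> x1 \<Longrightarrow> 1 - \<delta> < cdf \<nu> x" by (auto simp: eventually_at_top_linorder)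
    \<comment> \<open>The grid reaches past \<open>x0\<close> and \<open>x1\<close>, where the limit
      distribution is within \<delta> of 0 and of 1.\<close>
    define N where "N = 1 + \<lceil>(\<bar>x0\<bar> + \<bar>x1\<bar>) / \<delta>\<rceil>"
    have N1: "(\<bar>x0\<bar> + \<bar>x1\<bar>) / \<delta> \<le> N - 1" by (simp add: N_def)
    have "0 \<le> (\<bar>x0\<bar> + \<bar>x1\<bar>) / \<delta>" using \<delta> by simp
    then have N0: "N \<ge> 0" using N1 by linarith
    have N2: "\<bar>x0\<bar> + \<bar>x1\<bar> \<le> (N - 1) * \<delta>" using N1 \<delta> by (simp add: pos_divide_le_eq)
    have "(1 - N) * \<delta> = - ((N - 1) * \<delta>)" by (simp add: algebra_simps)
    then have "(1 - N) * \<delta> \<le> x0" using N2 by linarith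
    then have Na: "cdf \<nu> ((1 - N) * \<delta>) \<le> \<delta>" by (rule less_imp_le[OF x0])
    have "x1 \<le> (N - 1) * \<delta>" using N2 by linarith
    then have Nb: "1 - \<delta> \<le> cdf \<nu> ((N - 1) * \<delta>)" by (rule less_imp_le[OF x1])
    define D where "D n j \<omega> = \<bar>ramp_stat n (G n \<omega>) (j * \<delta>) ((j + 1) * \<delta>) \<omega> - lim_ramp (j * \<delta>) ((j + 1) * \<delta>)\<bar>" for n \<omega> and j :: int
    have st: "real_of_int j * \<delta> < real_of_int (j + 1) * \<delta>" for j using \<delta> by (simp add: algebra_simps)
    have Di: "integrable M (D n j)" for n j
      unfolding D_def by (rule integrable_abs, rule Bochner_Integration.integrable_diff[OF int[OF st]]) simp
    have LD: "L n \<omega> \<le> 4 * \<delta> + (\<Sum>j\<in>{-N..N}. D n j \<omega>) / \<delta>" if n: "n > 0" for n \<omega>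
    proof (cases "\<forall>j\<in>{-N..N}. D n j \<omega> \<le> \<delta>")
      case True
      have "L n \<omega> \<le> 4 * \<delta>"
        unfolding L_def
      proof (rule levy_dist_le_grid[OF pe nu lo up _ _ \<delta> Na Nb N0, where R = "\<lambda>a b. ramp_stat n (G n \<omega>) a b \<omega>"])
        note bd = esd_cdf_bounds(1,2)[of "Delta \<alpha> n (w \<omega>) (G n \<omega>)", OF Delta_w_sym[OF G_simple] n]
        show "measure (esd n (Delta \<alpha> n (w \<omega>) (G n \<omega>))) {..a} \<le> ramp_stat n (G n \<omega>) a b \<omega>"
          "ramp_stat n (G n \<omega>) a b \<omega> \<le> measure (esd n (Delta \<alpha> n (w \<omega>) (G n \<omega>))) {..b}" if "a < b" for a b
          unfolding ramp_stat_def using bd[OF that] by auto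
        show "\<bar>ramp_stat n (G n \<omega>) (j * \<delta>) ((j + 1) * \<delta>) \<omega> - lim_ramp (j * \<delta>) ((j + 1) * \<delta>)\<bar> \<le> \<delta>" if "j \<in> {-N..N}" for j
          using True that by (simp add: D_def)
      qed
      moreover have "0 \<le> (\<Sum>j\<in>{-N..N}. D n j \<omega>) / \<delta>" using \<delta> by (intro divide_nonneg_pos sum_nonneg) (auto simp: D_def)
      ultimately show ?thesis by simp
    next
      case False
      then obtain j where j: "j \<in> {-N..N}" "D n j \<omega> > \<delta>" by force
      have "D n j \<omega> \<le> (\<Sum>j\<in>{-N..N}. D n j \<omega>)" using j(1) by (intro member_le_sum) (auto simp: D_def)
      then have "1 \<le> (\<Sum>j\<in>{-N..N}. D n j \<omega>) / \<delta>" using j(2) \<delta> by (simp add: pos_le_divide_eq)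
      then show ?thesis using L(2)[of n \<omega>] \<delta> by linarith
    qed
    have EL: "expectation (L n) \<le> 4 * \<delta> + (\<Sum>j\<in>{-N..N}. expectation (D n j)) / \<delta>" if n: "n > 0" for n
    \<comment> \<open>A function that is not integrable has integral 0 by convention, and the bound
      is nonnegative, so it holds in that case too.\<close>
    proof (cases "integrable M (L n)")
      case True
      have "expectation (L n) \<le> expectation (\<lambda>\<omega>. 4 * \<delta> + (\<Sum>j\<in>{-N..N}. D n j \<omega>) / \<delta>)"
        by (intro integral_mono True LD n Bochner_Integration.integrable_add integrable_divide Bochner_Integration.integrable_sum Di) simp
      also have "\<dots> = 4 * \<delta> + (\<Sum>j\<in>{-N..N}. expectation (D n j)) / \<delta>"
        using Di by (simp add: prob_space)
      finally show ?thesis .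
    next
      case False
      then have "expectation (L n) = 0" by (rule not_integrable_integral_eq)
      moreover have "0 \<le> (\<Sum>j\<in>{-N..N}. expectation (D n j)) / \<delta>"
        using \<delta> by (intro divide_nonneg_pos sum_nonneg) (auto simp: D_def)
      ultimately show ?thesis using \<delta> by simp
    qed
    have "(\<lambda>n. (\<Sum>j\<in>{-N..N}. expectation (D n j)) / \<delta>) \<longlonglongrightarrow> (\<Sum>j\<in>{-N..N}. 0) / \<delta>"
      unfolding D_def using \<delta> st by (intro tendsto_divide tendsto_sum conv tendsto_const) auto
    then have "\<forall>\<^sub>F n in sequentially. (\<Sum>j\<in>{-N..N}. expectation (D n j)) / \<delta> < \<delta>"
      using \<delta> by (intro order_tendstoD(2)) auto
    then have "\<forall>\<^sub>F n in sequentially. norm (expectation (L n) - 0) < e"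
      using eventually_gt_at_top[of 0]
    proof eventually_elim
      case (elim n)
      have "0 \<le> expectation (L n)" using L by simp
      then show ?case using EL[OF elim(2)] elim(1) \<delta> by (simp add: \<delta>_def)
    qed
    then show "\<exists>no. \<forall>n\<ge>no. norm (expectation (L n) - 0) < e" by (simp add: eventually_sequentially)
  qed
  then show ?thesis using nu unfolding L_def
    by (intro exI[of _ \<nu>]) (auto simp: real_distribution_def real_distribution_axioms_def)
qed

section \<open>From two-root convergence to local averages that converge in mean\<close>

lemma measurable_gs_bcont:
  assumes f: "gs_bcont f" and \<rho>: "sets \<rho> = sets gs_borel"
  shows "f \<in> borel_measurable \<rho>" "\<exists>B\<ge>0. \<forall>x\<in>space \<rho>. \<bar>f x\<bar> \<le> B"
proof -
  have sub: "{U. gs_open U} \<subseteq> Pow Gstar" by (auto simp: gs_open_def)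
  have sp: "space \<rho> = Gstar" using sets_eq_imp_space_eq[OF \<rho>] by (simp add: gs_borel_def sub)
  have "{x \<in> Gstar. a < f x} \<in> sets \<rho>" for a
  proof -
    have "gs_open {x \<in> Gstar. a < f x}"
      unfolding gs_open_def
    proof (intro conjI ballI)
      fix x assume x: "x \<in> {x \<in> Gstar. a < f x}"
      then obtain d where "d > 0" "\<And>y. y \<in> Gstar \<Longrightarrow> ldist x y < d \<Longrightarrow> \<bar>f y - f x\<bar> < f x - a"
        using f unfolding gs_bcont_def by (metis (no_types, lifting) diff_gt_0_iff_gt mem_Collect_eq)
      then show "\<exists>e>0. \<forall>y\<in>Gstar. ldist x y < e \<longrightarrow> y \<in> {x \<in> Gstar. a < f x}"
        by (intro exI[of _ d]) force
    qed auto
    then show ?thesis unfolding \<rho> gs_borel_def by (simp add: sub)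
  qed
  then show "f \<in> borel_measurable \<rho>" by (simp add: borel_measurable_iff_greater sp)
  obtain B where "\<forall>x\<in>Gstar. \<bar>f x\<bar> \<le> B" using f by (auto simp: gs_bcont_def)
  then show "\<exists>B\<ge>0. \<forall>x\<in>space \<rho>. \<bar>f x\<bar> \<le> B" unfolding sp by (intro exI[of _ "max B 0"]) force
qed

lemma gs_bcont_const: "gs_bcont (\<lambda>_. c)"
  unfolding gs_bcont_def by (auto intro: exI[of _ "\<bar>c\<bar>"] exI[of _ 1])

text \<open>Products of this form are the test functions from which the moments of local averages
  are read off.\<close>

lemma gs2_bcont_mult:
  assumes f: "gs_bcont f" and g: "gs_bcont g"
  shows "gs2_bcont (\<lambda>z. f (fst z) * g (snd z))"
proof -
  obtain B where B: "\<And>x. x \<in> Gstar \<Longrightarrow> \<bar>f x\<bar> \<le> B" using f unfolding gs_bcont_def by blast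
  obtain B' where B': "\<And>x. x \<in> Gstar \<Longrightarrow> \<bar>g x\<bar> \<le> B'" using g unfolding gs_bcont_def by blast
  define C where "C = max (max B B') 1"
  have C: "C \<ge> 1" "\<bar>f x\<bar> \<le> C" "\<bar>g x\<bar> \<le> C" if "x \<in> Gstar" for x using B[OF that] B'[OF that] by (auto simp: C_def)
  have C1: "C \<ge> 1" by (simp add: C_def)
  show ?thesis unfolding gs2_bcont_def
  proof (intro conjI ballI allI impI)
    show "\<exists>B. \<forall>x\<in>Gstar \<times> Gstar. \<bar>f (fst x) * g (snd x)\<bar> \<le> B"
    proof (intro exI[of _ "C * C"] ballI)
      fix x assume "x \<in> Gstar \<times> Gstar"
      then have "fst x \<in> Gstar" "snd x \<in> Gstar" by auto
      then show "\<bar>f (fst x) * g (snd x)\<bar> \<le> C * C" unfolding abs_mult using C C1 by (intro mult_mono) auto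
    qed
    fix x :: "rgraph \<times> rgraph" and e :: real assume x: "x \<in> Gstar \<times> Gstar" and e: "e > 0"
    then have x12: "fst x \<in> Gstar" "snd x \<in> Gstar" by auto
    have e': "e / (2 * C) > 0" using e C1 by simp
    obtain d1 where d1: "d1 > 0" "\<And>y. y \<in> Gstar \<Longrightarrow> ldist (fst x) y < d1 \<Longrightarrow> \<bar>f y - f (fst x)\<bar> < e / (2 * C)"
      using f x12(1) e' unfolding gs_bcont_def by blast
    obtain d2 where d2: "d2 > 0" "\<And>y. y \<in> Gstar \<Longrightarrow> ldist (snd x) y < d2 \<Longrightarrow> \<bar>g y - g (snd x)\<bar> < e / (2 * C)"
      using g x12(2) e' unfolding gs_bcont_def by blast
    show "\<exists>d>0. \<forall>y\<in>Gstar \<times> Gstar. max (ldist (fst x) (fst y)) (ldist (snd x) (snd y)) < d \<longrightarrow>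
         \<bar>f (fst y) * g (snd y) - f (fst x) * g (snd x)\<bar> < e"
    proof (intro exI[of _ "min d1 d2"] conjI ballI impI)
      fix y assume y: "y \<in> Gstar \<times> Gstar" and d: "max (ldist (fst x) (fst y)) (ldist (snd x) (snd y)) < min d1 d2"
      have y12: "fst y \<in> Gstar" "snd y \<in> Gstar" using y by auto
      have 1: "\<bar>f (fst y) - f (fst x)\<bar> < e / (2 * C)" using d1(2)[OF y12(1)] d by simp
      have 2: "\<bar>g (snd y) - g (snd x)\<bar> < e / (2 * C)" using d2(2)[OF y12(2)] d by simp
      have "\<bar>f (fst y) * g (snd y) - f (fst x) * g (snd x)\<bar>
          = \<bar>(f (fst y) - f (fst x)) * g (snd y) + f (fst x) * (g (snd y) - g (snd x))\<bar>" by (simp add: algebra_simps)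
      also have "\<dots> \<le> \<bar>f (fst y) - f (fst x)\<bar> * \<bar>g (snd y)\<bar> + \<bar>f (fst x)\<bar> * \<bar>g (snd y) - g (snd x)\<bar>"
        by (rule order_trans[OF abs_triangle_ineq]) (simp add: abs_mult)
      also have "\<dots> \<le> \<bar>f (fst y) - f (fst x)\<bar> * C + C * \<bar>g (snd y) - g (snd x)\<bar>"
        using C(2)[OF x12(1)] C(3)[OF y12(2)] by (intro add_mono mult_left_mono mult_right_mono) auto
      also have "\<dots> < (e / (2 * C)) * C + C * (e / (2 * C))"
        using 1 2 C1 by (intro add_strict_mono mult_strict_right_mono mult_strict_left_mono) auto
      also have "\<dots> = e" using C1 by simp
      finally show "\<bar>f (fst y) * g (snd y) - f (fst x) * g (snd x)\<bar> < e" .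
    qed (use d1 d2 in auto)
  qed
qed

lemma integral_gs_bcont_mult:
  assumes f: "gs_bcont f" and g: "gs_bcont g" and \<rho>: "prob_space \<rho>" "sets \<rho> = sets gs_borel"
  shows "(\<integral>z. f (fst z) * g (snd z) \<partial>(\<rho> \<Otimes>\<^sub>M \<rho>)) = (\<integral>x. f x \<partial>\<rho>) * (\<integral>x. g x \<partial>\<rho>)"
proof -
  interpret \<rho>: prob_space \<rho> by fact
  interpret P: pair_prob_space \<rho> \<rho> by unfold_locales
  note [measurable] = measurable_gs_bcont(1)[OF f \<rho>(2)] measurable_gs_bcont(1)[OF g \<rho>(2)]
  obtain B where B: "B \<ge> 0" "\<forall>x\<in>space \<rho>. \<bar>f x\<bar> \<le> B" using measurable_gs_bcont(2)[OF f \<rho>(2)] by blast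
  obtain B' where B': "B' \<ge> 0" "\<forall>x\<in>space \<rho>. \<bar>g x\<bar> \<le> B'" using measurable_gs_bcont(2)[OF g \<rho>(2)] by blast
  have "integrable (\<rho> \<Otimes>\<^sub>M \<rho>) (\<lambda>z. f (fst z) * g (snd z))"
  proof (rule P.integrable_const_bound[of _ "B * B'"])
    show "AE z in \<rho> \<Otimes>\<^sub>M \<rho>. norm (f (fst z) * g (snd z)) \<le> B * B'"
      using B B' by (intro AE_I2) (auto simp: space_pair_measure abs_mult intro!: mult_mono)
  qed measurable
  then have "(\<integral>z. f (fst z) * g (snd z) \<partial>(\<rho> \<Otimes>\<^sub>M \<rho>)) = (\<integral>x. \<integral>y. f x * g y \<partial>\<rho> \<partial>\<rho>)"
    by (subst P.integral_fst'[symmetric]) simp_all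
  then show ?thesis by simp
qed

text \<open>The variance of |X| is nonnegative.\<close>

lemma (in prob_space) L1_le_sqrt_L2:
  fixes X :: "'a \<Rightarrow> real"
  assumes X: "integrable M X" "integrable M (\<lambda>\<omega>. (X \<omega>)\<^sup>2)"
  shows "expectation (\<lambda>\<omega>. \<bar>X \<omega>\<bar>) \<le> sqrt (expectation (\<lambda>\<omega>. (X \<omega>)\<^sup>2))"
proof -
  have "0 \<le> variance (\<lambda>\<omega>. \<bar>X \<omega>\<bar>)" by (rule variance_positive)
  also have "\<dots> = expectation (\<lambda>\<omega>. (X \<omega>)\<^sup>2) - (expectation (\<lambda>\<omega>. \<bar>X \<omega>\<bar>))\<^sup>2"
    using X by (subst variance_eq) auto
  finally show ?thesis by (intro real_le_rsqrt) simp
qed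

text \<open>The test functions f(x) f(y) and f(x) give the second and the first moment of the
  average of \<open>f\<close> over the vertices. With limits r^2 and r, the mean squared distance to
  r tends to 0.\<close>

lemma local_conv2_imp_L1:
  fixes G :: "nat \<Rightarrow> 'a \<Rightarrow> nat \<Rightarrow> nat \<Rightarrow> bool"
  assumes M: "prob_space M" and \<rho>: "prob_space \<rho>" "sets \<rho> = sets gs_borel" and lc: "local_conv2 M G \<rho>"
    and f: "gs_bcont f" and int: "\<And>n h. integrable M (\<lambda>\<omega>. h (G n \<omega>) :: real)"
  shows "\<exists>r. (\<lambda>n. \<integral>\<omega>. \<bar>(\<Sum>v<n. f (comp_at n (G n \<omega>) v)) / real n - r\<bar> \<partial>M) \<longlonglongrightarrow> 0"
proof -
  interpret prob_space M by fact
  interpret \<rho>: prob_space \<rho> by fact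
  define u where "u n A = (\<Sum>v<n. f (comp_at n A v)) / real n" for n A
  define r where "r = (\<integral>x. f x \<partial>\<rho>)"
  have lim: "(\<lambda>n. \<integral>\<omega>. (\<Sum>o1<n. \<Sum>o2<n. f (comp_at n (G n \<omega>) o1) * g (comp_at n (G n \<omega>) o2)) / (real n)\<^sup>2 \<partial>M)
      \<longlonglongrightarrow> r * (\<integral>x. g x \<partial>\<rho>)" if g: "gs_bcont g" for g
  proof -
    have "(\<lambda>n. \<integral>\<omega>. (\<Sum>o1<n. \<Sum>o2<n. (\<lambda>z. f (fst z) * g (snd z)) (comp_at n (G n \<omega>) o1, comp_at n (G n \<omega>) o2)) / (real n)\<^sup>2 \<partial>M)
       \<longlonglongrightarrow> (\<integral>z. f (fst z) * g (snd z) \<partial>(\<rho> \<Otimes>\<^sub>M \<rho>))"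
      using lc gs2_bcont_mult[OF f g] unfolding local_conv2_def by blast
    then show ?thesis by (simp add: integral_gs_bcont_mult[OF f g \<rho>] r_def)
  qed
  have "(\<lambda>n. expectation (\<lambda>\<omega>. (u n (G n \<omega>))\<^sup>2)) \<longlonglongrightarrow> r * r"
    using lim[OF f] by (simp add: u_def power_divide power2_eq_square sum_product r_def)
  moreover have "(\<lambda>n. expectation (\<lambda>\<omega>. u n (G n \<omega>))) \<longlonglongrightarrow> r"
  proof -
    have lim1: "(\<lambda>n. expectation (\<lambda>\<omega>. (\<Sum>o1<n. \<Sum>o2<n. f (comp_at n (G n \<omega>) o1) * 1) / (real n)\<^sup>2)) \<longlonglongrightarrow> r * (\<integral>x. 1 \<partial>\<rho>)"
      by (rule lim[OF gs_bcont_const])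
    \<comment> \<open>The second root is summed out, which cancels one factor
      \<open>n\<close>.\<close>
    have eq: "(\<Sum>o1<n. \<Sum>o2<n. f (comp_at n A o1) * 1) / (real n)\<^sup>2 = u n A" for n A
      by (simp add: u_def power2_eq_square flip: sum_distrib_left)
    show ?thesis using lim1 unfolding eq by (simp add: \<rho>.prob_space)
  qed
  ultimately have "(\<lambda>n. expectation (\<lambda>\<omega>. (u n (G n \<omega>))\<^sup>2) - 2 * r * expectation (\<lambda>\<omega>. u n (G n \<omega>)) + r * r) \<longlonglongrightarrow> r * r - 2 * r * r + r * r"
    by (intro tendsto_intros)
  moreover have "expectation (\<lambda>\<omega>. (u n (G n \<omega>) - r)\<^sup>2) = expectation (\<lambda>\<omega>. (u n (G n \<omega>))\<^sup>2) - 2 * r * expectation (\<lambda>\<omega>. u n (G n \<omega>)) + r * r" for n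
  proof -
    have "expectation (\<lambda>\<omega>. (u n (G n \<omega>) - r)\<^sup>2) = expectation (\<lambda>\<omega>. (u n (G n \<omega>))\<^sup>2 - 2 * r * u n (G n \<omega>) + r * r)"
      by (intro Bochner_Integration.integral_cong) (auto simp: power2_eq_square algebra_simps)
    then show ?thesis using int[of "\<lambda>A. (u n A)\<^sup>2" n] int[of "u n" n] by (simp add: prob_space)
  qed
  ultimately have "(\<lambda>n. expectation (\<lambda>\<omega>. (u n (G n \<omega>) - r)\<^sup>2)) \<longlonglongrightarrow> 0" by simp
  then have "(\<lambda>n. sqrt (expectation (\<lambda>\<omega>. (u n (G n \<omega>) - r)\<^sup>2))) \<longlonglongrightarrow> sqrt 0" by (rule tendsto_real_sqrt)
  then have sq: "(\<lambda>n. sqrt (expectation (\<lambda>\<omega>. (u n (G n \<omega>) - r)\<^sup>2))) \<longlonglongrightarrow> 0" by simp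
  have "(\<lambda>n. expectation (\<lambda>\<omega>. \<bar>u n (G n \<omega>) - r\<bar>)) \<longlonglongrightarrow> 0"
  proof (rule tendsto_sandwich[OF _ _ tendsto_const sq])
    show "\<forall>\<^sub>F n in sequentially. expectation (\<lambda>\<omega>. \<bar>u n (G n \<omega>) - r\<bar>) \<le> sqrt (expectation (\<lambda>\<omega>. (u n (G n \<omega>) - r)\<^sup>2))"
      using int[of "\<lambda>A. u _ A - r"] int[of "\<lambda>A. (u _ A - r)\<^sup>2"] by (intro always_eventually allI L1_le_sqrt_L2) auto
  qed simp
  then show ?thesis unfolding u_def by blast
qed

lemma (in iid_weights) levy_dist_random_graphs:
  fixes G :: "nat \<Rightarrow> 'a \<Rightarrow> nat \<Rightarrow> nat \<Rightarrow> bool"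
  assumes Gs: "\<And>n \<omega>. simple_graph_on n (G n \<omega>)" and Gm: "\<And>n. G n \<in> M \<rightarrow>\<^sub>M count_space UNIV"
    and ind: "indep_set
            (sets (vimage_algebra (space M) (\<lambda>\<omega> n. G n \<omega>) (PiM UNIV (\<lambda>_. count_space UNIV))))
            (sets (vimage_algebra (space M) (\<lambda>\<omega> p. w \<omega> (fst p) (snd p)) (PiM UNIV (\<lambda>_. borel))))"
    and int: "\<And>n v. v < n \<Longrightarrow> integrable M (\<lambda>\<omega>. wdeg n (w \<omega>) (G n \<omega>) v)"
    and ui: "\<And>\<epsilon>. \<epsilon> > 0 \<Longrightarrow> \<exists>K. \<forall>n>0. (\<Sum>v<n. expectation
             (\<lambda>\<omega>. if wdeg n (w \<omega>) (G n \<omega>) v > K then wdeg n (w \<omega>) (G n \<omega>) v else 0)) / real n < \<epsilon>"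
    and \<rho>: "prob_space \<rho>" "sets \<rho> = sets gs_borel" and lc: "local_conv2 M G \<rho>"
  shows "\<exists>\<nu>. prob_space \<nu> \<and> sets \<nu> = sets borel \<and>
    (\<lambda>n. expectation (\<lambda>\<omega>. levy_dist (esd n (Delta \<alpha> n (w \<omega>) (G n \<omega>))) \<nu>)) \<longlonglongrightarrow> 0"
proof -
  define wv where "wv \<omega> = (\<lambda>p. w \<omega> (fst p) (snd p))" for \<omega>
  define N where "N = vimage_algebra (space M) wv (PiM UNIV (\<lambda>_. borel :: real measure))"
  define F where "F = sets (vimage_algebra (space M) (\<lambda>\<omega> n. G n \<omega>) (PiM UNIV (\<lambda>_. count_space UNIV)))"
  have indN: "indep_set F (sets N)" using ind by (simp add: F_def N_def wv_def[abs_def])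
  have spN: "space N = space M" by (simp add: N_def)
  have "wv \<in> N \<rightarrow>\<^sub>M PiM UNIV (\<lambda>_. borel)" unfolding N_def by (rule measurable_vimage_algebra1) (auto simp: space_PiM)
  then have "(\<lambda>\<omega>. wv \<omega> (i, j)) \<in> borel_measurable N" for i j
    by (rule measurable_compose) (rule measurable_component_singleton, simp)
  then have wN: "(\<lambda>\<omega>. w \<omega> i j) \<in> borel_measurable N" for i j by (simp add: wv_def)
  have ev: "{\<omega> \<in> space M. G n \<omega> = A} \<in> F" for n A
  proof -
    have "(\<lambda>x. x n) \<in> PiM UNIV (\<lambda>_. count_space UNIV) \<rightarrow>\<^sub>M (count_space UNIV :: (nat \<Rightarrow> nat \<Rightarrow> bool) measure)"
      by (rule measurable_component_singleton) simp
    then have "(\<lambda>x. x n) -` {A} \<inter> space (PiM UNIV (\<lambda>_. count_space UNIV)) \<in> sets (PiM UNIV (\<lambda>_::nat. count_space UNIV))"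
      by (rule measurable_sets) simp
    then have "(\<lambda>\<omega> n. G n \<omega>) -` ((\<lambda>x. x n) -` {A} \<inter> space (PiM UNIV (\<lambda>_. count_space UNIV))) \<inter> space M \<in> F"
      unfolding F_def by (rule in_vimage_algebra)
    also have "(\<lambda>\<omega> n. G n \<omega>) -` ((\<lambda>x. x n) -` {A} \<inter> space (PiM UNIV (\<lambda>_. count_space UNIV))) \<inter> space M = {\<omega> \<in> space M. G n \<omega> = A}"
      by (auto simp: space_PiM)
    finally show ?thesis .
  qed
  \<comment> \<open>Only finitely many graphs occur for each \<open>n\<close>, so substituting the
    random graph preserves measurability.\<close>
  have GmS: "G n \<in> M \<rightarrow>\<^sub>M count_space {A. simple_graph_on n A}" for n
    using Gm[of n] Gs by (auto simp: measurable_def)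
  have comb: "(\<lambda>\<omega>. f (G n \<omega>) \<omega>) \<in> borel_measurable M"
    if "\<And>A. simple_graph_on n A \<Longrightarrow> f A \<in> borel_measurable M" for f :: "(nat \<Rightarrow> nat \<Rightarrow> bool) \<Rightarrow> 'a \<Rightarrow> real" and n
    by (rule measurable_compose_countable'[OF _ GmS countable_finite[OF finite_simple_graphs]]) (use that in auto)
  note dec = decouple_finite[OF indN spN ev Gm finite_simple_graphs]
  let ?t = "\<lambda>K n A v \<omega>. if wdeg n (w \<omega>) A v > K then wdeg n (w \<omega>) A v else 0"
  have tm: "?t K n A v \<in> borel_measurable N" for K n A v
  proof -
    note [measurable] = measurable_wdeg[of w N n A v, OF wN]
    show ?thesis by measurable
  qed
  have ti: "integrable M (\<lambda>\<omega>. ?t K n (G n \<omega>) v \<omega>)" if "v < n" for K n v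
    by (rule Bochner_Integration.integrable_bound[OF int[OF that]])
       (use borel_measurable_integrable[OF int[OF that]] in auto)
  have tdec: "expectation (\<lambda>\<omega>. expectation (?t K n (G n \<omega>) v)) = expectation (\<lambda>\<omega>. ?t K n (G n \<omega>) v \<omega>)" if "v < n" for K n v
    by (rule dec(2)[where f = "\<lambda>A. ?t K n A v"]) (use Gs tm ti[OF that] wdeg_nonneg in auto)
  have ig: "integrable M (\<lambda>\<omega>. h (G n \<omega>) :: real)" for h n by (rule integrable_graph_function[OF Gs Gm])
  interpret converging_graphs M w \<alpha> G
  proof
    show "simple_graph_on n (G n \<omega>)" for n \<omega> by (rule Gs)
    show "G n \<in> M \<rightarrow>\<^sub>M count_space UNIV" for n by (rule Gm)
    have "AE \<omega> in M. integrable M (\<lambda>\<omega>'. wdeg n (w \<omega>') (G n \<omega>) v)" if "v < n" for n v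
      by (rule dec(1)[where f = "\<lambda>A \<omega>. wdeg n (w \<omega>) A v"]) (use Gs measurable_wdeg[OF wN] int[OF that] wdeg_nonneg in auto)
    then have "AE \<omega> in M. v < n \<longrightarrow> integrable M (\<lambda>\<omega>'. wdeg n (w \<omega>') (G n \<omega>) v)" for n v
      by (cases "v < n") auto
    then show "AE \<omega> in M. \<forall>v<n. integrable M (\<lambda>\<omega>'. wdeg n (w \<omega>') (G n \<omega>) v)" for n
      by (simp add: AE_all_countable)
    fix \<epsilon> :: real assume "\<epsilon> > 0"
    then obtain K where K: "\<forall>n>0. (\<Sum>v<n. expectation (\<lambda>\<omega>. ?t K n (G n \<omega>) v \<omega>)) / real n < \<epsilon>" using ui by blast
    have "expectation (\<lambda>\<omega>. (\<Sum>v<n. expectation (?t K n (G n \<omega>) v)) / real n)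
        = (\<Sum>v<n. expectation (\<lambda>\<omega>. ?t K n (G n \<omega>) v \<omega>)) / real n" for n
    proof -
      have "expectation (\<lambda>\<omega>. (\<Sum>v<n. expectation (?t K n (G n \<omega>) v)) / real n)
          = (\<Sum>v<n. expectation (\<lambda>\<omega>. expectation (?t K n (G n \<omega>) v))) / real n"
        using ig[of "\<lambda>A. expectation (?t K n A v)" n for v]
        by (simp add: Bochner_Integration.integral_sum)
      also have "\<dots> = (\<Sum>v<n. expectation (\<lambda>\<omega>. ?t K n (G n \<omega>) v \<omega>)) / real n"
        by (intro arg_cong2[where f = "(/)"] sum.cong refl tdec) simp
      finally show ?thesis .
    qed
    note eq = this
    show "\<exists>K. \<forall>n>0. expectation (\<lambda>\<omega>. (\<Sum>v<n. expectation (?t K n (G n \<omega>) v)) / real n) < \<epsilon>"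
    proof (rule exI[of _ K], intro allI impI)
      fix n :: nat assume "n > 0"
      then have "(\<Sum>v<n. expectation (\<lambda>\<omega>. ?t K n (G n \<omega>) v \<omega>)) / real n < \<epsilon>" using K by blast
      then show "expectation (\<lambda>\<omega>. (\<Sum>v<n. expectation (?t K n (G n \<omega>) v)) / real n) < \<epsilon>"
        by (rule ord_eq_less_trans[OF eq])
    qed
  next
    show "\<exists>r. (\<lambda>n. expectation (\<lambda>\<omega>. \<bar>(\<Sum>v<n. f (comp_at n (G n \<omega>) v)) / real n - r\<bar>)) \<longlonglongrightarrow> 0" if "gs_bcont f" for f
      by (rule local_conv2_imp_L1[OF prob_space_axioms \<rho> lc that ig])
  qed
  have rm: "(\<lambda>\<omega>. ramp_stat n (G n \<omega>) a b \<omega>) \<in> borel_measurable M" if "a < b" for n a b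
    by (rule comb) (rule measurable_ramp_stat[OF _ that])
  have ri: "integrable M (\<lambda>\<omega>. ramp_stat n (G n \<omega>) a b \<omega>)" if "a < b" for n a b
    by (rule integrable_const_bound[of _ 1]) (use ramp_stat_bounds[OF Gs that] rm[OF that] in auto)
  show ?thesis
  proof (rule levy_dist_tendsto[OF _ ri])
    fix a b :: real assume ab: "a < b"
    obtain C where C: "\<And>n. n > 0 \<Longrightarrow> expectation (\<lambda>\<omega>. mean_deg n (G n \<omega>)) \<le> C" using mean_deg_bounded by blast
    \<comment> \<open>The fluctuation around the mean given the graph. It is measurable with respect
      to the weights for each fixed graph, so it can be decoupled.\<close>
    define d where "d n A \<omega> = \<bar>ramp_stat n A a b \<omega> - mean_ramp a b n A\<bar>" for n A \<omega>
    have d_nonneg: "0 \<le> d n A \<omega>" for n A \<omega> by (simp add: d_def)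
    have dN: "d n A \<in> borel_measurable N" if A: "simple_graph_on n A" for n A
      unfolding d_def ramp_stat_def
      by (intro borel_measurable_abs borel_measurable_diff borel_measurable_divide borel_measurable_const measurable_ramp_sum
          measurable_Delta wN Delta_w_sym A ab)
    have di: "integrable M (\<lambda>\<omega>. d n (G n \<omega>) \<omega>)" for n
      unfolding d_def by (intro integrable_abs Bochner_Integration.integrable_diff ri ab integrable_G)
    have bound: "expectation (\<lambda>\<omega>. d n (G n \<omega>) \<omega>) \<le> exp 2 * (C / mean_abs + 2) / sqrt (real n)" if n: "n > 0" for n
    proof -
      have "expectation (\<lambda>\<omega>. d n (G n \<omega>) \<omega>) = expectation (\<lambda>\<omega>. expectation (d n (G n \<omega>)))"
        by (rule dec(2)[symmetric]) (use Gs dN di d_nonneg in auto)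
      also have "\<dots> \<le> expectation (\<lambda>\<omega>. exp 2 * (mean_deg n (G n \<omega>) / mean_abs + 2) / sqrt (real n))"
      proof (rule integral_mono_AE[OF integrable_G])
        show "integrable M (\<lambda>\<omega>. exp 2 * (mean_deg n (G n \<omega>) / mean_abs + 2) / sqrt (real n))"
          using integrable_G[of "\<lambda>A. exp 2 * (mean_deg n A / mean_abs + 2) / sqrt (real n)" n] .
        show "AE \<omega> in M. expectation (d n (G n \<omega>)) \<le> exp 2 * (mean_deg n (G n \<omega>) / mean_abs + 2) / sqrt (real n)"
          using G_int[of n]
        proof eventually_elim
          case (elim \<omega>)
          let ?S = "\<Sum>v<n. expectation (\<lambda>\<omega>'. wdeg n (w \<omega>') (G n \<omega>) v)"
          have "expectation (d n (G n \<omega>)) \<le> exp 2 * (?S / mean_abs + 1 + real n) / (real n * sqrt (real n))"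
            unfolding d_def mean_ramp_def by (rule ramp_stat_L1[OF Gs _ ab n]) (use elim in auto)
          also have "\<dots> = exp 2 * (mean_deg n (G n \<omega>) / mean_abs + 1 / real n + 1) / sqrt (real n)"
          proof -
            have "?S / mean_abs + 1 + real n = real n * (mean_deg n (G n \<omega>) / mean_abs + 1 / real n + 1)"
              using n by (simp add: mean_deg_def distrib_left)
            then show ?thesis using n by simp
          qed
          also have "\<dots> \<le> exp 2 * (mean_deg n (G n \<omega>) / mean_abs + 2) / sqrt (real n)"
            using n by (intro divide_right_mono mult_left_mono) auto
          finally show ?case .
        qed
      qed
      also have "\<dots> = exp 2 * (expectation (\<lambda>\<omega>. mean_deg n (G n \<omega>)) / mean_abs + 2) / sqrt (real n)"
        using integrable_G[of "mean_deg n" n] by (simp add: prob_space)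
      also have "\<dots> \<le> exp 2 * (C / mean_abs + 2) / sqrt (real n)"
        using C[OF n] mean_abs_nonneg by (intro divide_right_mono mult_left_mono add_right_mono) auto
      finally show ?thesis .
    qed
    have lim0: "(\<lambda>n. exp 2 * (C / mean_abs + 2) / sqrt (real n)) \<longlonglongrightarrow> 0"
      by (intro tendsto_divide_0[OF tendsto_const] filterlim_at_top_imp_at_infinity
          filterlim_compose[OF sqrt_at_top filterlim_real_sequentially])
    have d0: "(\<lambda>n. expectation (\<lambda>\<omega>. d n (G n \<omega>) \<omega>)) \<longlonglongrightarrow> 0"
      by (rule tendsto_sandwich[OF _ _ tendsto_const lim0])
         (auto simp: d_def eventually_sequentially intro!: exI[of _ 1] bound[unfolded d_def])
    have sum0: "(\<lambda>n. expectation (\<lambda>\<omega>. d n (G n \<omega>) \<omega>) + expectation (\<lambda>\<omega>. \<bar>mean_ramp a b n (G n \<omega>) - lim_ramp a b\<bar>)) \<longlonglongrightarrow> 0"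
      using tendsto_add[OF d0 lim_ramp[OF ab]] by simp
    show "(\<lambda>n. expectation (\<lambda>\<omega>. \<bar>ramp_stat n (G n \<omega>) a b \<omega> - lim_ramp a b\<bar>)) \<longlonglongrightarrow> 0"
    proof (rule tendsto_sandwich[OF _ _ tendsto_const sum0])
      show "\<forall>\<^sub>F n in sequentially. expectation (\<lambda>\<omega>. \<bar>ramp_stat n (G n \<omega>) a b \<omega> - lim_ramp a b\<bar>)
         \<le> expectation (\<lambda>\<omega>. d n (G n \<omega>) \<omega>) + expectation (\<lambda>\<omega>. \<bar>mean_ramp a b n (G n \<omega>) - lim_ramp a b\<bar>)"
        unfolding d_def by (intro always_eventually allI L1_dist_triangle ri ab integrable_G)
    qed simp
  qed
qed

text \<open>Graphs that do not depend on \<omega> are a special case of the common setting: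
  expectations over the graph disappear, and local averages are plain numbers.\<close>

lemma (in iid_weights) esd_deterministic_graphs:
  fixes G :: "nat \<Rightarrow> nat \<Rightarrow> nat \<Rightarrow> bool"
  assumes Gs: "\<And>n. simple_graph_on n (G n)"
    and int: "\<And>n v. v < n \<Longrightarrow> integrable M (\<lambda>\<omega>. wdeg n (w \<omega>) (G n) v)"
    and ui: "\<And>\<epsilon>. \<epsilon> > 0 \<Longrightarrow> \<exists>K. \<forall>n>0. (\<Sum>v<n. expectation
             (\<lambda>\<omega>. if wdeg n (w \<omega>) (G n) v > K then wdeg n (w \<omega>) (G n) v else 0)) / real n < \<epsilon>"
    and lc: "local_conv G \<rho>"
  shows "\<exists>\<nu>. prob_space \<nu> \<and> sets \<nu> = sets borel \<and> (AE \<omega> in M. weak_conv_m (\<lambda>n. esd n (Delta \<alpha> n (w \<omega>) (G n))) \<nu>)"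
proof -
  interpret converging_graphs M w \<alpha> "\<lambda>n _. G n"
  proof
    fix f assume "gs_bcont f"
    then have "(\<lambda>n. (\<Sum>v<n. f (comp_at n (G n) v)) / real n) \<longlonglongrightarrow> (\<integral>x. f x \<partial>\<rho>)" using lc by (simp add: local_conv_def)
    then have "(\<lambda>n. \<bar>(\<Sum>v<n. f (comp_at n (G n) v)) / real n - (\<integral>x. f x \<partial>\<rho>)\<bar>) \<longlonglongrightarrow> 0"
      by (intro tendsto_rabs_zero LIM_zero)
    then show "\<exists>r. (\<lambda>n. expectation (\<lambda>\<omega>. \<bar>(\<Sum>v<n. f (comp_at n (G n) v)) / real n - r\<bar>)) \<longlonglongrightarrow> 0"
      by (intro exI[of _ "\<integral>x. f x \<partial>\<rho>"]) (simp add: prob_space)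
  qed (use Gs int ui in \<open>auto simp: prob_space\<close>)
  show ?thesis by (rule esd_AE_weak_conv) simp
qed

theorem theorem3:
  fixes M :: "'a measure" and w :: "'a \<Rightarrow> nat \<Rightarrow> nat \<Rightarrow> real" and \<alpha> :: real
  assumes "prob_space M"
    and "\<alpha> \<in> {0, 1}"
    and "\<forall>\<omega> i j. w \<omega> i j = w \<omega> j i"
    and "prob_space.indep_vars M (\<lambda>_. borel) (\<lambda>p \<omega>. w \<omega> (fst p) (snd p)) {p. fst p \<le> snd p}"
    and "\<forall>p\<in>{p. fst p \<le> snd p}. \<forall>q\<in>{p. fst p \<le> snd p}.
           distr M borel (\<lambda>\<omega>. w \<omega> (fst p) (snd p)) = distr M borel (\<lambda>\<omega>. w \<omega> (fst q) (snd q))"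
  shows
    "(\<forall>(G :: nat \<Rightarrow> nat \<Rightarrow> nat \<Rightarrow> bool) \<rho>.
        (\<forall>n. simple_graph_on n (G n))
      \<and> (\<forall>n. \<forall>v0<n. integrable M (\<lambda>\<omega>. wdeg n (w \<omega>) (G n) v0))
      \<and> (\<forall>\<epsilon>>0. \<exists>K. \<forall>n>0. (\<Sum>v0<n. prob_space.expectation M
             (\<lambda>\<omega>. if wdeg n (w \<omega>) (G n) v0 > K then wdeg n (w \<omega>) (G n) v0 else 0)) / real n < \<epsilon>)
      \<and> prob_space \<rho> \<and> sets \<rho> = sets gs_borel
      \<and> local_conv G \<rho>
      \<longrightarrow> (\<exists>\<nu>. prob_space \<nu> \<and> sets \<nu> = sets borel \<and>
             (AE \<omega> in M. weak_conv_m (\<lambda>n. esd n (Delta \<alpha> n (w \<omega>) (G n))) \<nu>)))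
   \<and> (\<forall>(G :: nat \<Rightarrow> 'a \<Rightarrow> nat \<Rightarrow> nat \<Rightarrow> bool) \<rho>.
        (\<forall>n \<omega>. simple_graph_on n (G n \<omega>))
      \<and> (\<forall>n. G n \<in> M \<rightarrow>\<^sub>M count_space UNIV)
      \<and> prob_space.indep_set M
            (sets (vimage_algebra (space M) (\<lambda>\<omega> n. G n \<omega>) (PiM UNIV (\<lambda>_. count_space UNIV))))
            (sets (vimage_algebra (space M) (\<lambda>\<omega> p. w \<omega> (fst p) (snd p)) (PiM UNIV (\<lambda>_. borel))))
      \<and> (\<forall>n. \<forall>v0<n. integrable M (\<lambda>\<omega>. wdeg n (w \<omega>) (G n \<omega>) v0))
      \<and> (\<forall>\<epsilon>>0. \<exists>K. \<forall>n>0. (\<Sum>v0<n. prob_space.expectation M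
             (\<lambda>\<omega>. if wdeg n (w \<omega>) (G n \<omega>) v0 > K then wdeg n (w \<omega>) (G n \<omega>) v0 else 0)) / real n < \<epsilon>)
      \<and> prob_space \<rho> \<and> sets \<rho> = sets gs_borel
      \<and> local_conv2 M G \<rho>
      \<longrightarrow> (\<exists>\<nu>. prob_space \<nu> \<and> sets \<nu> = sets borel \<and>
             (\<lambda>n. prob_space.expectation M (\<lambda>\<omega>. levy_dist (esd n (Delta \<alpha> n (w \<omega>) (G n \<omega>))) \<nu>))
               \<longlonglongrightarrow> 0))"
proof -
  interpret iid_weights M w \<alpha>
  proof (intro iid_weights.intro iid_weights_axioms.intro)
    show "distr M borel (\<lambda>\<omega>. w \<omega> (fst p) (snd p)) = distr M borel (\<lambda>\<omega>. w \<omega> (fst q) (snd q))"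
      if "fst p \<le> snd p" "fst q \<le> snd q" for p q
      using assms(5) that by blast
  qed (fact assms(1,2,4) | use assms(3) in blast)+
  show ?thesis
  proof (intro conjI allI impI; elim conjE)
    fix G :: "nat \<Rightarrow> nat \<Rightarrow> nat \<Rightarrow> bool" and \<rho>
    assume h: "\<forall>n. simple_graph_on n (G n)" "\<forall>n. \<forall>v0<n. integrable M (\<lambda>\<omega>. wdeg n (w \<omega>) (G n) v0)"
      "\<forall>\<epsilon>>0. \<exists>K. \<forall>n>0. (\<Sum>v0<n. expectation
             (\<lambda>\<omega>. if wdeg n (w \<omega>) (G n) v0 > K then wdeg n (w \<omega>) (G n) v0 else 0)) / real n < \<epsilon>"
      "local_conv G \<rho>"
    show "\<exists>\<nu>. prob_space \<nu> \<and> sets \<nu> = sets borel \<and>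
             (AE \<omega> in M. weak_conv_m (\<lambda>n. esd n (Delta \<alpha> n (w \<omega>) (G n))) \<nu>)"
      by (rule esd_deterministic_graphs[OF h(1)[rule_format] h(2)[rule_format] h(3)[rule_format] h(4)])
  next
    fix G :: "nat \<Rightarrow> 'a \<Rightarrow> nat \<Rightarrow> nat \<Rightarrow> bool" and \<rho>
    assume h: "\<forall>n \<omega>. simple_graph_on n (G n \<omega>)" "\<forall>n. G n \<in> M \<rightarrow>\<^sub>M count_space UNIV"
      "indep_set
            (sets (vimage_algebra (space M) (\<lambda>\<omega> n. G n \<omega>) (PiM UNIV (\<lambda>_. count_space UNIV))))
            (sets (vimage_algebra (space M) (\<lambda>\<omega> p. w \<omega> (fst p) (snd p)) (PiM UNIV (\<lambda>_. borel))))"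
      "\<forall>n. \<forall>v0<n. integrable M (\<lambda>\<omega>. wdeg n (w \<omega>) (G n \<omega>) v0)"
      "\<forall>\<epsilon>>0. \<exists>K. \<forall>n>0. (\<Sum>v0<n. expectation
             (\<lambda>\<omega>. if wdeg n (w \<omega>) (G n \<omega>) v0 > K then wdeg n (w \<omega>) (G n \<omega>) v0 else 0)) / real n < \<epsilon>"
      "prob_space \<rho>" "sets \<rho> = sets gs_borel" "local_conv2 M G \<rho>"
    show "\<exists>\<nu>. prob_space \<nu> \<and> sets \<nu> = sets borel \<and>
             (\<lambda>n. expectation (\<lambda>\<omega>. levy_dist (esd n (Delta \<alpha> n (w \<omega>) (G n \<omega>))) \<nu>)) \<longlonglongrightarrow> 0"
      by (rule levy_dist_random_graphs[OF h(1)[rule_format] h(2)[rule_format] h(3) h(4)[rule_format] h(5)[rule_format] h(6-8)])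
  qed
qed

end
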